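(* Let $p\in(0,\infty)$. Then the following two statements hold. (i) If $q\in(p,\infty)$, then $A_{p,\infty}(\mathbb R^n,\mathbb C^m)\subset A_{q,\infty}(\mathbb R^n,\mathbb C^m)$. Moreover, there exists a positive constant $C$, depending only on $m$, $p$, and $q$, such that, for any matrix weight $W$, $$[W]_{A_{q,\infty}(\mathbb R^n,\mathbb C^m)}\le C[W]_{A_{p,\infty}(\mathbb R^n,\mathbb C^m)}.$$ (ii) It holds that $$A_p(\mathbb R^n,\mathbb C^m)\subsetneqq A_{p,\infty}(\mathbb R^n,\mathbb C^m)\subset\bigcup_{q\in(0,\infty)}A_q(\mathbb R^n,\mathbb C^m).$$ Moreover, there exists a positive constant $C$, depending only on $m$ and $p$, such that, for any matrix weight $W$, $$[W]_{A_{p,\infty}(\mathbb R^n,\mathbb C^m)}\le C[W]_{A_p(\mathbb R^n,\mathbb C^m)},$$ where $C=1$ when $p\in(0,1]$.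
   Context: Fix $m,n\in\mathbb N$. $M_m(\mathbb C)$ is the set of complex $m\times m$ matrices and $\|\cdot\|$ is the operator norm induced by the Euclidean norm of $\mathbb C^m$. A cube in $\mathbb R^n$ has edges parallel to the coordinate axes and finite positive edge length (not necessarily open or closed). $\fint_E f:=\frac1{|E|}\int_E f$, $\log_+t:=\max\{0,\log t\}$. A matrix weight is a function $W:\mathbb R^n\to M_m(\mathbb C)$ such that $W(x)$ is nonnegative definite for every $x$, $W(x)$ is invertible for almost every $x$, and all entries of $W$ are locally integrable. Real powers $W^\alpha(x)$ are defined by the spectral theorem. $A_p=A_p(\mathbb R^n,\mathbb C^m)$ is the class of matrix weights with $[W]_{A_p}<\infty$, where $$[W]_{A_p}:=\sup_Q\operatorname*{ess\,sup}_{y\in Q}\fint_Q\|W^{1/p}(x)W^{-1/p}(y)\|^p\,dx\quad\text{if }p\in(0,1],$$ $$[W]_{A_p}:=\sup_Q\fint_Q\left[\fint_Q\|W^{1/p}(x)W^{-1/p}(y)\|^{p'}\,dy\right]^{p/p'}dx\quad\text{if }p\in(1,\infty),\ \tfrac1p+\tfrac1{p'}=1,$$ with suprema over all cubes $Q$. $A_{p,\infty}=A_{p,\infty}(\mathbb R^n,\mathbb C^m)$ is the class of matrix weights $W$ such that, for every cube $Q$, $\log_+\left(\fint_Q\|W^{1/p}(x)W^{-1/p}(\cdot)\|^p\,dx\right)\in L^1(Q)$, and $[W]_{A_{p,\infty}}:=\sup_Q\exp\left(\fint_Q\log\left(\fint_Q\|W^{1/p}(x)W^{-1/p}(y)\|^p\,dx\right)dy\right)<\infty$.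 For a matrix weight not satisfying the integrability condition, $[W]_{A_{p,\infty}}$ is understood as $+\infty$. *)

theory Defs
  imports "HOL-Probability.Essential_Supremum"
begin

section \<open>Matrices\<close>

definition mat_adjoint :: "complex^'m^'m \<Rightarrow> complex^'m^'m" where
  "mat_adjoint A = (\<chi> i j. cnj (A $ j $ i))"

definition unitary_mat :: "complex^'m^'m \<Rightarrow> bool" where
  "unitary_mat U \<longleftrightarrow> mat_adjoint U ** U = mat 1 \<and> U ** mat_adjoint U = mat 1"

definition diag_of :: "('m \<Rightarrow> real) \<Rightarrow> complex^'m^'m" where
  "diag_of d = (\<chi> i j. if i = j then complex_of_real (d i) else 0)"

text \<open>Over the complex numbers this condition already forces \<open>A\<close> to be Hermitian.\<close>

definition nonneg_definite :: "complex^'m^'m \<Rightarrow> bool" where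
  "nonneg_definite A \<longleftrightarrow>
     (\<forall>z. (\<Sum>i\<in>UNIV. (A *v z) $ i * cnj (z $ i)) \<in> \<real>\<^sub>\<ge>\<^sub>0)"

text \<open>
  If \<open>A = U D U*\<close> with \<open>U\<close> unitary and \<open>D\<close> real diagonal, then the power is
  \<open>U D^\<alpha> U*\<close>; by \<open>mat_rpow_eqI\<close> below it does not depend on the
  diagonalisation. As \<open>0 powr \<alpha> = 0\<close>, a negative power of a singular matrix is taken on
  the orthogonal complement of the kernel and is 0 on the kernel; for a matrix weight this concerns
  only a null set of points.
\<close>

definition mat_rpow :: "complex^'m^'m \<Rightarrow> real \<Rightarrow> complex^'m^'m" where
  "mat_rpow A \<alpha> = (THE B. \<exists>U d. unitary_mat U \<and>
      A = U ** diag_of d ** mat_adjoint U \<and>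
      B = U ** diag_of (\<lambda>i. d i powr \<alpha>) ** mat_adjoint U)"

definition op_norm :: "complex^'m^'m \<Rightarrow> real" where
  "op_norm A = onorm ((*v) A)"

lemma diag_of_mult_nth: "(diag_of d ** A) $ i $ j = of_real (d i) * A $ i $ j"
  by (simp add: diag_of_def matrix_matrix_mult_def if_distrib[of "\<lambda>x. x * _"] cong: if_cong)

lemma mult_diag_of_nth: "(A ** diag_of d) $ i $ j = A $ i $ j * of_real (d j)"
  by (simp add: diag_of_def matrix_matrix_mult_def if_distrib cong: if_cong)

lemma mat_rpow_eqI:
  fixes U :: "complex^'m^'m"
  assumes U: "unitary_mat U" and A: "A = U ** diag_of d ** mat_adjoint U"
  shows "mat_rpow A \<alpha> = U ** diag_of (\<lambda>i. d i powr \<alpha>) ** mat_adjoint U"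
  unfolding mat_rpow_def
proof (rule the_equality)
  fix B assume "\<exists>V e. unitary_mat V \<and> A = V ** diag_of e ** mat_adjoint V \<and>
      B = V ** diag_of (\<lambda>i. e i powr \<alpha>) ** mat_adjoint V"
  then obtain V e where V: "unitary_mat V" and AV: "A = V ** diag_of e ** mat_adjoint V"
    and B: "B = V ** diag_of (\<lambda>i. e i powr \<alpha>) ** mat_adjoint V" by blast
  have UU: "mat_adjoint U ** U = mat 1" "U ** mat_adjoint U = mat 1"
    and VV: "mat_adjoint V ** V = mat 1" "V ** mat_adjoint V = mat 1"
    using U V by (auto simp: unitary_mat_def)
  define X where "X = mat_adjoint V ** U"
  have "diag_of e ** X = (mat_adjoint V ** V) ** diag_of e ** mat_adjoint V ** U"
    by (simp add: VV X_def matrix_mul_assoc)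
  also have "\<dots> = mat_adjoint V ** A ** U"
    by (simp add: AV matrix_mul_assoc)
  also have "\<dots> = mat_adjoint V ** U ** diag_of d ** (mat_adjoint U ** U)"
    by (simp add: A matrix_mul_assoc)
  also have "\<dots> = X ** diag_of d"
    by (simp add: UU X_def)
  finally have eq: "diag_of e ** X = X ** diag_of d" .
  have "(diag_of (\<lambda>i. e i powr \<alpha>) ** X) $ i $ j = (X ** diag_of (\<lambda>i. d i powr \<alpha>)) $ i $ j" for i j
  proof -
    have "(diag_of e ** X) $ i $ j = (X ** diag_of d) $ i $ j"
      by (simp add: eq)
    then show ?thesis
      by (auto simp: diag_of_mult_nth mult_diag_of_nth)
  qed
  then have eq': "diag_of (\<lambda>i. e i powr \<alpha>) ** X = X ** diag_of (\<lambda>i. d i powr \<alpha>)"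
    by (simp add: vec_eq_iff)
  have "B = V ** diag_of (\<lambda>i. e i powr \<alpha>) ** mat_adjoint V ** (U ** mat_adjoint U)"
    by (simp add: B UU)
  also have "\<dots> = V ** (diag_of (\<lambda>i. e i powr \<alpha>) ** X) ** mat_adjoint U"
    by (simp add: X_def matrix_mul_assoc)
  also have "\<dots> = (V ** mat_adjoint V) ** U ** diag_of (\<lambda>i. d i powr \<alpha>) ** mat_adjoint U"
    unfolding eq' by (simp add: X_def matrix_mul_assoc)
  finally show "B = U ** diag_of (\<lambda>i. d i powr \<alpha>) ** mat_adjoint U"
    by (simp add: VV)
qed (use U A in blast)

section \<open>Lebesgue measure and cubes\<close>

text \<open>
  The dimension \<open>n\<close> is a number rather than an index type, because constants that are
  independent of \<open>n\<close> have to be chosen before \<open>n\<close>. A point of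
  \<open>n\<close>-space is an extensional function on \<open>{..<n}\<close>; the completed product measure is
  Lebesgue measure.
\<close>

type_synonym 'm matrix_fun = "(nat \<Rightarrow> real) \<Rightarrow> complex^'m^'m"

definition lebesgue_n :: "nat \<Rightarrow> (nat \<Rightarrow> real) measure" where
  "lebesgue_n n = completion (PiM {..<n} (\<lambda>_. lborel))"

text \<open>Each edge is a bounded interval that may or may not contain its endpoints.\<close>

definition cubes :: "nat \<Rightarrow> (nat \<Rightarrow> real) set set" where
  "cubes n = {Q. \<exists>a l I. l > 0 \<and> Q = PiE {..<n} I \<and>
      (\<forall>i<n. {a i<..<a i + l} \<subseteq> I i \<and> I i \<subseteq> {a i..a i + l})}"

text \<open>\<open>compact\<close> refers to the product topology on \<open>nat \<Rightarrow> real\<close>, which induces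
  the Euclidean topology on the extensional functions on \<open>{..<n}\<close>.\<close>

definition locally_integrable :: "nat \<Rightarrow> ((nat \<Rightarrow> real) \<Rightarrow> complex) \<Rightarrow> bool" where
  "locally_integrable n f \<longleftrightarrow>
     (\<forall>K. compact K \<and> K \<subseteq> space (lebesgue_n n) \<longrightarrow> set_integrable (lebesgue_n n) K f)"

definition nn_average :: "'a measure \<Rightarrow> 'a set \<Rightarrow> ('a \<Rightarrow> ennreal) \<Rightarrow> ennreal" where
  "nn_average M E f = (\<integral>\<^sup>+x\<in>E. f x \<partial>M) / emeasure M E"

definition average :: "'a measure \<Rightarrow> 'a set \<Rightarrow> ('a \<Rightarrow> real) \<Rightarrow> real" where
  "average M E f = (LINT x:E|M. f x) / measure M E"

definition ennreal_powr :: "ennreal \<Rightarrow> real \<Rightarrow> ennreal" where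
  "ennreal_powr x a = (if x = \<infinity> then \<infinity> else ennreal (enn2real x powr a))"

definition log_plus :: "real \<Rightarrow> real" where
  "log_plus t = max 0 (ln t)"

section \<open>Matrix weights\<close>

definition matrix_weight :: "nat \<Rightarrow> 'm::finite matrix_fun \<Rightarrow> bool" where
  "matrix_weight n W \<longleftrightarrow>
     (\<forall>x\<in>space (lebesgue_n n). nonneg_definite (W x)) \<and>
     (AE x in lebesgue_n n. invertible (W x)) \<and>
     (\<forall>i j. locally_integrable n (\<lambda>x. W x $ i $ j))"

definition weight_ratio :: "real \<Rightarrow> 'm::finite matrix_fun \<Rightarrow> (nat \<Rightarrow> real) \<Rightarrow> (nat \<Rightarrow> real) \<Rightarrow> real" where
  "weight_ratio p W x y = op_norm (mat_rpow (W x) (1 / p) ** mat_rpow (W y) (- (1 / p)))"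

definition weight_average :: "nat \<Rightarrow> real \<Rightarrow> 'm::finite matrix_fun \<Rightarrow> (nat \<Rightarrow> real) set \<Rightarrow> (nat \<Rightarrow> real) \<Rightarrow> ennreal" where
  "weight_average n p W Q y =
     nn_average (lebesgue_n n) Q (\<lambda>x. ennreal (weight_ratio p W x y powr p))"

definition Ap_const :: "nat \<Rightarrow> real \<Rightarrow> 'm::finite matrix_fun \<Rightarrow> ennreal" where
  "Ap_const n p W =
     (if p \<le> 1 then
        (SUP Q\<in>cubes n. esssup (restrict_space (lebesgue_n n) Q) (weight_average n p W Q))
      else
        (let p' = p / (p - 1) in
         SUP Q\<in>cubes n. nn_average (lebesgue_n n) Q (\<lambda>x.
           ennreal_powr
             (nn_average (lebesgue_n n) Q (\<lambda>y. ennreal (weight_ratio p W x y powr p')))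
             (p / p'))))"

definition Ap_class :: "nat \<Rightarrow> real \<Rightarrow> 'm::finite matrix_fun set" where
  "Ap_class n p = {W. matrix_weight n W \<and> Ap_const n p W < \<infinity>}"

text \<open>
  For a matrix weight \<open>weight_average n p W Q y\<close> is finite for every \<open>y\<close>, because
  \<open>weight_ratio p W x y powr p\<close> is at most the operator norm of \<open>W x\<close> times a
  constant depending on \<open>y\<close>; so no information is lost by \<open>enn2real\<close>. It vanishes only
  for \<open>y\<close> in a null set, so the convention \<open>ln 0 = 0\<close> is harmless.
\<close>

definition Apinf_integrable :: "nat \<Rightarrow> real \<Rightarrow> 'm::finite matrix_fun \<Rightarrow> bool" where
  "Apinf_integrable n p W \<longleftrightarrow>
     (\<forall>Q\<in>cubes n. set_integrable (lebesgue_n n) Q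
        (\<lambda>y. log_plus (enn2real (weight_average n p W Q y))))"

text \<open>
  Under \<open>Apinf_integrable\<close> the logarithm itself is integrable on every cube, since its negative
  part is dominated by a constant plus \<open>log_plus\<close> of the operator norm of \<open>W y\<close>.
  Hence the Bochner integral below is never a default value.
\<close>

definition Apinf_const :: "nat \<Rightarrow> real \<Rightarrow> 'm::finite matrix_fun \<Rightarrow> ennreal" where
  "Apinf_const n p W =
     (if Apinf_integrable n p W then
        (SUP Q\<in>cubes n. ennreal (exp (average (lebesgue_n n) Q
           (\<lambda>y. ln (enn2real (weight_average n p W Q y))))))
      else \<infinity>)"

definition Apinf_class :: "nat \<Rightarrow> real \<Rightarrow> 'm::finite matrix_fun set" where
  "Apinf_class n p =
     {W. matrix_weight n W \<and> Apinf_integrable n p W \<and> Apinf_const n p W < \<infinity>}"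

end

theory Submission
  imports Defs "HOL-Probability.Probability_Measure"
begin

text \<open>
  Write \<open>A\<^sub>s\<close> for the power of \<open>A\<close> with real exponent \<open>s\<close>. Cordes' inequality
  \<open>\<parallel>A\<^sub>s B\<^sub>s\<parallel> \<le> \<parallel>A B\<parallel> powr s\<close> with \<open>s = p / q\<close> bounds the integrand in the definition of
  \<open>A_{q,\<infinity>}\<close> pointwise by the one for \<open>A_{p,\<infinity>}\<close>, so (i) holds with constant 1.

  A reducing operator of a cube \<open>Q\<close> is a matrix \<open>S\<^sub>Q\<close> for which
  \<open>\<parallel>S\<^sub>Q X\<parallel> powr p\<close> is comparable, uniformly in \<open>X\<close>, to the average over \<open>Q\<close> of
  \<open>\<parallel>W\<^bsub>1/p\<^esub> X\<parallel> powr p\<close>; it is the inverse of an Auerbach basis. Up to constants it turns the average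
  inside the logarithm into \<open>\<parallel>S\<^sub>Q W\<^bsub>-1/p\<^esub>(y)\<parallel> powr p\<close>, and Jensen's inequality compares \<open>A_{p,\<infinity>}\<close> with \<open>A_p\<close>.

  For the last inclusion let \<open>\<psi>\<^sub>Q = log_plus (\<parallel>S\<^sub>Q W\<^bsub>-1/p\<^esub>\<parallel> powr p)\<close>. Its average over \<open>Q\<close> is bounded
  uniformly in \<open>Q\<close>, and on a subcube \<open>R\<close> of \<open>Q\<close> the function \<open>\<psi>\<^sub>Q\<close> exceeds \<open>\<psi>\<^sub>R\<close> by at most
  a constant plus the average of \<open>\<psi>\<^sub>Q\<close> over \<open>R\<close>. A stopping-time argument as for the John--Nirenberg inequality
  bounds the averages of \<open>exp (\<delta> \<psi>\<^sub>Q)\<close> over \<open>Q\<close> uniformly in \<open>Q\<close> for some \<open>\<delta> > 0\<close>, and Cordes' inequality then gives \<open>A_q\<close> as soon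
  as \<open>1 / (q - 1) \<le> \<delta>\<close>. The inclusion of \<open>A_p\<close> in \<open>A_{p,\<infinity>}\<close> is strict because of the weight
  \<open>\<bar>x 0\<bar> powr (2 * p)\<close> times the identity.
\<close>

subsection \<open>Matrices over the complex numbers\<close>

text \<open>Each cube carries its own function \<open>\<psi> Q\<close>, so there is no single
  function of bounded mean oscillation to iterate on. Two of these functions are linked only through
  the number \<open>op_norm (S' ** matrix_inv S)\<close>, for the reducing operators
  \<open>S'\<close> of the cube and \<open>S\<close> of the subcube \<open>R\<close>. It can be
  controlled because it factors through the weight at almost every point of \<open>R\<close>: one
  factor is the one inside \<open>\<psi> Q\<close>, the other, \<open>dual_reduced\<close>, has a
  mean over \<open>R\<close> bounded by a power of the matrix size. Hence the form of the hypothesis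
  \<open>change\<close> in \<open>john_nirenberg\<close>.

  Reducing operators also answer noncommutativity: the weight at \<open>x\<close> and its inverse at
  \<open>y\<close> cannot be averaged separately until \<open>matrix_inv S ** S\<close> is placed
  between them. For \<open>p < 1\<close> the averaged expression need not be a norm even after
  taking roots, so the reducing operator is found by maximising a determinant, which rests on
  homogeneity and compactness instead of convexity.

  The dimension \<open>n\<close> enters the estimates only through the factor \<open>2 ^ n\<close>
  between a cube and its dyadic parent; it affects the \<open>q\<close> of the last inclusion but no
  constant in the inequalities.\<close>

definition cdot :: "complex^'m \<Rightarrow> complex^'m::finite \<Rightarrow> complex" where
  "cdot x y = (\<Sum>i\<in>UNIV. x $ i * cnj (y $ i))"

lemma cdot_add_left: "cdot (x + y) z = cdot x z + cdot y z"
  by (simp add: cdot_def distrib_right sum.distrib)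

lemma cdot_add_right: "cdot x (y + z) = cdot x y + cdot x z"
  by (simp add: cdot_def distrib_left sum.distrib)

lemma cdot_scale_left: "cdot (c *s x) y = c * cdot x y"
  by (simp add: cdot_def sum_distrib_left mult.assoc)

lemma cdot_scale_right: "cdot x (c *s y) = cnj c * cdot x y"
  by (simp add: cdot_def sum_distrib_left mult_ac)

lemma cdot_commute: "cdot y x = cnj (cdot x y)"
  by (simp add: cdot_def mult.commute)

text \<open>Adjoints and eigenvalues need the Hermitian form, while the norm and the Cauchy-Schwarz
  inequality refer to the real-valued \<open>inner\<close>; this identity passes between the
  two.\<close>

lemma inner_eq_Re_cdot: "inner x y = Re (cdot x y)"
  by (simp add: cdot_def inner_vec_def inner_complex_def)

lemma cdot_self: "cdot x x = of_real ((norm x)\<^sup>2)"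
proof -
  have "cdot x x \<in> \<real>"
    using cdot_commute[of x x] by (simp add: complex_is_Real_iff complex_eq_iff)
  then show ?thesis
    by (simp add: complex_is_Real_iff complex_eq_iff power2_norm_eq_inner inner_eq_Re_cdot)
qed

lemma cdot_adjoint: "cdot (A *v x) y = cdot x (mat_adjoint A *v y)"
  unfolding cdot_def mat_adjoint_def matrix_vector_mult_def
  by (simp add: sum_distrib_left sum_distrib_right)
    (subst sum.swap, simp add: mult_ac)

lemma cdot_axis_right: "cdot x (axis i 1) = x $ i"
  by (simp add: cdot_def axis_def if_distrib[of cnj] if_distrib[of "(*) _"] cong: if_cong)

lemma mat_adjoint_mult: "mat_adjoint (A ** B) = mat_adjoint B ** mat_adjoint (A :: complex^'m::finite^'m)"
  by (simp add: mat_adjoint_def matrix_matrix_mult_def vec_eq_iff mult.commute)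

lemma mat_adjoint_adjoint [simp]: "mat_adjoint (mat_adjoint A) = A"
  by (simp add: mat_adjoint_def vec_eq_iff)

lemma mat_adjoint_mat1 [simp]: "mat_adjoint (mat 1) = mat 1"
  by (auto simp: mat_adjoint_def vec_eq_iff mat_def)

lemma mat_adjoint_diag_of [simp]: "mat_adjoint (diag_of d) = diag_of d"
  by (auto simp: mat_adjoint_def vec_eq_iff diag_of_def)

lemma bounded_linear_matrix_vector: "bounded_linear ((*v) (A :: complex^'m::finite^'m))"
proof -
  have "linear ((*v) A)"
    by (rule linearI, rule matrix_vector_right_distrib)
      (simp add: vec_eq_iff matrix_vector_mult_def scaleR_sum_right)
  then show ?thesis by (simp add: linear_conv_bounded_linear)
qed

lemma norm_mult_le_op_norm: "norm (A *v x) \<le> op_norm A * norm x"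
  unfolding op_norm_def by (rule onorm[OF bounded_linear_matrix_vector])

lemma op_norm_nonneg [simp]: "0 \<le> op_norm (A :: complex^'m::finite^'m)"
  unfolding op_norm_def by (rule onorm_pos_le[OF bounded_linear_matrix_vector])

lemma op_norm_leI: "(\<And>x. norm (A *v x) \<le> b * norm x) \<Longrightarrow> op_norm A \<le> b"
  unfolding op_norm_def by (rule onorm_le)

lemma op_norm_mult_le: "op_norm (A ** B) \<le> op_norm A * op_norm (B :: complex^'m::finite^'m)"
proof (rule op_norm_leI)
  fix x
  have "norm (A *v (B *v x)) \<le> op_norm A * (op_norm B * norm x)"
    by (rule order_trans[OF norm_mult_le_op_norm]) (intro mult_left_mono norm_mult_le_op_norm op_norm_nonneg)
  then show "norm ((A ** B) *v x) \<le> op_norm A * op_norm B * norm x"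
    by (simp add: matrix_vector_mul_assoc mult.assoc)
qed

lemma op_norm_triangle: "op_norm (A + B) \<le> op_norm A + op_norm (B :: complex^'m::finite^'m)"
proof (rule op_norm_leI)
  fix x
  show "norm ((A + B) *v x) \<le> (op_norm A + op_norm B) * norm x"
    using norm_triangle_ineq[of "A *v x" "B *v x"] norm_mult_le_op_norm[of A x] norm_mult_le_op_norm[of B x]
    by (simp add: matrix_vector_mult_add_rdistrib distrib_right)
qed

lemma op_norm_scaleR_le: "op_norm (c *\<^sub>R A) \<le> \<bar>c\<bar> * op_norm (A :: complex^'m::finite^'m)"
proof (rule op_norm_leI)
  fix x
  have "(c *\<^sub>R A) *v x = c *\<^sub>R (A *v x)"
    by (simp add: vec_eq_iff matrix_vector_mult_def scaleR_sum_right)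
  then show "norm ((c *\<^sub>R A) *v x) \<le> \<bar>c\<bar> * op_norm A * norm x"
    using mult_left_mono[OF norm_mult_le_op_norm[of A x], of "\<bar>c\<bar>"] by (simp add: mult.assoc)
qed

text \<open>A convex function on a finite-dimensional space is continuous. Continuity of the
  operator norm, and with it Borel measurability, is obtained in this way.\<close>

lemma convex_on_op_norm: "convex_on UNIV (op_norm :: complex^'m::finite^'m \<Rightarrow> real)"
proof (rule convex_onI)
  fix t :: real and x y :: "complex^'m^'m" assume "0 < t" "t < 1"
  then show "op_norm ((1 - t) *\<^sub>R x + t *\<^sub>R y) \<le> (1 - t) * op_norm x + t * op_norm y"
    using op_norm_triangle[of "(1 - t) *\<^sub>R x" "t *\<^sub>R y"] op_norm_scaleR_le[of "1 - t" x] op_norm_scaleR_le[of t y]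
    by simp
qed simp

lemma continuous_on_op_norm: "continuous_on UNIV (op_norm :: complex^'m::finite^'m \<Rightarrow> real)"
  by (rule convex_on_continuous[OF open_UNIV convex_on_op_norm])

lemma inner_adjoint: "inner (A *v x) y = inner x (mat_adjoint A *v y)"
  by (simp add: inner_eq_Re_cdot cdot_adjoint)

lemma op_norm_adjoint_le: "op_norm (mat_adjoint A) \<le> op_norm A"
proof (rule op_norm_leI)
  fix x
  let ?y = "mat_adjoint A *v x"
  have "norm ?y * norm ?y = inner (A *v ?y) x"
    by (simp add: inner_adjoint[of A] norm_eq_sqrt_inner)
  also have "\<dots> \<le> norm (A *v ?y) * norm x"
    by (rule norm_cauchy_schwarz)
  also have "\<dots> \<le> op_norm A * norm ?y * norm x"
    by (intro mult_right_mono norm_mult_le_op_norm norm_ge_zero)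
  finally show "norm ?y \<le> op_norm A * norm x"
    by (cases "norm ?y = 0") (auto simp: mult_ac)
qed

lemma op_norm_adjoint [simp]: "op_norm (mat_adjoint A) = op_norm A"
  using op_norm_adjoint_le[of A] op_norm_adjoint_le[of "mat_adjoint A"] by simp

lemma op_norm_mat1: "op_norm (mat 1 :: complex^'m::finite^'m) = 1"
proof -
  have "op_norm (mat 1 :: complex^'m::finite^'m) \<le> 1"
    by (rule op_norm_leI) simp
  moreover have "norm (mat 1 *v (axis undefined 1 :: complex^'m)) \<le> op_norm (mat 1 :: complex^'m::finite^'m) * norm (axis undefined 1 :: complex^'m)"
    by (rule norm_mult_le_op_norm)
  ultimately show ?thesis by (simp add: norm_axis_1)
qed

lemma norm_column_le_op_norm: "norm (A *v axis i 1) \<le> op_norm A"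
  using norm_mult_le_op_norm[of A "axis i 1"] by (simp add: norm_axis_1)

lemma norm_vector_smult: "norm (c *s x) = cmod c * norm (x :: complex^'m::finite)"
  by (simp add: norm_vec_def vector_scalar_mult_def norm_mult L2_set_right_distrib)

lemma matrix_vector_axis_nth: "((A :: complex^'m::finite^'n::finite) *v axis j 1) $ i = A $ i $ j"
  by (simp add: matrix_vector_mult_def axis_def if_distrib[of "(*) _"] cong: if_cong)

lemma matrix_vector_sum_columns:
  "(A :: complex^'m::finite^'m) *v x = (\<Sum>j\<in>UNIV. (x $ j) *s (A *v axis j 1))"
  by (simp add: vec_eq_iff matrix_vector_axis_nth) (simp add: matrix_vector_mult_def mult.commute)

lemma op_norm_le_sum_columns: "op_norm A \<le> (\<Sum>j\<in>UNIV. norm (A *v axis j 1))"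
proof (rule op_norm_leI)
  fix x :: "complex^'a"
  have "A *v x = (\<Sum>j\<in>UNIV. (x $ j) *s (A *v axis j 1))" by (rule matrix_vector_sum_columns)
  also have "norm \<dots> \<le> (\<Sum>j\<in>UNIV. norm (x $ j) * norm (A *v axis j 1))"
    by (rule sum_norm_le) (simp add: norm_vector_smult)
  also have "\<dots> \<le> (\<Sum>j\<in>UNIV. norm x * norm (A *v axis j 1))"
    by (intro sum_mono mult_right_mono Finite_Cartesian_Product.norm_nth_le norm_ge_zero)
  finally show "norm (A *v x) \<le> (\<Sum>j\<in>UNIV. norm (A *v axis j 1)) * norm x"
    by (simp add: sum_distrib_left sum_distrib_right mult_ac)
qed

lemma op_norm_pos: "invertible A \<Longrightarrow> 0 < op_norm (A :: complex^'m::finite^'m)"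
proof (rule ccontr)
  assume "invertible A" "\<not> 0 < op_norm A"
  then have "op_norm A = 0" using op_norm_nonneg[of A] by linarith
  moreover obtain B where "A ** B = mat 1" using \<open>invertible A\<close> invertible_def by blast
  ultimately show False
    using op_norm_mult_le[of A B] op_norm_mat1[where 'm='m] by simp
qed

lemma nonneg_definite_cdot: "nonneg_definite A \<longleftrightarrow> (\<forall>z. cdot (A *v z) z \<in> \<real>\<^sub>\<ge>\<^sub>0)"
  by (simp add: nonneg_definite_def cdot_def)

text \<open>Polarisation: the form is real at \<open>x + y\<close> and at
  \<open>x + \<i> *s y\<close>, which makes the imaginary and the real part of
  \<open>?b y x - cnj (?b x y)\<close> vanish.\<close>

lemma nonneg_definite_self_adjoint:
  assumes "nonneg_definite A"
  shows "mat_adjoint A = A"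
proof -
  let ?b = "\<lambda>x y. cdot (A *v x) y"
  have im: "Im (?b z z) = 0" for z
    using assms by (auto simp: nonneg_definite_cdot complex_nonneg_Reals_iff)
  have sym: "?b y x = cnj (?b x y)" for x y
  proof -
    have 1: "?b (x + y) (x + y) = ?b x x + ?b x y + ?b y x + ?b y y"
      by (simp add: matrix_vector_right_distrib cdot_add_left cdot_add_right)
    have 2: "?b (x + \<i> *s y) (x + \<i> *s y) = ?b x x - \<i> * ?b x y + \<i> * ?b y x + ?b y y"
      by (simp add: matrix_vector_right_distrib cdot_add_left cdot_add_right vector_scalar_commute
         cdot_scale_left cdot_scale_right algebra_simps)
    show ?thesis
      using arg_cong[OF 1, of Im] arg_cong[OF 2, of Im] im by (simp add: complex_eq_iff)
  qed
  show ?thesis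
  proof (simp add: vec_eq_iff, intro allI)
    fix i j
    have e: "?b (axis j 1) (axis i 1) = A $ i $ j" for i j
      unfolding cdot_axis_right by (rule matrix_vector_axis_nth)
    show "mat_adjoint A $ i $ j = A $ i $ j"
      using sym[of "axis i 1" "axis j 1"] by (simp add: e mat_adjoint_def)
  qed
qed


section \<open>Spectral theorem for self-adjoint matrices\<close>

text \<open>The orthogonal complement \<open>S\<close> of the eigenvectors found so far is invariant
  under \<open>A\<close>. A maximiser of the quadratic form on its unit sphere is an eigenvector,
  because the first variation vanishes along the residual \<open>h\<close>, which again lies in
  \<open>S\<close>.\<close>

lemma self_adjoint_exists_eigenvector:
  fixes A :: "complex^'m::finite^'m" and I :: "'m set"
  assumes A: "mat_adjoint A = A" and fin: "I \<noteq> UNIV"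
    and eig: "\<And>i. i \<in> I \<Longrightarrow> \<exists>c. A *v v i = c *s v i"
  shows "\<exists>z (c::real). norm z = 1 \<and> (\<forall>i\<in>I. cdot z (v i) = 0) \<and> A *v z = of_real c *s z"
proof -
  define S where "S = {z. \<forall>i\<in>I. cdot z (v i) = 0}"
  have S_add: "x + y \<in> S" if "x \<in> S" "y \<in> S" for x y
    using that by (simp add: S_def cdot_add_left)
  have S_scale: "c *s x \<in> S" if "x \<in> S" for x c
    using that by (simp add: S_def cdot_scale_left)
  have scaleR: "c *\<^sub>R x = of_real c *s x" for c and x :: "complex^'m"
    by (simp add: vec_eq_iff) (simp add: scaleR_conv_of_real)
  have S_A: "A *v x \<in> S" if "x \<in> S" for x
  proof -
    have "cdot (A *v x) (v i) = 0" if i: "i \<in> I" for i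
    proof -
      obtain c where "A *v v i = c *s v i" using eig[OF i] by blast
      then show ?thesis
        using \<open>x \<in> S\<close> i by (simp add: cdot_adjoint A cdot_scale_right S_def)
    qed
    then show ?thesis by (simp add: S_def)
  qed
  obtain k where k: "k \<notin> I" using fin by blast
  \<comment> \<open>The rows outside \<open>I\<close> are zero, so \<open>R\<close> is singular, and
    a nonzero kernel vector is orthogonal to all \<open>v i\<close> with \<open>i\<close> in
    \<open>I\<close>. This shows that \<open>S\<close> is not trivial.\<close>
  define R :: "complex^'m^'m" where "R = (\<chi> i. if i \<in> I then (\<chi> j. cnj (v i $ j)) else 0)"
  have "row k R = 0" using k by (simp add: row_def R_def vec_eq_iff)
  then have "det R = 0" by (rule det_zero_row(1))
  then have "\<not> invertible R" by (simp add: invertible_det_nz)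
  then have "\<not> (\<exists>B. B ** R = mat 1)" by (simp add: invertible_left_inverse)
  then obtain z0 where z0: "R *v z0 = 0" "z0 \<noteq> 0"
    using matrix_left_invertible_ker[of R] by blast
  have z0S: "z0 \<in> S"
  proof -
    have "cdot z0 (v i) = (R *v z0) $ i" if "i \<in> I" for i
      using that by (simp add: cdot_def matrix_vector_mult_def R_def mult.commute)
    then show ?thesis using z0 by (simp add: S_def)
  qed
  define K where "K = {z \<in> S. norm z = 1}"
  have contc: "continuous_on UNIV (\<lambda>z. cdot z w)" for w :: "complex^'m"
    unfolding cdot_def by (intro continuous_intros)
  have clS: "closed S"
  proof -
    have "S = (\<Inter>i\<in>I. {z. cdot z (v i) = 0})" by (auto simp: S_def)
    moreover have "closed {z. cdot z (v i) = 0}" for i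
      by (rule closed_Collect_eq[OF contc continuous_on_const])
    ultimately show ?thesis by auto
  qed
  have "K = S \<inter> sphere 0 1" by (auto simp: K_def)
  then have compK: "compact K" using clS by (simp add: closed_Int_compact)
  have "inverse (norm z0) *\<^sub>R z0 \<in> K"
    unfolding K_def mem_Collect_eq
  proof
    show "inverse (norm z0) *\<^sub>R z0 \<in> S" by (subst scaleR) (rule S_scale[OF z0S])
  qed (simp add: z0(2))
  then have neK: "K \<noteq> {}" by blast
  have contA: "continuous_on UNIV ((*v) A)"
    by (rule linear_continuous_on[OF bounded_linear_matrix_vector])
  have contq: "continuous_on K (\<lambda>z. inner (A *v z) z)"
    by (intro continuous_intros continuous_on_subset[OF contA]) auto
  obtain z where zK: "z \<in> K" and zmax: "\<And>y. y \<in> K \<Longrightarrow> inner (A *v y) y \<le> inner (A *v z) z"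
    using continuous_attains_sup[OF compK neK contq] by blast
  define c where "c = inner (A *v z) z"
  have zS: "z \<in> S" and nz: "norm z = 1" using zK by (auto simp: K_def)
  have max: "inner (A *v y) y \<le> c * (norm y)\<^sup>2" if "y \<in> S" for y
  proof (cases "y = 0")
    case False
    have "inverse (norm y) *\<^sub>R y \<in> K"
      unfolding K_def mem_Collect_eq
    proof
      show "inverse (norm y) *\<^sub>R y \<in> S" by (subst scaleR) (rule S_scale[OF that])
    qed (simp add: False)
    from zmax[OF this] have "inner (A *v (inverse (norm y) *\<^sub>R y)) (inverse (norm y) *\<^sub>R y) \<le> c"
      by (simp add: c_def)
    moreover have "A *v (inverse (norm y) *\<^sub>R y) = inverse (norm y) *\<^sub>R (A *v y)"
      using linear_simps(5)[OF bounded_linear_matrix_vector] by blast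
    ultimately show ?thesis
      using False by (simp add: field_simps power2_eq_square)
  qed simp
  define h where "h = A *v z - c *\<^sub>R z"
  have hS: "h \<in> S"
    using S_add[OF S_A[OF zS] S_scale[OF zS, of "- of_real c"]] by (simp add: h_def scaleR)
  \<comment> \<open>Maximality at \<open>z\<close>, tested against the competitor
    \<open>z + t *\<^sub>R h\<close>. For a nonzero \<open>h\<close> the term linear in
    \<open>t\<close> would win for small positive \<open>t\<close>.\<close>
  have ineq: "2 * t * inner h h + t\<^sup>2 * (inner (A *v h) h - c * inner h h) \<le> 0" for t :: real
  proof -
    have mem: "z + t *\<^sub>R h \<in> S" using S_add[OF zS S_scale[OF hS, of "of_real t"]] by (simp add: scaleR)
    have Az: "A *v (z + t *\<^sub>R h) = A *v z + t *\<^sub>R (A *v h)"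
      using linear_simps(1,5)[OF bounded_linear_matrix_vector[of A]] by simp
    have sym: "inner (A *v h) z = inner (A *v z) h"
      by (subst inner_adjoint) (simp add: A inner_commute)
    have hz: "inner (A *v z) h = inner h h + c * inner z h"
      by (simp add: h_def algebra_simps inner_diff_left inner_diff_right)
    have "inner (A *v (z + t *\<^sub>R h)) (z + t *\<^sub>R h) = c + 2 * t * inner (A *v z) h + t\<^sup>2 * inner (A *v h) h"
      unfolding Az by (simp add: inner_add_left inner_add_right sym c_def power2_eq_square algebra_simps)
    moreover have "(norm (z + t *\<^sub>R h))\<^sup>2 = 1 + 2 * t * inner z h + t\<^sup>2 * inner h h"
      using nz unfolding power2_norm_eq_inner norm_eq_1
      by (simp add: inner_add_left inner_add_right inner_commute algebra_simps power2_eq_square)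
    ultimately show ?thesis
      using max[OF mem] by (simp add: hz algebra_simps)
  qed
  have "inner h h = 0"
  proof (rule ccontr)
    assume ne: "inner h h \<noteq> 0"
    then have pos: "0 < inner h h" using inner_ge_zero[of h] by linarith
    define b where "b = \<bar>inner (A *v h) h - c * inner h h\<bar>"
    define t where "t = inner h h / (b + 1)"
    have tpos: "0 < t" using pos by (simp add: t_def b_def)
    have "b * t < inner h h"
      using pos by (simp add: t_def b_def field_simps)
    then have "t * (b * t) < t * (2 * inner h h)"
      using tpos pos by (intro mult_strict_left_mono) linarith+
    moreover have "- (t\<^sup>2 * b) \<le> t\<^sup>2 * (inner (A *v h) h - c * inner h h)"
    proof -
      have "t\<^sup>2 * (- b) \<le> t\<^sup>2 * (inner (A *v h) h - c * inner h h)"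
        by (rule mult_left_mono) (auto simp: b_def)
      then show ?thesis by simp
    qed
    ultimately show False using ineq[of t] by (simp add: power2_eq_square algebra_simps)
  qed
  then have "A *v z = of_real c *s z" by (simp add: h_def scaleR)
  then show ?thesis using nz zS by (auto simp: S_def)
qed

lemma self_adjoint_orthonormal_eigenvectors:
  fixes A :: "complex^'m::finite^'m" and I :: "'m set"
  assumes A: "mat_adjoint A = A"
  shows "\<exists>v (d :: 'm \<Rightarrow> real). (\<forall>i\<in>I. A *v v i = of_real (d i) *s v i) \<and>
      (\<forall>i\<in>I. \<forall>j\<in>I. cdot (v i) (v j) = (if i = j then 1 else 0))"
  using finite[of I]
proof (induction I rule: finite_induct)
  case (insert k I)
  then obtain v d where v: "\<forall>i\<in>I. A *v v i = of_real (d i) *s v i"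
    "\<forall>i\<in>I. \<forall>j\<in>I. cdot (v i) (v j) = (if i = j then 1 else 0)" by blast
  have "I \<noteq> UNIV" using insert by blast
  then obtain z and c :: real where z: "norm z = 1" "\<forall>i\<in>I. cdot z (v i) = 0" "A *v z = of_real c *s z"
    using self_adjoint_exists_eigenvector[OF A, of I v] v(1) by blast
  have zz: "cdot z z = 1" using z(1) by (simp add: cdot_self)
  have z': "cdot (v i) z = 0" if "i \<in> I" for i
    using z(2) that cdot_commute[of "v i" z] by simp
  show ?case
    by (rule exI[of _ "v(k := z)"], rule exI[of _ "d(k := c)"]) (auto simp: insert(2) v z zz z')
qed simp

theorem self_adjoint_diagonalization:
  fixes A :: "complex^'m::finite^'m"
  assumes A: "mat_adjoint A = A"
  obtains U d where "unitary_mat U" "A = U ** diag_of d ** mat_adjoint U"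
proof -
  obtain v :: "'m \<Rightarrow> complex^'m" and d where vd: "\<forall>i\<in>UNIV. A *v v i = of_real (d i) *s v i"
    "\<forall>i\<in>UNIV. \<forall>j\<in>UNIV. cdot (v i) (v j) = (if i = j then 1 else 0)"
    using self_adjoint_orthonormal_eigenvectors[OF A, of UNIV]
    by blast
  then have v: "A *v v i = of_real (d i) *s v i"
    and o: "cdot (v i) (v j) = (if i = j then 1 else 0)" for i j by (blast, blast)
  define U :: "complex^'m^'m" where "U = (\<chi> i j. v j $ i)"
  have 1: "mat_adjoint U ** U = mat 1"
  proof (simp only: vec_eq_iff, intro allI)
    fix i j
    have "(mat_adjoint U ** U) $ i $ j = cdot (v j) (v i)"
      by (simp add: matrix_matrix_mult_def mat_adjoint_def U_def cdot_def mult.commute)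
    then show "(mat_adjoint U ** U) $ i $ j = mat 1 $ i $ j"
      by (auto simp: o mat_def)
  qed
  then have 2: "U ** mat_adjoint U = mat 1"
    using matrix_left_right_inverse by blast
  have "A ** U = U ** diag_of d"
  proof (simp only: vec_eq_iff, intro allI)
    fix i j
    have "(A ** U) $ i $ j = (A *v v j) $ i"
      by (simp add: matrix_matrix_mult_def matrix_vector_mult_def U_def)
    then show "(A ** U) $ i $ j = (U ** diag_of d) $ i $ j"
      by (simp add: v mult_diag_of_nth U_def mult.commute)
  qed
  then have "A ** (U ** mat_adjoint U) = U ** diag_of d ** mat_adjoint U"
    by (simp only: matrix_mul_assoc)
  then have "A = U ** diag_of d ** mat_adjoint U"
    by (simp only: 2 matrix_mul_rid)
  with 1 2 show ?thesis by (intro that[of U d]) (auto simp: unitary_mat_def)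
qed

subsection \<open>Powers of nonnegative definite matrices\<close>

lemma unitary_conj_mult:
  assumes "unitary_mat U"
  shows "(U ** M ** mat_adjoint U) ** (U ** N ** mat_adjoint U) = U ** (M ** N) ** mat_adjoint U"
proof -
  have "(U ** M ** mat_adjoint U) ** (U ** N ** mat_adjoint U)
      = U ** M ** (mat_adjoint U ** U) ** N ** mat_adjoint U"
    by (simp only: matrix_mul_assoc)
  also have "\<dots> = U ** M ** N ** mat_adjoint U"
    using assms by (simp only: unitary_mat_def matrix_mul_rid)
  also have "\<dots> = U ** (M ** N) ** mat_adjoint U"
    by (simp only: matrix_mul_assoc)
  finally show ?thesis .
qed

lemma diag_of_mult: "diag_of d ** diag_of e = diag_of (\<lambda>i. d i * e i)"
  by (simp add: vec_eq_iff diag_of_mult_nth) (simp add: diag_of_def)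

lemma diag_of_one: "diag_of (\<lambda>i. 1) = mat 1"
  by (simp add: vec_eq_iff diag_of_def mat_def)

lemma diag_of_vector: "(diag_of d *v x) $ i = of_real (d i) * x $ i"
  by (simp add: diag_of_def matrix_vector_mult_def if_distrib[of "\<lambda>x. x * _"] cong: if_cong)

lemma op_norm_diag_of_le:
  assumes "\<And>i. \<bar>d i\<bar> \<le> b"
  shows "op_norm (diag_of d :: complex^'m::finite^'m) \<le> b"
proof (rule op_norm_leI)
  fix x :: "complex^'m"
  have b: "0 \<le> b" using assms[of undefined] by linarith
  have "norm (diag_of d *v x) \<le> norm (b *\<^sub>R x)"
  proof (rule norm_le_componentwise_cart)
    fix i show "norm ((diag_of d *v x) $ i) \<le> norm ((b *\<^sub>R x) $ i)"
      unfolding diag_of_vector norm_mult vector_scaleR_component norm_scaleR norm_of_real abs_of_nonneg[OF b]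
      by (rule mult_right_mono[OF assms norm_ge_zero])
  qed
  also have "\<dots> = b * norm x" unfolding norm_scaleR abs_of_nonneg[OF b] ..
  finally show "norm (diag_of d *v x) \<le> b * norm x" .
qed

lemma op_norm_unitary_le: "unitary_mat (U :: complex^'m::finite^'m) \<Longrightarrow> op_norm U \<le> 1"
proof (rule op_norm_leI)
  fix x assume "unitary_mat U"
  then have "cdot (U *v x) (U *v x) = cdot x x"
    by (simp add: cdot_adjoint[of U] matrix_vector_mul_assoc unitary_mat_def)
  then have "norm (U *v x) = norm x"
    by (simp add: cdot_self del: of_real_power)
  then show "norm (U *v x) \<le> 1 * norm x" by simp
qed

lemma unitary_mat_adjoint: "unitary_mat U \<Longrightarrow> unitary_mat (mat_adjoint U)"
  by (simp add: unitary_mat_def)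

lemma op_norm_unitary_conj_le:
  assumes "unitary_mat (U :: complex^'m::finite^'m)"
  shows "op_norm (U ** M ** mat_adjoint U) \<le> op_norm M"
proof -
  have "op_norm (U ** M ** mat_adjoint U) \<le> op_norm U * op_norm M * op_norm (mat_adjoint U)"
    by (rule order_trans[OF op_norm_mult_le]) (intro mult_right_mono op_norm_mult_le op_norm_nonneg)
  also have "\<dots> \<le> 1 * op_norm M * 1"
    using op_norm_unitary_le[OF assms] op_norm_unitary_le[OF unitary_mat_adjoint[OF assms]]
    by (intro mult_mono) auto
  finally show ?thesis by simp
qed

lemma unitary_conj_eigenvector:
  fixes U :: "complex^'m::finite^'m"
  assumes "unitary_mat U"
  shows "(U ** diag_of d ** mat_adjoint U) *v (U *v axis i 1) = of_real (d i) *s (U *v axis i 1)"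
proof -
  have "(U ** diag_of d ** mat_adjoint U) *v (U *v axis i 1)
      = U *v (diag_of d *v ((mat_adjoint U ** U) *v axis i 1))"
    by (simp only: matrix_vector_mul_assoc matrix_mul_assoc)
  also have "\<dots> = U *v (diag_of d *v axis i 1)"
    using assms by (simp add: unitary_mat_def)
  also have "diag_of d *v axis i 1 = of_real (d i) *s axis i 1"
    by (simp add: vec_eq_iff diag_of_vector axis_def)
  finally show ?thesis by (simp add: vector_scalar_commute)
qed

lemma norm_unitary_axis: "unitary_mat U \<Longrightarrow> norm (U *v axis i 1) = 1"
proof -
  assume "unitary_mat U"
  then have "cdot (U *v axis i 1) (U *v axis i 1) = cdot (axis i 1) (axis i 1)"
    by (simp add: cdot_adjoint[of U] matrix_vector_mul_assoc unitary_mat_def)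
  then have "(norm (U *v axis i 1))\<^sup>2 = (norm (axis i 1 :: complex^'a))\<^sup>2"
    unfolding cdot_self by (simp only: of_real_eq_iff)
  moreover have "norm (axis i 1 :: complex^'a) = 1" by (simp add: norm_axis_1)
  ultimately have "(norm (U *v axis i 1))\<^sup>2 = 1\<^sup>2" by metis
  then show ?thesis by (rule power2_eq_imp_eq) simp_all
qed

lemma nonneg_definite_diagonalization:
  fixes A :: "complex^'m::finite^'m"
  assumes "nonneg_definite A"
  obtains U d where "unitary_mat U" "A = U ** diag_of d ** mat_adjoint U" "\<And>i. 0 \<le> d i"
proof -
  obtain U d where U: "unitary_mat U" and A: "A = U ** diag_of d ** mat_adjoint U"
    using self_adjoint_diagonalization[OF nonneg_definite_self_adjoint[OF assms]] by blast
  have "0 \<le> d i" for i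
  proof -
    let ?u = "U *v axis i 1"
    have "cdot (A *v ?u) ?u = of_real (d i)"
      unfolding A unitary_conj_eigenvector[OF U] cdot_scale_left cdot_self norm_unitary_axis[OF U] by simp
    moreover have "cdot (A *v ?u) ?u \<in> \<real>\<^sub>\<ge>\<^sub>0"
      using assms by (simp add: nonneg_definite_cdot)
    ultimately show ?thesis by simp
  qed
  with U A that show ?thesis by blast
qed

lemma nonneg_definite_unitary_diag:
  fixes U :: "complex^'m::finite^'m"
  assumes "\<And>i. 0 \<le> d i"
  shows "nonneg_definite (U ** diag_of d ** mat_adjoint U)"
  unfolding nonneg_definite_cdot
proof
  fix z
  let ?w = "mat_adjoint U *v z"
  have "cdot ((U ** diag_of d ** mat_adjoint U) *v z) z = cdot (U *v (diag_of d *v ?w)) z"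
    by (simp only: matrix_vector_mul_assoc matrix_mul_assoc)
  also have "\<dots> = (\<Sum>i\<in>UNIV. of_real (d i * (cmod (?w $ i))\<^sup>2))"
    unfolding cdot_adjoint[of U] unfolding cdot_def diag_of_vector of_real_mult complex_norm_square
    by (simp only: mult.assoc)
  also have "\<dots> \<in> \<real>\<^sub>\<ge>\<^sub>0"
    unfolding of_real_sum[symmetric] nonneg_Reals_of_real_iff
    by (intro sum_nonneg mult_nonneg_nonneg assms zero_le_power2)
  finally show "cdot ((U ** diag_of d ** mat_adjoint U) *v z) z \<in> \<real>\<^sub>\<ge>\<^sub>0" .
qed

lemma nonneg_definite_rpow: "nonneg_definite A \<Longrightarrow> nonneg_definite (mat_rpow A s)"
proof -
  assume "nonneg_definite A"
  from nonneg_definite_diagonalization[OF this] obtain U d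
    where U: "unitary_mat U" "A = U ** diag_of d ** mat_adjoint U" by blast
  show ?thesis
    unfolding mat_rpow_eqI[OF U] by (rule nonneg_definite_unitary_diag) simp
qed

lemmas mat_adjoint_rpow = nonneg_definite_self_adjoint[OF nonneg_definite_rpow]

text \<open>Because \<open>0 powr s = 0\<close> for every \<open>s\<close>, this also holds for singular matrices and exponents
  of either sign.\<close>

lemma mat_rpow_mult: "nonneg_definite A \<Longrightarrow> mat_rpow A s ** mat_rpow A t = mat_rpow A (s + t)"
proof -
  assume "nonneg_definite A"
  from nonneg_definite_diagonalization[OF this] obtain U d
    where U: "unitary_mat U" "A = U ** diag_of d ** mat_adjoint U" by blast
  have "mat_rpow A s ** mat_rpow A t = U ** (diag_of (\<lambda>i. d i powr s) ** diag_of (\<lambda>i. d i powr t)) ** mat_adjoint U"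
    by (simp only: mat_rpow_eqI[OF U] unitary_conj_mult[OF U(1)])
  also have "\<dots> = mat_rpow A (s + t)"
    by (simp only: mat_rpow_eqI[OF U] diag_of_mult powr_add)
  finally show ?thesis .
qed

lemma mat_rpow_rpow: "nonneg_definite A \<Longrightarrow> mat_rpow (mat_rpow A s) t = mat_rpow A (s * t)"
proof -
  assume "nonneg_definite A"
  from nonneg_definite_diagonalization[OF this] obtain U d
    where U: "unitary_mat U" "A = U ** diag_of d ** mat_adjoint U" by blast
  show ?thesis
    unfolding mat_rpow_eqI[OF U] mat_rpow_eqI[OF U(1) refl] by (simp add: powr_powr)
qed

lemma mat_rpow_one: "nonneg_definite A \<Longrightarrow> mat_rpow A 1 = A"
proof -
  assume "nonneg_definite A"
  from nonneg_definite_diagonalization[OF this] obtain U d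
    where U: "unitary_mat U" "A = U ** diag_of d ** mat_adjoint U" "\<And>i. 0 \<le> d i" by blast
  have "(\<lambda>i. d i powr 1) = d" using U(3) by auto
  then show ?thesis unfolding mat_rpow_eqI[OF U(1,2)] using U(2) by simp
qed

lemma mat_rpow_zero: "nonneg_definite A \<Longrightarrow> invertible A \<Longrightarrow> mat_rpow A 0 = mat 1"
proof -
  assume A: "nonneg_definite A" "invertible A"
  then obtain B where B: "A ** B = mat 1" by (auto simp: invertible_def)
  have A0: "mat_rpow A 0 ** A = A"
    using mat_rpow_mult[OF A(1), of 0 1] A by (simp add: mat_rpow_one)
  have "mat_rpow A 0 = mat_rpow A 0 ** (A ** B)" unfolding B by (simp only: matrix_mul_rid)
  also have "\<dots> = mat 1" unfolding matrix_mul_assoc A0 by (rule B)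
  finally show ?thesis .
qed

lemma mat_rpow_minus_mult:
  "nonneg_definite A \<Longrightarrow> invertible A \<Longrightarrow> mat_rpow A s ** mat_rpow A (- s) = mat 1"
  "nonneg_definite A \<Longrightarrow> invertible A \<Longrightarrow> mat_rpow A (- s) ** mat_rpow A s = mat 1"
  by (simp_all add: mat_rpow_mult mat_rpow_zero)

lemma invertible_mat_rpow:
  "nonneg_definite A \<Longrightarrow> invertible A \<Longrightarrow> invertible (mat_rpow A s)"
  unfolding invertible_def[of "mat_rpow A s"]
  by (rule exI[of _ "mat_rpow A (- s)"]) (simp add: mat_rpow_minus_mult)

text \<open>Since \<open>0 powr 0 = 0\<close>, the zeroth power is the orthogonal projection onto
  the range, which is the identity only for invertible matrices.\<close>

lemma mat_rpow_zero_op_norm_le: "nonneg_definite A \<Longrightarrow> op_norm (mat_rpow A 0) \<le> 1"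
proof -
  assume "nonneg_definite A"
  from nonneg_definite_diagonalization[OF this] obtain U d
    where U: "unitary_mat U" "A = U ** diag_of d ** mat_adjoint U" by blast
  show ?thesis
    unfolding mat_rpow_eqI[OF U]
    by (rule order_trans[OF op_norm_unitary_conj_le[OF U(1)] op_norm_diag_of_le]) auto
qed

lemma op_norm_rpow_le:
  fixes A :: "complex^'m::finite^'m"
  assumes "nonneg_definite A" "0 < s"
  shows "op_norm (mat_rpow A s) \<le> op_norm A powr s"
proof -
  from nonneg_definite_diagonalization[OF assms(1)] obtain U d
    where U: "unitary_mat U" "A = U ** diag_of d ** mat_adjoint U" and d: "\<And>i. 0 \<le> d i" by blast
  have "d i \<le> op_norm A" for i
    using norm_mult_le_op_norm[of A "U *v axis i 1"] d[of i]
    unfolding U(2) unitary_conj_eigenvector[OF U(1)]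
    by (simp add: norm_unitary_axis[OF U(1)] norm_vector_smult)
  then show ?thesis
    unfolding mat_rpow_eqI[OF U] using assms(2) d
    by (intro order_trans[OF op_norm_unitary_conj_le[OF U(1)] op_norm_diag_of_le])
      (auto simp: U(2)[symmetric] intro!: powr_mono2)
qed

lemma continuous_on_matrix_mult [continuous_intros]:
  fixes f g :: "'a::topological_space \<Rightarrow> complex^'m::finite^'m"
  assumes "continuous_on S f" "continuous_on S g"
  shows "continuous_on S (\<lambda>x. f x ** g x)"
  unfolding matrix_matrix_mult_def by (intro continuous_intros assms)

text \<open>The exponent varies, not the matrix. A zero eigenvalue contributes the constant 0 for
  every exponent, so continuity persists at exponent 0. It provides the maximum on which the proof
  of Cordes' inequality rests.\<close>

lemma continuous_on_mat_rpow:
  fixes A :: "complex^'m::finite^'m"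
  assumes "nonneg_definite A"
  shows "continuous_on UNIV (mat_rpow A)"
proof -
  from nonneg_definite_diagonalization[OF assms] obtain U d
    where U: "unitary_mat U" "A = U ** diag_of d ** mat_adjoint U" by blast
  have "continuous_on UNIV (\<lambda>s. complex_of_real (d i powr s))" for i
    by (cases "d i = 0") (auto intro!: continuous_intros)
  then have "continuous_on UNIV (\<lambda>s. if i = j then complex_of_real (d i powr s) else 0)" for i j
    by (cases "i = j") (auto intro!: continuous_intros)
  then have "continuous_on UNIV (\<lambda>s. diag_of (\<lambda>i. d i powr s) :: complex^'m^'m)"
    unfolding diag_of_def by (intro continuous_on_vec_lambda)
  then have "continuous_on UNIV (\<lambda>s. U ** diag_of (\<lambda>i. d i powr s) ** mat_adjoint U)"
    by (intro continuous_intros)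
  then show ?thesis unfolding mat_rpow_eqI[OF U] .
qed

section \<open>Cordes' inequality\<close>

text \<open>The eigenvector \<open>z\<close> of \<open>C\<^sup>*C\<close>, \<open>C = A\<^sup>uB\<^sup>u\<close>, for the top eigenvalue \<open>l = op_norm C ^ 2\<close> gives
  the eigenvector \<open>B\<^bsup>u-t\<^esup>z\<close> of the product \<open>(A\<^sup>sB\<^sup>s)\<^sup>*(A\<^sup>tB\<^sup>t)\<close> for the same eigenvalue.\<close>

lemma op_norm_rpow_mult_midpoint:
  fixes A B :: "complex^'m::finite^'m"
  assumes A: "nonneg_definite A" and B: "nonneg_definite B"
  defines "g \<equiv> \<lambda>s. op_norm (mat_rpow A s ** mat_rpow B s)"
  assumes u: "2 * u = s + t"
  shows "(g u)\<^sup>2 \<le> g s * g t"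
proof -
  define C where "C = mat_rpow A u ** mat_rpow B u"
  note adj = mat_adjoint_rpow[OF A] mat_adjoint_rpow[OF B]
  define X where "X = mat_adjoint C ** C"
  have X: "X = mat_rpow B u ** mat_rpow A (2 * u) ** mat_rpow B u"
  proof -
    have "X = mat_rpow B u ** (mat_rpow A u ** mat_rpow A u) ** mat_rpow B u"
      unfolding X_def C_def mat_adjoint_mult adj by (simp only: matrix_mul_assoc)
    then show ?thesis unfolding mat_rpow_mult[OF A] by simp
  qed
  have quad: "cdot (X *v z) z = of_real ((norm (C *v z))\<^sup>2)" for z
    by (simp add: X_def matrix_vector_mul_assoc[symmetric] cdot_adjoint[of "mat_adjoint C"] cdot_self
        del: of_real_power)
  have "nonneg_definite X" by (simp add: nonneg_definite_cdot quad del: of_real_power)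
  from nonneg_definite_diagonalization[OF this] obtain U d where
    U: "unitary_mat U" "X = U ** diag_of d ** mat_adjoint U" and d: "\<And>i. 0 \<le> d i" by blast
  obtain i where i: "\<And>j. d j \<le> d i"
  proof -
    have "Max (range d) \<in> range d" by (rule Max_in) auto
    then obtain i where "d i = Max (range d)" by (metis rangeE)
    then show ?thesis using that[of i] by simp
  qed
  have opC: "op_norm C \<le> sqrt (d i)"
  proof (rule op_norm_leI)
    fix z
    have "(norm (C *v z))\<^sup>2 = inner (X *v z) z"
      unfolding inner_eq_Re_cdot quad by simp
    also have "\<dots> \<le> norm (X *v z) * norm z" by (rule norm_cauchy_schwarz)
    also have "\<dots> \<le> (op_norm X * norm z) * norm z"
      by (intro mult_right_mono norm_mult_le_op_norm norm_ge_zero)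
    also have "\<dots> \<le> (d i * norm z) * norm z"
      unfolding U(2) using i d
      by (intro mult_right_mono order_trans[OF op_norm_unitary_conj_le[OF U(1)] op_norm_diag_of_le]) auto
    finally have "(norm (C *v z))\<^sup>2 \<le> (sqrt (d i) * norm z)\<^sup>2"
      using d[of i] by (simp add: power_mult_distrib power2_eq_square mult_ac)
    then show "norm (C *v z) \<le> sqrt (d i) * norm z"
      using d[of i] by (simp add: power2_le_iff_abs_le)
  qed
  then have gu: "(g u)\<^sup>2 \<le> d i"
    using power_mono[OF opC, of 2] d[of i] by (simp add: g_def C_def)
  have main: "(g u)\<^sup>2 \<le> g s * g t" if ts: "t \<le> s" and u: "2 * u = s + t" for s t
  proof (cases "d i = 0")
    case True
    then show ?thesis using gu by (auto simp: g_def intro: order_trans)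
  next
    case False
    define z where "z = U *v axis i 1"
    have Xz: "X *v z = of_real (d i) *s z"
      unfolding z_def U(2) by (rule unitary_conj_eigenvector[OF U(1)])
    have z: "norm z = 1" unfolding z_def by (rule norm_unitary_axis[OF U(1)])
    define w where "w = mat_rpow B (u - t) *v z"
    define Y where "Y = mat_rpow B s ** mat_rpow A s ** (mat_rpow A t ** mat_rpow B t)"
    \<comment> \<open>The shift \<open>u - t\<close> makes the exponents fit:
      \<open>t + (u - t) = u\<close>, \<open>s + t = 2 * u\<close> and
      \<open>s = (u - t) + u\<close>.\<close>
    have "Y ** mat_rpow B (u - t)
        = mat_rpow B s ** (mat_rpow A s ** mat_rpow A t) ** (mat_rpow B t ** mat_rpow B (u - t))"
      unfolding Y_def by (simp only: matrix_mul_assoc)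
    also have "\<dots> = mat_rpow B (u - t + u) ** mat_rpow A (2 * u) ** mat_rpow B u"
      using u by (simp add: mat_rpow_mult[OF A] mat_rpow_mult[OF B])
    also have "\<dots> = mat_rpow B (u - t) ** X"
      unfolding X mat_rpow_mult[OF B, symmetric] by (simp only: matrix_mul_assoc)
    finally have "Y *v w = mat_rpow B (u - t) *v (X *v z)"
      unfolding w_def by (simp only: matrix_vector_mul_assoc)
    then have Yw: "Y *v w = of_real (d i) *s w"
      unfolding Xz by (simp add: w_def vector_scalar_commute)
    have "w \<noteq> 0"
    proof
      assume w: "w = 0"
      have "X *v z = (mat_rpow B u ** mat_rpow A (2 * u) ** mat_rpow B t) *v w"
        unfolding w_def X matrix_vector_mul_assoc matrix_mul_assoc[symmetric] mat_rpow_mult[OF B] by simp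
      then have "X *v z = 0" using w by simp
      then show False using Xz False z by auto
    qed
    \<comment> \<open>\<open>Y\<close> need not be self-adjoint, but an eigenvalue of any matrix is
      bounded in modulus by the operator norm.\<close>
    have "d i * norm w = norm (Y *v w)"
      unfolding Yw using d[of i] by (simp add: norm_vector_smult)
    also have "\<dots> \<le> op_norm Y * norm w" by (rule norm_mult_le_op_norm)
    finally have "d i \<le> op_norm Y" using \<open>w \<noteq> 0\<close> by simp
    also have "\<dots> \<le> op_norm (mat_rpow B s ** mat_rpow A s) * g t"
      unfolding Y_def g_def by (rule op_norm_mult_le)
    also have "op_norm (mat_rpow B s ** mat_rpow A s) = g s"
      using op_norm_adjoint[of "mat_rpow A s ** mat_rpow B s"] by (simp add: g_def mat_adjoint_mult adj)
    finally show ?thesis using gu by linarith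
  qed
  show ?thesis
  proof (cases "t \<le> s")
    case True then show ?thesis using main u by blast
  next
    case False
    then have "(g u)\<^sup>2 \<le> g t * g s" using main[of s t] u by simp
    then show ?thesis by (simp add: mult.commute)
  qed
qed

text \<open>Cordes' inequality. Normalised to have value \<open>1\<close> at \<open>s = 1\<close>, the function \<open>s \<mapsto> op_norm (A\<^sup>sB\<^sup>s)\<close>
  is midpoint log-convex with value at most \<open>1\<close> at \<open>s = 0\<close>; compare its maximum on \<open>[0, 1]\<close>
  with the value at the reflected point.\<close>

theorem op_norm_rpow_mult_le:
  fixes A B :: "complex^'m::finite^'m"
  assumes A: "nonneg_definite A" and B: "nonneg_definite B"
    and pos: "0 < op_norm (A ** B)" and s: "0 \<le> s" "s \<le> 1"
  shows "op_norm (mat_rpow A s ** mat_rpow B s) \<le> op_norm (A ** B) powr s"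
proof -
  define c where "c = op_norm (A ** B)"
  define g where "g = (\<lambda>s. op_norm (mat_rpow A s ** mat_rpow B s))"
  define f where "f = (\<lambda>s. g s * c powr (- s))"
  have c: "0 < c" using pos by (simp add: c_def)
  have g0: "0 \<le> g s" for s by (simp add: g_def)
  have f_nn: "0 \<le> f s" for s by (simp add: f_def g0)
  have "continuous_on UNIV g" unfolding g_def
    by (rule continuous_on_compose2[OF continuous_on_op_norm])
      (auto intro!: continuous_intros continuous_on_mat_rpow A B)
  then have "continuous_on {0..1} f"
    unfolding f_def using c by (intro continuous_intros) (auto intro: continuous_on_subset)
  then obtain u where u: "u \<in> {0..1}" and umax: "\<And>s. s \<in> {0..1} \<Longrightarrow> f s \<le> f u"
    using continuous_attains_sup[of "{0..1::real}" f] by auto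
  have mid: "(f u)\<^sup>2 \<le> f s * f t" if "2 * u = s + t" for s t
  proof -
    have "(f u)\<^sup>2 = (g u)\<^sup>2 * c powr (- (s + t))"
      by (simp add: f_def power_mult_distrib power2_eq_square powr_add[symmetric] that[symmetric])
    also have "\<dots> \<le> (g s * g t) * c powr (- (s + t))"
      using op_norm_rpow_mult_midpoint[OF A B that] by (intro mult_right_mono) (auto simp: g_def)
    also have "\<dots> = f s * f t" by (simp add: f_def powr_add[of c "- s" "- t", simplified])
    finally show ?thesis .
  qed
  have "g 0 \<le> 1 * 1" unfolding g_def
    by (rule order_trans[OF op_norm_mult_le]) (intro mult_mono mat_rpow_zero_op_norm_le A B, auto)
  then have f0: "f 0 \<le> 1" using c by (simp add: f_def)
  have f1: "f 1 \<le> 1"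
    using c by (simp add: f_def g_def mat_rpow_one A B c_def[symmetric] powr_minus)
  have "(f u)\<^sup>2 \<le> f u"
  proof (cases "u \<le> 1 / 2")
    case True
    have "(f u)\<^sup>2 \<le> f 0 * f (2 * u)" by (rule mid) simp
    also have "\<dots> \<le> 1 * f u" using True u by (intro mult_mono f0 umax f_nn) auto
    finally show ?thesis by simp
  next
    case False
    have "(f u)\<^sup>2 \<le> f 1 * f (2 * u - 1)" by (rule mid) simp
    also have "\<dots> \<le> 1 * f u" using False u by (intro mult_mono f1 umax f_nn) auto
    finally show ?thesis by simp
  qed
  then have "f u \<le> 1" using f_nn[of u] by (cases "f u = 0") (auto simp: power2_eq_square)
  with umax[of s] s have "f s \<le> 1" by fastforce
  then have "g s \<le> c powr s" using c by (simp add: f_def powr_minus field_simps)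
  then show ?thesis by (simp add: g_def c_def)
qed


section \<open>Measurability of matrix functions and of matrix powers\<close>

lemma borel_measurable_matrix_mult [measurable]:
  fixes f g :: "'a \<Rightarrow> complex^'m::finite^'m"
  assumes [measurable]: "f \<in> borel_measurable M" "g \<in> borel_measurable M"
  shows "(\<lambda>x. f x ** g x) \<in> borel_measurable M"
  by (rule borel_measurable_continuous_Pair[OF assms]) (intro continuous_intros)

lemma borel_measurable_op_norm [measurable]:
  fixes f :: "'a \<Rightarrow> complex^'m::finite^'m"
  assumes "f \<in> borel_measurable M"
  shows "(\<lambda>x. op_norm (f x)) \<in> borel_measurable M"
  by (rule measurable_compose[OF assms borel_measurable_continuous_onI[OF continuous_on_op_norm]])

lemma borel_measurable_matrixI:
  fixes f :: "'a \<Rightarrow> complex^'m::finite^'n::finite"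
  assumes "\<And>i j. (\<lambda>x. f x $ i $ j) \<in> borel_measurable M"
  shows "f \<in> borel_measurable M"
  unfolding borel_measurable_euclidean_space[of f]
proof
  fix b :: "complex^'m^'n" assume "b \<in> Basis"
  then obtain i j c where b: "b = axis i (axis j c)" by (auto simp: Basis_vec_def)
  have "(\<lambda>x. inner (f x $ i $ j) c) \<in> borel_measurable M"
    by (rule borel_measurable_inner) (simp_all add: assms)
  then show "(\<lambda>x. inner (f x) b) \<in> borel_measurable M" by (simp add: b inner_axis)
qed

text \<open>Polynomials in a measurable matrix function are measurable, so the measurability of
  matrix powers is reached from them. The limit has to include the value 0 at 0, for exponents of
  either sign.\<close>

lemma powr_pointwise_limit_of_polynomials:
  fixes s :: real
  obtains a :: "nat \<Rightarrow> nat \<Rightarrow> real" and n :: "nat \<Rightarrow> nat"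
  where "\<And>t. 0 \<le> t \<Longrightarrow> (\<lambda>k. \<Sum>i\<le>n k. a k i * t ^ i) \<longlonglongrightarrow> t powr s"
proof -
  \<comment> \<open>Cutting off the base at \<open>1 / Suc k\<close> gives continuity for negative
    \<open>s\<close> as well; the second factor forces the value 0 at \<open>t = 0\<close>. Both
    changes disappear as soon as \<open>Suc k\<close> is at least \<open>1 / t\<close>.\<close>
  define f where "f = (\<lambda>(k::nat) (t::real). max t (1 / real (Suc k)) powr s * min 1 (real (Suc k) * t))"
  have f_eq: "f k t = t powr s" if "1 / t \<le> real (Suc k)" "0 < t" for k t
  proof -
    have "1 \<le> real (Suc k) * t" using that by (simp add: field_simps)
    moreover have "1 / real (Suc k) \<le> t" using that by (simp add: field_simps)
    ultimately show ?thesis by (simp add: f_def max_def)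
  qed
  have "\<exists>a n. \<forall>t\<in>{0..real k}. \<bar>f k t - (\<Sum>i\<le>n. a i * t ^ i)\<bar> < 1 / real (Suc k)" for k
  proof -
    have "continuous_on {0..real k} (f k)" unfolding f_def
      by (intro continuous_intros) (auto simp: max_def)
    then obtain g where g: "real_polynomial_function g" "\<And>t. t \<in> {0..real k} \<Longrightarrow> \<bar>f k t - g t\<bar> < 1 / real (Suc k)"
      using Stone_Weierstrass_real_polynomial_function[of "{0..real k}" "f k" "1 / real (Suc k)"] by auto
    obtain a n where "g = (\<lambda>x. \<Sum>i\<le>n. a i * x ^ i)"
      using real_polynomial_function_imp_sum[OF g(1)] by blast
    with g(2) show ?thesis by blast
  qed
  then obtain a n where an: "\<And>k t. t \<in> {0..real k} \<Longrightarrow> \<bar>f k t - (\<Sum>i\<le>n k. a k i * t ^ i)\<bar> < 1 / real (Suc k)"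
    by metis
  have "(\<lambda>k. \<Sum>i\<le>n k. a k i * t ^ i) \<longlonglongrightarrow> t powr s" if t: "0 \<le> t" for t
  proof -
    have ev: "\<forall>\<^sub>F k in sequentially. f k t = t powr s"
    proof (cases "t = 0")
      case False
      then show ?thesis
        using t by (intro eventually_sequentiallyI[of "nat \<lceil>1 / t\<rceil>"] f_eq) linarith+
    qed (simp add: f_def)
    have "\<forall>\<^sub>F k in sequentially. norm ((\<Sum>i\<le>n k. a k i * t ^ i) - t powr s) \<le> 1 / real (Suc k)"
      using ev eventually_ge_at_top[of "nat \<lceil>t\<rceil>"]
    proof eventually_elim
      case (elim k)
      have "t \<in> {0..real k}" using t elim by (simp add: nat_ceiling_le_eq)
      from an[OF this] elim show ?case by simp
    qed
    then have "(\<lambda>k. (\<Sum>i\<le>n k. a k i * t ^ i) - t powr s) \<longlonglongrightarrow> 0"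
      by (rule Lim_null_comparison) (use LIMSEQ_inverse_real_of_nat in \<open>simp add: inverse_eq_divide\<close>)
    then show ?thesis by (simp add: LIM_zero_iff)
  qed
  then show ?thesis by (rule that)
qed

lemma unitary_diag_power:
  fixes U :: "complex^'m::finite^'m"
  assumes "unitary_mat U"
  shows "(((**) (U ** diag_of d ** mat_adjoint U)) ^^ i) (mat 1) = U ** diag_of (\<lambda>j. d j ^ i) ** mat_adjoint U"
proof (induction i)
  case 0
  show ?case using assms by (simp add: diag_of_one unitary_mat_def)
next
  case (Suc i)
  show ?case by (simp add: Suc unitary_conj_mult[OF assms] diag_of_mult)
qed

lemma conj_diag_nth: "(U ** diag_of e ** V) $ i $ j = (\<Sum>k\<in>UNIV. U $ i $ k * of_real (e k) * V $ k $ j)"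
  unfolding matrix_matrix_mult_def[of "U ** diag_of e"] by (simp add: mult_diag_of_nth)

lemma unitary_diag_polynomial:
  fixes U :: "complex^'m::finite^'m"
  assumes "unitary_mat U"
  shows "(\<Sum>i\<le>n. a i *\<^sub>R (((**) (U ** diag_of d ** mat_adjoint U)) ^^ i) (mat 1))
    = U ** diag_of (\<lambda>j. \<Sum>i\<le>n. a i * d j ^ i) ** mat_adjoint U"
  unfolding unitary_diag_power[OF assms] vec_eq_iff
proof (intro allI)
  fix k l
  show "(\<Sum>i\<le>n. a i *\<^sub>R (U ** diag_of (\<lambda>j. d j ^ i) ** mat_adjoint U)) $ k $ l
      = (U ** diag_of (\<lambda>j. \<Sum>i\<le>n. a i * d j ^ i) ** mat_adjoint U) $ k $ l"
    unfolding sum_component vector_scaleR_component conj_diag_nth of_real_sum sum_distrib_left sum_distrib_right scaleR_sum_right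
    by (subst sum.swap) (intro sum.cong refl, simp add: scaleR_conv_of_real)
qed

lemma tendsto_unitary_diag:
  assumes "\<And>j. (\<lambda>k. e k j) \<longlonglongrightarrow> d j"
  shows "(\<lambda>k. U ** diag_of (e k) ** V) \<longlonglongrightarrow> U ** diag_of d ** (V :: complex^'m::finite^'m)"
proof (intro vec_tendstoI)
  fix i j
  show "(\<lambda>k. (U ** diag_of (e k) ** V) $ i $ j) \<longlonglongrightarrow> (U ** diag_of d ** V) $ i $ j"
    unfolding conj_diag_nth by (intro tendsto_intros assms)
qed

text \<open>Polynomials in \<open>W x\<close> avoid a measurable choice of the diagonalising unitary
  matrix: in any diagonalisation they act on the eigenvalues, so they converge to the power at each
  point.\<close>

lemma borel_measurable_mat_rpow:
  fixes W :: "'a \<Rightarrow> complex^'m::finite^'m"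
  assumes [measurable]: "W \<in> borel_measurable M" and W: "\<And>x. x \<in> space M \<Longrightarrow> nonneg_definite (W x)"
  shows "(\<lambda>x. mat_rpow (W x) s) \<in> borel_measurable M"
proof -
  obtain a n where an: "\<And>t. 0 \<le> t \<Longrightarrow> (\<lambda>k. \<Sum>i\<le>n k. a k i * t ^ i) \<longlonglongrightarrow> t powr s"
    using powr_pointwise_limit_of_polynomials[of s] by blast
  have pow: "(\<lambda>x. (((**) (W x)) ^^ i) (mat 1)) \<in> borel_measurable M" for i
    by (induction i) simp_all
  show ?thesis
  proof (rule borel_measurable_LIMSEQ_metric)
    show "(\<lambda>x. \<Sum>i\<le>n k. a k i *\<^sub>R (((**) (W x)) ^^ i) (mat 1)) \<in> borel_measurable M" for k
      by (intro borel_measurable_sum borel_measurable_scaleR pow) simp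
  next
    fix x assume "x \<in> space M"
    from nonneg_definite_diagonalization[OF W[OF this]] obtain U d
      where U: "unitary_mat U" "W x = U ** diag_of d ** mat_adjoint U" and d: "\<And>i. 0 \<le> d i" by blast
    show "(\<lambda>k. \<Sum>i\<le>n k. a k i *\<^sub>R (((**) (W x)) ^^ i) (mat 1)) \<longlonglongrightarrow> mat_rpow (W x) s"
      unfolding mat_rpow_eqI[OF U] unfolding U(2) unitary_diag_polynomial[OF U(1)]
      by (intro tendsto_unitary_diag an d)
  qed
qed

subsection \<open>Reducing operators\<close>

text \<open>Bounding every term by the largest one treats exponents below and above 1 alike.\<close>

lemma sum_powr_le:
  fixes x :: "'m::finite \<Rightarrow> real"
  assumes x: "\<And>j. 0 \<le> x j" and r: "0 < r"
  shows "(\<Sum>j\<in>UNIV. x j) powr r \<le> real CARD('m) powr r * (\<Sum>j\<in>UNIV. x j powr r)"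
proof -
  have "Max (range x) \<in> range x" by (rule Max_in) auto
  then obtain i where "x i = Max (range x)" by (metis rangeE)
  then have i: "x j \<le> x i" for j by simp
  have "(\<Sum>j\<in>UNIV. x j) \<le> real CARD('m) * x i"
    using sum_bounded_above[of UNIV x "x i"] i by simp
  then have "(\<Sum>j\<in>UNIV. x j) powr r \<le> (real CARD('m) * x i) powr r"
    using r x by (intro powr_mono2 sum_nonneg) auto
  also have "\<dots> = real CARD('m) powr r * x i powr r"
    using x by (intro powr_mult)
  also have "\<dots> \<le> real CARD('m) powr r * (\<Sum>j\<in>UNIV. x j powr r)"
    by (intro mult_left_mono member_le_sum) auto
  finally show ?thesis .
qed

lemma continuous_on_matrix_vector:
  "continuous_on S (\<lambda>A. A *v (z :: complex^'m::finite))"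
  unfolding matrix_vector_mult_def by (intro continuous_intros)

lemma borel_measurable_matrix_vector [measurable]:
  fixes f :: "'a \<Rightarrow> complex^'m::finite^'m"
  assumes "f \<in> borel_measurable M"
  shows "(\<lambda>x. f x *v z) \<in> borel_measurable M"
  by (rule measurable_compose[OF assms borel_measurable_continuous_onI[OF continuous_on_matrix_vector]])

lemma continuous_on_det: "continuous_on S (det :: complex^'m::finite^'m \<Rightarrow> complex)"
  unfolding det_def by (intro continuous_intros)

lemma norm_matrix_le:
  fixes V :: "complex^'m::finite^'m"
  assumes "\<And>j. norm (V *v axis j 1) \<le> b"
  shows "norm V \<le> (real CARD('m))\<^sup>2 * b"
proof -
  have e: "norm (V $ i $ j) \<le> b" for i j
  proof -
    have "V $ i $ j = (V *v axis j 1) $ i"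
      by (simp only: matrix_vector_axis_nth)
    then show ?thesis
      using Finite_Cartesian_Product.norm_nth_le[of "V *v axis j 1" i] assms[of j] by simp
  qed
  have "norm V \<le> (\<Sum>i\<in>UNIV. norm (V $ i))"
    unfolding norm_vec_def[of V] by (rule L2_set_le_sum) simp
  also have "\<dots> \<le> (\<Sum>i\<in>(UNIV :: 'm set). real CARD('m) * b)"
  proof (rule sum_mono)
    fix i
    have "norm (V $ i) \<le> (\<Sum>j\<in>UNIV. norm (V $ i $ j))"
      unfolding norm_vec_def[of "V $ i"] by (rule L2_set_le_sum) simp
    also have "\<dots> \<le> real CARD('m) * b"
      using sum_bounded_above[of UNIV "\<lambda>j. norm (V $ i $ j)" b] e by simp
    finally show "norm (V $ i) \<le> real CARD('m) * b" .
  qed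
  also have "\<dots> = (real CARD('m))\<^sup>2 * b" by (simp add: power2_eq_square)
  finally show ?thesis .
qed

text \<open>An Auerbach basis: among all matrices whose columns have \<open>\<rho>\<close>-size at most one, take one of
  maximal determinant. Cramer's rule bounds the coordinates of a vector in the basis of its columns.\<close>

lemma auerbach_basis:
  fixes \<rho> :: "complex^'m::finite \<Rightarrow> real"
  assumes r: "0 < r" and cont: "continuous_on UNIV \<rho>"
    and homogeneous: "\<And>c z. \<rho> (c *s z) = cmod c powr r * \<rho> z"
    and pos: "\<And>z. z \<noteq> 0 \<Longrightarrow> 0 < \<rho> z"
  obtains V :: "complex^'m^'m" where "invertible V" "\<And>j. \<rho> (V *v axis j 1) \<le> 1"
    "\<And>c j. cmod (c $ j) powr r \<le> \<rho> (V *v c)"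
proof -
  have rho0: "\<rho> 0 = 0" using homogeneous[of 0 0] r by simp
  have rho_nn: "0 \<le> \<rho> z" for z using pos[of z] rho0 by (cases "z = 0") auto
  define K where "K = {V :: complex^'m^'m. \<forall>j. \<rho> (V *v axis j 1) \<le> 1}"
  have contV: "continuous_on UNIV (\<lambda>V :: complex^'m^'m. \<rho> (V *v z))" for z
    by (rule continuous_on_compose2[OF cont continuous_on_matrix_vector]) simp
  have "closed (\<Inter>j. {V :: complex^'m^'m. \<rho> (V *v axis j 1) \<le> 1})"
    by (intro closed_INT ballI closed_Collect_le contV continuous_on_const)
  moreover have "(\<Inter>j. {V. \<rho> (V *v axis j 1) \<le> 1}) = K" by (auto simp: K_def)
  ultimately have closedK: "closed K" by simp
  have "norm (axis undefined 1 :: complex^'m) = 1" by (simp add: norm_axis_1)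
  then have "sphere (0 :: complex^'m) 1 \<noteq> {}" by (auto intro!: exI[of _ "axis undefined 1"])
  then obtain z1 where z1: "norm z1 = 1" and min: "\<And>z. norm z = 1 \<Longrightarrow> \<rho> z1 \<le> \<rho> z"
    using continuous_attains_inf[OF compact_sphere _ continuous_on_subset[OF cont subset_UNIV], of 0 1] by auto
  have c0: "0 < \<rho> z1" using pos[of z1] z1 by (cases "z1 = 0") auto
  \<comment> \<open>Homogeneity spreads the minimum over the unit sphere to all vectors. This bounds
    the columns of the matrices in \<open>K\<close> and makes \<open>K\<close> compact.\<close>
  have lower: "norm z powr r * \<rho> z1 \<le> \<rho> z" for z
  proof (cases "z = 0")
    case False
    define w where "w = of_real (inverse (norm z)) *s z"
    have "norm w = 1" using False by (simp add: w_def norm_vector_smult norm_inverse)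
    then have "\<rho> z1 \<le> \<rho> w" by (rule min)
    moreover have "of_real (norm z) *s w = z" using False by (simp add: w_def)
    then have "\<rho> z = norm z powr r * \<rho> w" using homogeneous[of "of_real (norm z)" w] by simp
    ultimately show ?thesis by (simp add: mult_left_mono)
  qed (simp add: rho0)
  have colb: "norm (V *v axis j 1) \<le> (1 / \<rho> z1) powr (1 / r)" if "V \<in> K" for V j
  proof -
    have "norm (V *v axis j 1) powr r * \<rho> z1 \<le> 1"
      using lower[of "V *v axis j 1"] that by (auto simp: K_def intro: order_trans)
    then have "norm (V *v axis j 1) powr r \<le> 1 / \<rho> z1" using c0 by (simp add: field_simps)
    then have "(norm (V *v axis j 1) powr r) powr (1 / r) \<le> (1 / \<rho> z1) powr (1 / r)"
      using r by (intro powr_mono2) auto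
    then show ?thesis using r by (simp add: powr_powr)
  qed
  have "bounded K"
    unfolding bounded_iff using norm_matrix_le[OF colb] by blast
  with closedK have compK: "compact K" by (simp add: compact_eq_bounded_closed)
  \<comment> \<open>\<open>T\<close> dominates every \<open>\<rho> (axis j 1)\<close>, so the
    multiple \<open>V0\<close> of the identity lies in \<open>K\<close>; as \<open>V0\<close> is
    invertible, the maximal determinant is not 0.\<close>
  define T where "T = 1 + (\<Sum>j\<in>UNIV. \<rho> (axis j 1))"
  have T: "1 \<le> T" unfolding T_def using rho_nn by (simp add: sum_nonneg)
  define V0 :: "complex^'m^'m" where "V0 = diag_of (\<lambda>_. T powr (- (1 / r)))"
  have V0e: "V0 *v axis j 1 = of_real (T powr (- (1 / r))) *s axis j 1" for j
    by (simp add: V0_def vec_eq_iff diag_of_vector axis_def)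
  have "V0 \<in> K"
  proof -
    have "\<rho> (V0 *v axis j 1) \<le> 1" for j
    proof -
      have "\<rho> (axis j 1) \<le> T"
        unfolding T_def using member_le_sum[of j UNIV "\<lambda>j. \<rho> (axis j 1)"] rho_nn by simp
      moreover have "\<rho> (V0 *v axis j 1) = \<rho> (axis j 1) / T"
        unfolding V0e homogeneous using T r by (simp add: powr_powr powr_minus divide_inverse norm_inverse inverse_powr)
      ultimately show ?thesis using T by simp
    qed
    then show ?thesis by (simp add: K_def)
  qed
  have "V0 ** diag_of (\<lambda>_. T powr (1 / r)) = mat 1"
    unfolding V0_def diag_of_mult using T by (simp add: powr_minus diag_of_one)
  then have "invertible V0" by (auto simp: invertible_right_inverse)
  then have det0: "det V0 \<noteq> 0" by (simp add: invertible_det_nz)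
  obtain V where VK: "V \<in> K" and Vmax: "\<And>V'. V' \<in> K \<Longrightarrow> cmod (det V') \<le> cmod (det V)"
    using continuous_attains_sup[OF compK _ continuous_on_norm[OF continuous_on_det[of K]]] \<open>V0 \<in> K\<close> by blast
  have detV: "det V \<noteq> 0" using Vmax[OF \<open>V0 \<in> K\<close>] det0 by auto
  then have invV: "invertible V" by (simp add: invertible_det_nz)
  have coord: "cmod (c $ j) powr r \<le> \<rho> (V *v c)" for c j
  proof (cases "V *v c = 0")
    case True
    obtain B where "B ** V = mat 1" using invV by (auto simp: invertible_def)
    then have "c = B *v (V *v c)" by (simp add: matrix_vector_mul_assoc)
    then have "c = 0" using True by simp
    then show ?thesis using rho_nn r by simp
  next
    case False
    define z where "z = V *v c"
    define t where "t = \<rho> z powr (1 / r)"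
    have z: "0 < \<rho> z" using pos False by (simp add: z_def)
    then have t: "0 < t" by (simp add: t_def)
    have tr: "t powr r = \<rho> z" using z r by (simp add: t_def powr_powr)
    define c' where "c' = of_real (inverse t) *s c"
    \<comment> \<open>Column \<open>j\<close> is exchanged for \<open>z\<close> scaled to
      \<open>\<rho>\<close>-size one, so the matrix stays in \<open>K\<close> and its determinant
      cannot exceed that of \<open>V\<close> in modulus.\<close>
    define V' where "V' = (\<chi> i k. if k = j then (V *v c') $ i else V $ i $ k)"
    have Vc': "V *v c' = of_real (inverse t) *s z"
      by (simp add: c'_def z_def vector_scalar_commute)
    have "\<rho> (V' *v axis k 1) \<le> 1" for k
    proof (cases "k = j")
      case True
      have "V' *v axis k 1 = V *v c'"
        using True by (simp add: V'_def matrix_vector_axis_nth vec_eq_iff)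
      then show ?thesis using z t by (simp add: Vc' homogeneous norm_inverse inverse_powr tr)
    next
      case False
      have "V' *v axis k 1 = V *v axis k 1"
        using False by (simp add: V'_def matrix_vector_axis_nth vec_eq_iff)
      then show ?thesis using VK by (simp add: K_def)
    qed
    then have "V' \<in> K" by (simp add: K_def)
    moreover have "det V' = c' $ j * det V" unfolding V'_def by (rule cramer_lemma)
    ultimately have "cmod (c' $ j) * cmod (det V) \<le> 1 * cmod (det V)"
      using Vmax[of V'] by (simp add: norm_mult)
    then have "cmod (c' $ j) \<le> 1" using detV by simp
    then have "cmod (c $ j) \<le> t" using t by (simp add: c'_def norm_mult norm_inverse norm_divide field_simps)
    then have "cmod (c $ j) powr r \<le> t powr r" using r by (intro powr_mono2) auto
    then show ?thesis unfolding tr z_def .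
  qed
  show ?thesis using that[OF invV _ coord] VK by (simp add: K_def)
qed

lemma op_norm_mult_powr_le:
  "0 \<le> r \<Longrightarrow> op_norm (A ** B) powr r \<le> op_norm A powr r * op_norm (B :: complex^'m::finite^'m) powr r"
  unfolding powr_mult[symmetric] by (intro powr_mono2 op_norm_mult_le) auto

lemma integrable_op_norm_mult_powr:
  fixes B :: "'a \<Rightarrow> complex^'m::finite^'m"
  assumes r: "0 \<le> r" and [measurable]: "B \<in> borel_measurable M" and int: "integrable M (\<lambda>x. op_norm (B x) powr r)"
  shows "integrable M (\<lambda>x. op_norm (B x ** X) powr r)"
  by (intro Bochner_Integration.integrable_bound[OF integrable_mult_left[OF int, of "op_norm X powr r"]])
    (auto simp: op_norm_mult_powr_le[OF r])

text \<open>Apply \<open>auerbach_basis\<close> to the mean of \<open>norm (B x *v z) powr r\<close>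
  as a function of \<open>z\<close>, and let \<open>S\<close> be the inverse of the basis. Estimates
  for vectors pass to matrices column by column.\<close>

theorem (in prob_space) reducing_operator:
  fixes B :: "'a \<Rightarrow> complex^'m::finite^'m"
  assumes r: "0 < r" and [measurable]: "B \<in> borel_measurable M"
    and int: "integrable M (\<lambda>x. op_norm (B x) powr r)" and inv: "AE x in M. invertible (B x)"
  obtains S :: "complex^'m^'m" where "invertible S"
    "\<And>X. op_norm (S ** X) powr r \<le> real CARD('m) powr (2 * r + 2) * (\<integral>x. op_norm (B x ** X) powr r \<partial>M)"
    "\<And>X. (\<integral>x. op_norm (B x ** X) powr r \<partial>M) \<le> real CARD('m) powr (2 * r + 2) * op_norm (S ** X) powr r"
proof -
  define \<rho> where "\<rho> z = (\<integral>x. norm (B x *v z) powr r \<partial>M)" for z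
  have bound: "norm (B x *v z) powr r \<le> op_norm (B x) powr r * norm z powr r" for x z
    using r by (subst powr_mult[symmetric]) (auto intro!: powr_mono2 norm_mult_le_op_norm)
  have integ: "integrable M (\<lambda>x. norm (B x *v z) powr r)" for z
    by (rule Bochner_Integration.integrable_bound[OF integrable_mult_left[OF int, of "norm z powr r"]])
      (auto simp: bound)
  have cont: "continuous_on UNIV \<rho>"
    unfolding continuous_on_sequentially
  proof (intro ballI allI impI, elim conjE)
    fix u :: "nat \<Rightarrow> complex^'m" and z assume u: "u \<longlonglongrightarrow> z"
    then have "bounded (range u)" by (rule convergent_imp_bounded)
    then obtain b where b: "\<And>n. norm (u n) \<le> b" by (auto simp: bounded_iff)
    have "(\<lambda>n. \<rho> (u n)) \<longlonglongrightarrow> \<rho> z"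
      unfolding \<rho>_def
    proof (rule integral_dominated_convergence)
      show "integrable M (\<lambda>x. op_norm (B x) powr r * b powr r)"
        by (rule integrable_mult_left[OF int])
      show "AE x in M. norm (norm (B x *v u n) powr r) \<le> op_norm (B x) powr r * b powr r" for n
        using r b by (auto intro!: AE_I2 order_trans[OF bound] mult_left_mono powr_mono2)
      show "AE x in M. (\<lambda>n. norm (B x *v u n) powr r) \<longlonglongrightarrow> norm (B x *v z) powr r"
        using r by (auto intro!: AE_I2 tendsto_powr' tendsto_norm tendsto_const
            isCont_tendsto_compose[OF linear_continuous_at[OF bounded_linear_matrix_vector] u])
    qed auto
    then show "(\<rho> \<circ> u) \<longlonglongrightarrow> \<rho> z" by (simp add: o_def)
  qed
  have homogeneous: "\<rho> (c *s z) = cmod c powr r * \<rho> z" for c z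
    unfolding \<rho>_def by (simp add: vector_scalar_commute norm_vector_smult powr_mult)
  \<comment> \<open>If the mean vanishes, then \<open>B x *v z = 0\<close> for almost every
    \<open>x\<close>, which invertibility excludes.\<close>
  have pos: "0 < \<rho> z" if "z \<noteq> 0" for z
  proof (rule ccontr)
    assume "\<not> 0 < \<rho> z"
    moreover have "0 \<le> \<rho> z" unfolding \<rho>_def by (rule integral_nonneg_AE) simp
    ultimately have "\<rho> z = 0" by simp
    then have "AE x in M. norm (B x *v z) powr r = 0"
      unfolding \<rho>_def by (subst (asm) integral_nonneg_eq_0_iff_AE[OF integ]) auto
    then have "AE x in M. False" using inv
    proof eventually_elim
      case (elim x)
      then obtain A where "A ** B x = mat 1" by (auto simp: invertible_def)
      then have "z = A *v (B x *v z)" by (simp add: matrix_vector_mul_assoc)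
      then show ?case using elim that by auto
    qed
    then show False by simp
  qed
  obtain V :: "complex^'m^'m" where V: "invertible V" "\<And>j. \<rho> (V *v axis j 1) \<le> 1"
      "\<And>c j. cmod (c $ j) powr r \<le> \<rho> (V *v c)"
    using auerbach_basis[OF r cont homogeneous pos] by blast
  obtain S :: "complex^'m^'m" where S: "V ** S = mat 1" "S ** V = mat 1" using V(1) by (auto simp: invertible_def)
  define m where "m = real CARD('m)"
  have m: "1 \<le> m" using zero_less_card_finite[where 'a='m] by (simp add: m_def Suc_leI)
  \<comment> \<open>Summing the coordinates of \<open>S *v z\<close> costs one factor
    \<open>m\<close>, and summing columns later costs another. The resulting
    \<open>m powr (2 * r)\<close> is then enlarged to the constant of the opposite estimate.\<close>
  have lower: "norm (S *v z) \<le> m * \<rho> z powr (1 / r)" for z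
  proof -
    have "cmod ((S *v z) $ j) \<le> \<rho> z powr (1 / r)" for j
    proof -
      have "V *v (S *v z) = z" by (simp add: matrix_vector_mul_assoc S)
      then have "cmod ((S *v z) $ j) powr r \<le> \<rho> z" using V(3)[of "S *v z" j] by simp
      then have "(cmod ((S *v z) $ j) powr r) powr (1 / r) \<le> \<rho> z powr (1 / r)"
        using r by (intro powr_mono2) auto
      then show ?thesis using r by (simp add: powr_powr)
    qed
    then have "(\<Sum>j\<in>UNIV. cmod ((S *v z) $ j)) \<le> m * \<rho> z powr (1 / r)"
      unfolding m_def using sum_bounded_above[of UNIV "\<lambda>j. cmod ((S *v z) $ j)"] by simp
    moreover have "norm (S *v z) \<le> (\<Sum>j\<in>UNIV. cmod ((S *v z) $ j))"
      unfolding norm_vec_def[of "S *v z"] by (rule L2_set_le_sum) simp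
    ultimately show ?thesis by linarith
  qed
  \<comment> \<open>Expanding \<open>z\<close> in the basis costs \<open>m powr r\<close> and a
    further \<open>m\<close> from the number of terms. The columns of a matrix cost the same again,
    which is the origin of \<open>2 * r + 2\<close>.\<close>
  have upper: "\<rho> z \<le> m powr (r + 1) * norm (S *v z) powr r" for z
  proof -
    define c where "c = S *v z"
    have "z = V *v c" by (simp add: c_def matrix_vector_mul_assoc S)
    have "norm (B x *v z) powr r \<le> m powr r * (\<Sum>j\<in>UNIV. norm c powr r * norm (B x *v (V *v axis j 1)) powr r)" for x
    proof -
      have "B x *v z = (\<Sum>j\<in>UNIV. (c $ j) *s (B x *v (V *v axis j 1)))"
        unfolding \<open>z = V *v c\<close> matrix_vector_mul_assoc by (rule matrix_vector_sum_columns)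
      then have "norm (B x *v z) \<le> (\<Sum>j\<in>UNIV. norm c * norm (B x *v (V *v axis j 1)))"
        by (auto intro!: sum_norm_le mult_right_mono Finite_Cartesian_Product.norm_nth_le simp: norm_vector_smult)
      then have "norm (B x *v z) powr r \<le> (\<Sum>j\<in>UNIV. norm c * norm (B x *v (V *v axis j 1))) powr r"
        using r by (intro powr_mono2) auto
      also have "\<dots> \<le> m powr r * (\<Sum>j\<in>UNIV. (norm c * norm (B x *v (V *v axis j 1))) powr r)"
        unfolding m_def using r by (intro sum_powr_le) auto
      finally show ?thesis by (simp add: powr_mult)
    qed
    then have "\<rho> z \<le> (\<integral>x. m powr r * (\<Sum>j\<in>UNIV. norm c powr r * norm (B x *v (V *v axis j 1)) powr r) \<partial>M)"
      unfolding \<rho>_def by (intro integral_mono integ Bochner_Integration.integrable_mult_right Bochner_Integration.integrable_sum) auto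
    also have "\<dots> = m powr r * (\<Sum>j\<in>UNIV. norm c powr r * \<rho> (V *v axis j 1))"
      unfolding \<rho>_def by (simp add: integ)
    also have "\<dots> \<le> m powr r * (\<Sum>j\<in>(UNIV :: 'm set). norm c powr r * 1)"
      by (intro mult_left_mono sum_mono V) auto
    also have "\<dots> = m powr (r + 1) * norm c powr r"
      using m by (simp add: m_def powr_add)
    finally show ?thesis by (simp add: c_def)
  qed
  have opint: "integrable M (\<lambda>x. op_norm (B x ** X) powr r)" for X
    by (rule integrable_op_norm_mult_powr) (use r int in auto)
  show ?thesis
  proof (rule that)
    show "invertible S" using S by (auto simp: invertible_def)
  next
    fix X :: "complex^'m^'m"
    let ?I = "\<integral>x. op_norm (B x ** X) powr r \<partial>M"
    have I: "0 \<le> ?I" by (rule integral_nonneg_AE) simp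
    have "\<rho> (X *v axis j 1) \<le> ?I" for j
      unfolding \<rho>_def using r
      by (intro integral_mono integ opint powr_mono2)
        (auto simp: matrix_vector_mul_assoc norm_column_le_op_norm)
    then have "\<rho> (X *v axis j 1) powr (1 / r) \<le> ?I powr (1 / r)" for j
      using r by (intro powr_mono2) (auto simp: \<rho>_def intro!: integral_nonneg_AE)
    then have "norm (S *v (X *v axis j 1)) \<le> m * ?I powr (1 / r)" for j
      using m by (intro order_trans[OF lower] mult_left_mono) auto
    then have "op_norm (S ** X) \<le> m * (m * ?I powr (1 / r))"
      using sum_bounded_above[of UNIV "\<lambda>j. norm ((S ** X) *v axis j 1)" "m * ?I powr (1 / r)"]
      by (intro order_trans[OF op_norm_le_sum_columns]) (simp add: m_def matrix_vector_mul_assoc)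
    then have "op_norm (S ** X) powr r \<le> (m * (m * ?I powr (1 / r))) powr r"
      using r by (intro powr_mono2) auto
    also have "\<dots> = m powr (2 * r) * ?I"
      using r I m by (simp add: powr_mult powr_powr powr_add[symmetric] mult.assoc[symmetric])
    also have "\<dots> \<le> m powr (2 * r + 2) * ?I"
      using m I by (intro mult_right_mono powr_mono) auto
    finally show "op_norm (S ** X) powr r \<le> real CARD('m) powr (2 * r + 2) * ?I"
      unfolding m_def .
  next
    fix X :: "complex^'m^'m"
    have "op_norm (B x ** X) powr r \<le> m powr r * (\<Sum>j\<in>UNIV. norm (B x *v (X *v axis j 1)) powr r)" for x
    proof -
      have "op_norm (B x ** X) powr r \<le> (\<Sum>j\<in>UNIV. norm ((B x ** X) *v axis j 1)) powr r"
        using r by (intro powr_mono2 op_norm_le_sum_columns) auto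
      also have "\<dots> \<le> m powr r * (\<Sum>j\<in>UNIV. norm ((B x ** X) *v axis j 1) powr r)"
        unfolding m_def using r by (intro sum_powr_le) auto
      finally show ?thesis by (simp add: matrix_vector_mul_assoc)
    qed
    then have "(\<integral>x. op_norm (B x ** X) powr r \<partial>M)
        \<le> (\<integral>x. m powr r * (\<Sum>j\<in>UNIV. norm (B x *v (X *v axis j 1)) powr r) \<partial>M)"
      by (intro integral_mono opint Bochner_Integration.integrable_mult_right Bochner_Integration.integrable_sum integ) auto
    also have "\<dots> = m powr r * (\<Sum>j\<in>UNIV. \<rho> (X *v axis j 1))"
      unfolding \<rho>_def by (simp add: integ)
    also have "\<dots> \<le> m powr r * (\<Sum>j\<in>(UNIV :: 'm set). m powr (r + 1) * op_norm (S ** X) powr r)"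
      using r by (intro mult_left_mono sum_mono order_trans[OF upper] powr_mono2)
        (auto simp: matrix_vector_mul_assoc norm_column_le_op_norm)
    also have "\<dots> = (m powr r * m powr 1 * m powr (r + 1)) * op_norm (S ** X) powr r"
      using m by (simp add: m_def)
    also have "m powr r * m powr 1 * m powr (r + 1) = m powr (2 * r + 2)"
      unfolding powr_add[symmetric] by simp
    finally show "(\<integral>x. op_norm (B x ** X) powr r \<partial>M) \<le> real CARD('m) powr (2 * r + 2) * op_norm (S ** X) powr r"
      unfolding m_def .
  qed
qed

subsection \<open>Dyadic cells\<close>

lemma space_lebesgue_n: "space (lebesgue_n n) = PiE {..<n} (\<lambda>_. UNIV)"
  by (simp add: lebesgue_n_def space_PiM)

lemma sets_lebesgue_nI: "A \<in> sets (PiM {..<n} (\<lambda>_. lborel)) \<Longrightarrow> A \<in> sets (lebesgue_n n)"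
  by (simp add: lebesgue_n_def)

lemma emeasure_lebesgue_n_PiE:
  assumes "\<And>i. i < n \<Longrightarrow> A i \<in> sets lborel"
  shows "emeasure (lebesgue_n n) (PiE {..<n} A) = (\<Prod>i<n. emeasure lborel (A i))"
proof -
  interpret product_sigma_finite "\<lambda>_. lborel :: real measure"
    by (simp add: product_sigma_finite_def lborel.sigma_finite_measure_axioms)
  have "PiE {..<n} A \<in> sets (PiM {..<n} (\<lambda>_. lborel))"
    using assms by (intro sets_PiM_I_finite) auto
  then show ?thesis
    using emeasure_PiM[of "{..<n}" A] assms by (simp add: lebesgue_n_def)
qed

text \<open>Half-open, so that the cubes of one dyadic level partition the space exactly and not
  merely up to null sets.\<close>

definition hcube :: "nat \<Rightarrow> (nat \<Rightarrow> real) \<Rightarrow> real \<Rightarrow> (nat \<Rightarrow> real) set" where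
  "hcube n a l = PiE {..<n} (\<lambda>i. {a i..<a i + l})"

lemma hcube_in_cubes: "0 < l \<Longrightarrow> hcube n a l \<in> cubes n"
  unfolding cubes_def hcube_def
  by (auto intro!: exI[of _ a] exI[of _ l] exI[of _ "\<lambda>i. {a i..<a i + l}"])

lemma sets_PiM_hcube: "hcube n a l \<in> sets (PiM {..<n} (\<lambda>_. lborel))"
  unfolding hcube_def by (intro sets_PiM_I_finite) auto

lemmas sets_hcube = sets_lebesgue_nI[OF sets_PiM_hcube]

lemma emeasure_hcube: "0 \<le> l \<Longrightarrow> emeasure (lebesgue_n n) (hcube n a l) = ennreal (l ^ n)"
  unfolding hcube_def by (subst emeasure_lebesgue_n_PiE) (auto simp: prod_ennreal ennreal_power)

text \<open>An arbitrary cube lies between an open and a closed box of equal volume, and so does the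
  half-open cube; the two differ by a null set.\<close>

lemma cubeE:
  assumes "Q \<in> cubes n"
  obtains a l where "0 < l" "Q \<in> sets (lebesgue_n n)" "AE x in lebesgue_n n. x \<in> Q \<longleftrightarrow> x \<in> hcube n a l"
    "emeasure (lebesgue_n n) Q = ennreal (l ^ n)" "Q \<subseteq> PiE {..<n} (\<lambda>i. {a i..a i + l})"
proof -
  obtain a l I where l: "0 < l" and Q: "Q = PiE {..<n} I"
    and I: "\<And>i. i < n \<Longrightarrow> {a i<..<a i + l} \<subseteq> I i \<and> I i \<subseteq> {a i..a i + l}"
    using assms by (auto simp: cubes_def)
  \<comment> \<open>An edge is an open interval together with some of its two endpoints, hence
    Borel.\<close>
  have bor: "I i \<in> sets borel" if "i < n" for i
  proof -
    have "I i = {a i<..<a i + l} \<union> (I i \<inter> {a i, a i + l})"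
    proof
      show "I i \<subseteq> {a i<..<a i + l} \<union> (I i \<inter> {a i, a i + l})"
      proof
        fix x assume x: "x \<in> I i"
        then have "a i \<le> x" "x \<le> a i + l" using I[OF that] by auto
        then have "x \<in> {a i<..<a i + l} \<or> x = a i \<or> x = a i + l" by auto
        with x show "x \<in> {a i<..<a i + l} \<union> (I i \<inter> {a i, a i + l})" by blast
      qed
    qed (use I[OF that] in blast)
    moreover have "finite (I i \<inter> {a i, a i + l})" by auto
    then have "I i \<inter> {a i, a i + l} \<in> sets borel" by (intro borel_closed finite_imp_closed)
    ultimately show ?thesis by (metis borel_open open_greaterThanLessThan sets.Un)
  qed
  define Op where "Op = PiE {..<n} (\<lambda>i. {a i<..<a i + l})"
  define C where "C = PiE {..<n} (\<lambda>i. {a i..a i + l})"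
  have meas: "Op \<in> sets (lebesgue_n n)" "C \<in> sets (lebesgue_n n)" "Q \<in> sets (lebesgue_n n)"
    unfolding Op_def C_def Q using bor by (intro sets_lebesgue_nI sets_PiM_I_finite; simp)+
  have Op: "emeasure (lebesgue_n n) Op = ennreal (l ^ n)"
    unfolding Op_def using l by (subst emeasure_lebesgue_n_PiE) (auto simp: prod_ennreal ennreal_power)
  have C: "emeasure (lebesgue_n n) C = ennreal (l ^ n)"
    unfolding C_def using l by (subst emeasure_lebesgue_n_PiE) (auto simp: prod_ennreal ennreal_power)
  have sub: "Op \<subseteq> Q" "Q \<subseteq> C" "Op \<subseteq> hcube n a l" "hcube n a l \<subseteq> C"
    unfolding Op_def C_def Q hcube_def using I by (intro PiE_mono; auto)+
  have "emeasure (lebesgue_n n) (C - Op) = 0"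
    using meas sub Op C by (subst emeasure_Diff) auto
  then have "AE x in lebesgue_n n. x \<notin> C - Op"
    using meas by (intro AE_not_in) auto
  then have AE: "AE x in lebesgue_n n. x \<in> Q \<longleftrightarrow> x \<in> hcube n a l"
    by (rule AE_mp) (use sub in \<open>auto intro!: AE_I2\<close>)
  have "emeasure (lebesgue_n n) Q = ennreal (l ^ n)"
    using emeasure_mono[OF sub(1) meas(3)] emeasure_mono[OF sub(2) meas(2)] Op C by simp
  then show ?thesis using that[of l a] l meas AE sub by (auto simp: C_def)
qed

text \<open>The dyadic cube of side \<open>l / 2 ^ k\<close> containing \<open>y\<close>, in the
  grid anchored at \<open>a\<close>. Comparing integer parts makes membership in a common cell an
  equivalence relation by construction.\<close>

definition cell :: "nat \<Rightarrow> (nat \<Rightarrow> real) \<Rightarrow> real \<Rightarrow> nat \<Rightarrow> (nat \<Rightarrow> real) \<Rightarrow> (nat \<Rightarrow> real) set" where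
  "cell n a l k y = {z \<in> PiE {..<n} (\<lambda>_. UNIV). \<forall>i<n. \<lfloor>2 ^ k * (z i - a i) / l\<rfloor> = \<lfloor>2 ^ k * (y i - a i) / l\<rfloor>}"

lemma cell_eq_hcube:
  assumes "0 < l"
  shows "cell n a l k y = hcube n (\<lambda>i. a i + of_int \<lfloor>2 ^ k * (y i - a i) / l\<rfloor> * (l / 2 ^ k)) (l / 2 ^ k)"
proof -
  have "\<lfloor>2 ^ k * (s - b) / l\<rfloor> = j \<longleftrightarrow> s \<in> {b + of_int j * (l / 2 ^ k)..<b + of_int j * (l / 2 ^ k) + l / 2 ^ k}"
    for s b :: real and j :: int
    using assms by (simp add: floor_eq_iff field_simps)
  note * = this
  show ?thesis
  proof (rule set_eqI)
    fix z
    show "z \<in> cell n a l k y \<longleftrightarrow> z \<in> hcube n (\<lambda>i. a i + of_int \<lfloor>2 ^ k * (y i - a i) / l\<rfloor> * (l / 2 ^ k)) (l / 2 ^ k)"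
      unfolding cell_def hcube_def mem_Collect_eq PiE_iff * by auto
  qed
qed

lemma cell_self: "y \<in> PiE {..<n} (\<lambda>_. UNIV) \<Longrightarrow> y \<in> cell n a l k y"
  by (simp add: cell_def)

lemma cell_eq: "z \<in> cell n a l k y \<Longrightarrow> cell n a l k z = cell n a l k y"
  by (auto simp: cell_def)

text \<open>Halving inside the floor is integer division by 2, so the floors of level
  \<open>k + 1\<close> determine those of level \<open>k\<close>.\<close>

lemma cell_Suc_subset: "cell n a l (Suc k) y \<subseteq> cell n a l k y"
proof -
  have "\<lfloor>2 ^ k * s / l\<rfloor> = \<lfloor>2 ^ Suc k * s / l\<rfloor> div 2" for s
  proof -
    have "\<lfloor>2 ^ k * s / l\<rfloor> = \<lfloor>(2 ^ Suc k * s / l) / of_int 2\<rfloor>" by simp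
    also have "\<dots> = \<lfloor>2 ^ Suc k * s / l\<rfloor> div 2" by (rule floor_divide_real_eq_div) simp
    finally show ?thesis .
  qed
  then show ?thesis unfolding cell_def by auto
qed

lemma cell_antimono: "j \<le> k \<Longrightarrow> cell n a l k y \<subseteq> cell n a l j y"
proof (induction k rule: dec_induct)
  case (step k)
  show ?case by (rule order_trans[OF cell_Suc_subset step.IH])
qed simp

lemma cell_0: "0 < l \<Longrightarrow> y \<in> hcube n a l \<Longrightarrow> cell n a l 0 y = hcube n a l"
proof -
  assume l: "0 < l" and y: "y \<in> hcube n a l"
  have "\<lfloor>(y i - a i) / l\<rfloor> = 0" if "i < n" for i
    using l y that by (auto simp: hcube_def PiE_iff floor_eq_iff field_simps)
  then show ?thesis unfolding cell_eq_hcube[OF l] hcube_def by (intro PiE_cong) simp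
qed

lemma countable_cells: "countable (range (cell n a l k))"
proof -
  have "range (cell n a l k) \<subseteq> (\<lambda>j. {z \<in> PiE {..<n} (\<lambda>_. UNIV). \<forall>i<n. \<lfloor>2 ^ k * (z i - a i) / l\<rfloor> = j i}) ` PiE {..<n} (\<lambda>_. UNIV)"
  proof safe
    fix y
    show "cell n a l k y \<in> (\<lambda>j. {z \<in> PiE {..<n} (\<lambda>_. UNIV). \<forall>i<n. \<lfloor>2 ^ k * (z i - a i) / l\<rfloor> = j i}) ` PiE {..<n} (\<lambda>_. UNIV)"
      by (rule image_eqI[of _ _ "\<lambda>i\<in>{..<n}. \<lfloor>2 ^ k * (y i - a i) / l\<rfloor>"]) (auto simp: cell_def)
  qed
  moreover have "countable (PiE {..<n} (\<lambda>_. UNIV :: int set))" by (intro countable_PiE) auto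
  ultimately show ?thesis by (meson countable_image countable_subset)
qed

lemma emeasure_cell: "0 < l \<Longrightarrow> emeasure (lebesgue_n n) (cell n a l k y) = ennreal ((l / 2 ^ k) ^ n)"
  unfolding cell_eq_hcube by (rule emeasure_hcube) simp

lemma sets_PiM_cell: "0 < l \<Longrightarrow> cell n a l k y \<in> sets (PiM {..<n} (\<lambda>_. lborel))"
  unfolding cell_eq_hcube by (rule sets_PiM_hcube)

lemmas sets_cell = sets_lebesgue_nI[OF sets_PiM_cell]

lemma (in finite_measure) measure_approx_increasing_union:
  assumes "\<And>j. A j \<in> sets M" "incseq A" "0 < e"
  obtains N where "measure M ((\<Union>j. A j) - A N) < e"
proof -
  have "(\<lambda>j. measure M (A j)) \<longlonglongrightarrow> measure M (\<Union>j. A j)"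
    using assms by (intro finite_Lim_measure_incseq) auto
  then have "\<forall>\<^sub>F j in sequentially. dist (measure M (A j)) (measure M (\<Union>j. A j)) < e"
    using assms(3) by (rule tendstoD)
  then obtain N where "dist (measure M (A N)) (measure M (\<Union>j. A j)) < e"
    by (auto simp: eventually_sequentially)
  moreover have "measure M ((\<Union>j. A j) - A N) = measure M (\<Union>j. A j) - measure M (A N)"
    using assms by (intro finite_measure_Diff) auto
  ultimately show ?thesis using that[of N] by (simp add: dist_real_def)
qed

text \<open>The sets that can be approximated by unions of cells of a common level form a
  \<open>\<sigma>\<close>-algebra for which all coordinates are measurable.\<close>

lemma approximation_by_cells:
  fixes M :: "(nat \<Rightarrow> real) measure"
  assumes "finite_measure M" and sets: "sets M = sets (PiM {..<n} (\<lambda>_. lborel))"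
    and l: "0 < l" and S: "S \<in> sets M" and e: "0 < e"
  shows "\<exists>k D. D \<in> sets M \<and> (\<forall>y\<in>D. cell n a l k y \<subseteq> D) \<and> measure M ((S - D) \<union> (D - S)) < e"
proof -
  interpret finite_measure M by fact
  define \<Omega> :: "(nat \<Rightarrow> real) set" where "\<Omega> = PiE {..<n} (\<lambda>_. UNIV)"
  have space: "space M = \<Omega>" using sets_eq_imp_space_eq[OF sets] by (simp add: \<Omega>_def space_PiM)
  \<comment> \<open>Measurable unions of cells of level \<open>k\<close>, expressed by saturation.
    Such a set is saturated at every finer level too, which allows sets of different levels to be
    merged.\<close>
  define sat where "sat k D \<longleftrightarrow> D \<in> sets M \<and> (\<forall>y\<in>D. cell n a l k y \<subseteq> D)" for k D
  define \<C> where "\<C> = {S \<in> sets M. \<forall>e>0. \<exists>k D. sat k D \<and> measure M ((S - D) \<union> (D - S)) < e}"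
  have sat_mono: "sat k D" if "sat j D" "j \<le> k" for j k D
    using that cell_antimono[OF \<open>j \<le> k\<close>, of n a l] unfolding sat_def by blast
  have sat_C: "D \<in> \<C>" if "sat k D" for k D
    unfolding \<C>_def using that by (auto simp: sat_def intro!: exI[of _ k] exI[of _ D])
  have C_sets: "S \<in> sets M" if "S \<in> \<C>" for S using that by (simp add: \<C>_def)
  have C_approx: "\<exists>k D. sat k D \<and> measure M ((S - D) \<union> (D - S)) < e" if "S \<in> \<C>" "0 < e" for S e
    using that unfolding \<C>_def by blast
  have compl: "\<Omega> - S \<in> \<C>" if "S \<in> \<C>" for S
    unfolding \<C>_def
  proof (intro CollectI conjI allI impI)
    show "\<Omega> - S \<in> sets M" using C_sets[OF that] unfolding space[symmetric] by (rule sets.compl_sets)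
    fix e :: real assume "0 < e"
    with that obtain k D where D: "sat k D" "measure M ((S - D) \<union> (D - S)) < e"
      unfolding \<C>_def by blast
    have sub: "S \<subseteq> \<Omega>" "D \<subseteq> \<Omega>"
      using C_sets[OF that] D(1) unfolding sat_def space[symmetric] by (blast dest: sets.sets_into_space)+
    have "cell n a l k y \<subseteq> \<Omega> - D" if y: "y \<in> \<Omega> - D" for y
    proof
      fix z assume z: "z \<in> cell n a l k y"
      then have "y \<in> cell n a l k z" using y cell_eq[OF z] cell_self[of y n a l k] by (simp add: \<Omega>_def)
      moreover have "cell n a l k z \<subseteq> D" if "z \<in> D" using that D(1) unfolding sat_def by blast
      ultimately show "z \<in> \<Omega> - D" using y z by (auto simp: cell_def \<Omega>_def)
    qed
    moreover have "\<Omega> - D \<in> sets M" using D(1) unfolding space[symmetric] sat_def by blast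
    ultimately have "sat k (\<Omega> - D)" unfolding sat_def by blast
    moreover have "((\<Omega> - S) - (\<Omega> - D)) \<union> ((\<Omega> - D) - (\<Omega> - S)) = (S - D) \<union> (D - S)"
      using sub by blast
    ultimately show "\<exists>k D. sat k D \<and> measure M ((\<Omega> - S - D) \<union> (D - (\<Omega> - S))) < e"
      using D(2) by metis
  qed
  have un: "S \<union> T \<in> \<C>" if S: "S \<in> \<C>" and T: "T \<in> \<C>" for S T
    unfolding \<C>_def
  proof (intro CollectI conjI allI impI)
    show "S \<union> T \<in> sets M" using S T C_sets by blast
    fix e :: real assume e: "0 < e"
    obtain k D where D: "sat k D" "measure M ((S - D) \<union> (D - S)) < e / 2"
      using C_approx[OF S, of "e / 2"] e by auto
    obtain k' D' where D': "sat k' D'" "measure M ((T - D') \<union> (D' - T)) < e / 2"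
      using C_approx[OF T, of "e / 2"] e by auto
    have "sat (max k k') D" "sat (max k k') D'" using sat_mono D D' by simp_all
    then have "sat (max k k') (D \<union> D')" unfolding sat_def by blast
    moreover have "measure M ((S \<union> T - (D \<union> D')) \<union> (D \<union> D' - (S \<union> T)))
        \<le> measure M (((S - D) \<union> (D - S)) \<union> ((T - D') \<union> (D' - T)))"
      using C_sets[OF S] C_sets[OF T] D D' unfolding sat_def by (intro finite_measure_mono) auto
    moreover have "\<dots> \<le> measure M ((S - D) \<union> (D - S)) + measure M ((T - D') \<union> (D' - T))"
      using C_sets[OF S] C_sets[OF T] D D' unfolding sat_def by (intro measure_Un_le) auto
    ultimately show "\<exists>k D. sat k D \<and> measure M ((S \<union> T - D) \<union> (D - (S \<union> T))) < e"
      using D(2) D'(2) by (intro exI[of _ "max k k'"] exI[of _ "D \<union> D'"]) linarith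
  qed
  \<comment> \<open>A finite part of the union already has almost the full measure, and finite
    unions reach a common level.\<close>
  have UN: "(\<Union>j. A j) \<in> \<C>" if A: "range A \<subseteq> \<C>" for A :: "nat \<Rightarrow> _"
    unfolding \<C>_def
  proof (intro CollectI conjI allI impI)
    have AM: "A j \<in> sets M" for j using A C_sets by blast
    then show U: "(\<Union>j. A j) \<in> sets M" by blast
    fix e :: real assume e: "0 < e"
    define B where "B N = (\<Union>j\<le>N. A j)" for N
    have BC: "B N \<in> \<C>" for N
      by (induction N) (use A un in \<open>auto simp: B_def atMost_Suc Un_commute\<close>)
    have BU: "(\<Union>N. B N) = (\<Union>j. A j)" by (auto simp: B_def)
    have "incseq B" by (auto simp: B_def incseq_def intro: order_trans)
    then obtain N where N: "measure M ((\<Union>j. A j) - B N) < e / 2"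
      using measure_approx_increasing_union[of B "e / 2"] C_sets[OF BC] e unfolding BU by auto
    obtain k D where D: "sat k D" "measure M ((B N - D) \<union> (D - B N)) < e / 2"
      using C_approx[OF BC, of "e / 2" N] e by auto
    have "measure M (((\<Union>j. A j) - D) \<union> (D - (\<Union>j. A j))) \<le>
        measure M (((\<Union>j. A j) - B N) \<union> ((B N - D) \<union> (D - B N)))"
      using U C_sets[OF BC] D(1) unfolding sat_def
      by (intro finite_measure_mono) (auto simp: B_def)
    also have "\<dots> \<le> measure M ((\<Union>j. A j) - B N) + measure M ((B N - D) \<union> (D - B N))"
      using U C_sets[OF BC] D(1) unfolding sat_def by (intro measure_Un_le) auto
    finally show "\<exists>k D. sat k D \<and> measure M (((\<Union>j. A j) - D) \<union> (D - (\<Union>j. A j))) < e"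
      using D N by (intro exI[of _ k] exI[of _ D]) linarith
  qed
  have "{} \<in> \<C>" by (rule sat_C[of 0]) (simp add: sat_def)
  moreover have "\<C> \<subseteq> Pow \<Omega>" using C_sets sets.sets_into_space unfolding space[symmetric] by blast
  ultimately have sa: "sigma_algebra \<Omega> \<C>"
    unfolding sigma_algebra_iff2 using compl UN by blast
  define N where "N = sigma \<Omega> \<C>"
  have N: "space N = \<Omega>" "sets N = \<C>"
    using sa by (simp_all add: N_def sigma_algebra.sets_measure_of_eq sigma_algebra.space_measure_of_eq)
  have half: "{x \<in> \<Omega>. x i < c} \<in> \<C>" if i: "i < n" for i c
  proof -
    \<comment> \<open>The union of the cells whose right end in direction \<open>i\<close> is at
      most \<open>c\<close>. Cells are half-open, so their points satisfy \<open>x i < c\<close>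
      strictly, and shrinking cells exhaust the half-space.\<close>
    define D where "D k = {x \<in> \<Omega>. a i + (of_int \<lfloor>2 ^ k * (x i - a i) / l\<rfloor> + 1) * (l / 2 ^ k) \<le> c}" for k
    have "D k \<in> sets M" for k
    proof -
      have "(\<lambda>x. x i) \<in> borel_measurable M"
        unfolding measurable_cong_sets[OF sets refl]
        using measurable_component_singleton[of i "{..<n}" "\<lambda>_. lborel :: real measure"] i by simp
      then have "(\<lambda>x. 2 ^ k * (x i - a i) / l) \<in> borel_measurable M" by simp
      from measurable_compose[OF this borel_measurable_real_floor]
      have "(\<lambda>x. a i + (of_int \<lfloor>2 ^ k * (x i - a i) / l\<rfloor> + 1) * (l / 2 ^ k)) \<in> borel_measurable M"
        by (intro borel_measurable_add borel_measurable_times borel_measurable_const)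
      then show ?thesis unfolding D_def space[symmetric] by (rule borel_measurable_le) simp
    qed
    moreover have "z \<in> D k" if "y \<in> D k" "z \<in> cell n a l k y" for y z k
    proof -
      have "\<lfloor>2 ^ k * (z i - a i) / l\<rfloor> = \<lfloor>2 ^ k * (y i - a i) / l\<rfloor>" "z \<in> \<Omega>"
        using that(2) i by (simp_all add: cell_def \<Omega>_def)
      then show ?thesis using that(1) unfolding D_def by simp
    qed
    ultimately have "sat k (D k)" for k unfolding sat_def by blast
    then have "D k \<in> \<C>" for k by (rule sat_C)
    then have "(\<Union>k. D k) \<in> \<C>" by (intro UN) auto
    moreover have "(\<Union>k. D k) = {x \<in> \<Omega>. x i < c}"
    proof safe
      fix x k assume x: "x \<in> D k"
      then show "x \<in> \<Omega>" by (simp add: D_def)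
      have "2 ^ k * (x i - a i) / l < of_int \<lfloor>2 ^ k * (x i - a i) / l\<rfloor> + 1" by linarith
      then have "x i < a i + (of_int \<lfloor>2 ^ k * (x i - a i) / l\<rfloor> + 1) * (l / 2 ^ k)"
        using l by (simp add: field_simps)
      then show "x i < c" using x by (simp add: D_def)
    next
      fix x assume x: "x \<in> \<Omega>" "x i < c"
      have "(\<lambda>k. l * (1 / 2) ^ k) \<longlonglongrightarrow> l * 0" by (intro tendsto_intros LIMSEQ_realpow_zero) auto
      then have "\<forall>\<^sub>F k in sequentially. l * (1 / 2) ^ k < c - x i"
        using x by (intro order_tendstoD) auto
      then obtain k where k: "l / 2 ^ k < c - x i"
        by (auto simp: eventually_sequentially power_one_over)
      have "of_int \<lfloor>2 ^ k * (x i - a i) / l\<rfloor> \<le> 2 ^ k * (x i - a i) / l" by linarith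
      then have "of_int \<lfloor>2 ^ k * (x i - a i) / l\<rfloor> * (l / 2 ^ k) \<le> 2 ^ k * (x i - a i) / l * (l / 2 ^ k)"
        using l by (intro mult_right_mono) auto
      also have "\<dots> = x i - a i" using l by simp
      finally have "x \<in> D k" using k x by (simp add: D_def algebra_simps)
      then show "x \<in> (\<Union>k. D k)" by blast
    qed
    ultimately show ?thesis by simp
  qed
  \<comment> \<open>The coordinates generate the product \<open>\<sigma>\<close>-algebra, so the
    identity is measurable into it and every measurable set lies in \<open>\<C>\<close>.\<close>
  have "(\<lambda>x. x) \<in> measurable N (PiM {..<n} (\<lambda>_. lborel))"
  proof (rule measurable_PiM_single')
    fix i assume "i \<in> {..<n}"
    then have "(\<lambda>x. x i) \<in> borel_measurable N"
      unfolding borel_measurable_iff_less using half N by auto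
    then show "(\<lambda>x. x i) \<in> measurable N lborel" by simp
  qed (simp add: N \<Omega>_def)
  then have "(\<lambda>x. x) -` S \<inter> space N \<in> sets N"
    by (rule measurable_sets) (use S sets in simp)
  then have "S \<in> \<C>" using sets.sets_into_space[OF S] by (simp add: N space Int_absorb2)
  then show ?thesis using e unfolding \<C>_def sat_def by blast
qed

subsection \<open>A John--Nirenberg inequality\<close>

lemma emeasure_lebesgue_n: "A \<in> sets (PiM {..<n} (\<lambda>_. lborel)) \<Longrightarrow>
    emeasure (lebesgue_n n) A = emeasure (PiM {..<n} (\<lambda>_. lborel)) A"
  by (simp add: lebesgue_n_def)

section \<open>Almost everywhere bounds from averages over cells\<close>

text \<open>Otherwise every cell has density at most \<open>\<theta>\<close>. Summing over the cells
  of a close approximation \<open>D\<close> of \<open>S\<close> bounds the measure of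
  \<open>S \<inter> D\<close> by \<open>\<theta>\<close> times that of \<open>D\<close>, although
  both are close to the measure of \<open>S\<close>.\<close>

lemma cell_density:
  assumes l: "0 < l" and S: "S \<in> sets (PiM {..<n} (\<lambda>_. lborel))" "S \<subseteq> hcube n a l"
    and pos: "0 < emeasure (lebesgue_n n) S" and \<theta>: "0 < \<theta>" "\<theta> < (1::real)"
  shows "\<exists>k. \<exists>y\<in>hcube n a l.
    ennreal \<theta> * emeasure (lebesgue_n n) (cell n a l k y) < emeasure (lebesgue_n n) (S \<inter> cell n a l k y)"
proof (rule ccontr)
  assume neg: "\<not> ?thesis"
  define P where "P = (PiM {..<n} (\<lambda>_. lborel) :: (nat \<Rightarrow> real) measure)"
  define Q where "Q = hcube n a l"
  define M where "M = density P (indicator Q)"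
  have QP: "Q \<in> sets P" by (simp add: Q_def P_def sets_PiM_hcube)
  have setsM: "sets M = sets P" by (simp add: M_def)
  have emM: "emeasure M A = emeasure P (Q \<inter> A)" if "A \<in> sets P" for A
    using that QP unfolding M_def by (subst emeasure_density) (auto simp: indicator_inter_arith[symmetric] nn_integral_indicator)
  have emL: "emeasure P A = emeasure (lebesgue_n n) A" if "A \<in> sets P" for A
    using that by (simp add: emeasure_lebesgue_n P_def)
  have emQ: "emeasure P Q = ennreal (l ^ n)"
    using emL[OF QP] l by (simp add: Q_def emeasure_hcube)
  have fin: "finite_measure M"
    by standard (use emM[of "space P"] QP emQ in \<open>simp add: M_def sets.Int_space_eq2\<close>)
  interpret finite_measure M by fact
  have SP: "S \<in> sets P" "S \<subseteq> Q" using S by (simp_all add: P_def Q_def)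
  have emS: "emeasure M S = emeasure (lebesgue_n n) S"
    using emM[OF SP(1)] emL[OF SP(1)] SP(2) by (simp add: Int_absorb1)
  define s where "s = measure M S"
  have s: "0 < s" using pos unfolding emS[symmetric] emeasure_eq_measure s_def by simp
  \<comment> \<open>With this error, \<open>s - e < \<theta> * (s + e)\<close> would mean
    \<open>s * (1 - \<theta>) < e * (1 + \<theta>)\<close>, while the right side is at most
    \<open>2 * e = s * (1 - \<theta>)\<close>.\<close>
  define e where "e = s * (1 - \<theta>) / 2"
  have e: "0 < e" using s \<theta> by (simp add: e_def)
  obtain k D where D: "D \<in> sets M" "\<And>y. y \<in> D \<Longrightarrow> cell n a l k y \<subseteq> D"
    "measure M ((S - D) \<union> (D - S)) < e"
    using approximation_by_cells[OF fin _ l _ e, of n S a] SP(1) by (auto simp: setsM P_def)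
  define \<D> where "\<D> = cell n a l k ` (D \<inter> Q)"
  have cQ: "cell n a l k y \<subseteq> Q" if "y \<in> Q" for y
    using cell_antimono[of 0 k n a l y] cell_0[OF l] that by (simp add: Q_def)
  have extD: "y \<in> PiE {..<n} (\<lambda>_. UNIV)" if "y \<in> Q" for y using that by (auto simp: Q_def hcube_def PiE_iff)
  have UD: "\<Union>\<D> = D \<inter> Q"
  proof (intro equalityI subsetI)
    fix x assume "x \<in> \<Union>\<D>"
    then obtain y where "y \<in> D" "y \<in> Q" "x \<in> cell n a l k y" unfolding \<D>_def by blast
    then show "x \<in> D \<inter> Q" using D(2)[of y] cQ[of y] by blast
  next
    fix x assume x: "x \<in> D \<inter> Q"
    then have "x \<in> cell n a l k x" by (intro cell_self extD) simp
    then show "x \<in> \<Union>\<D>" using x unfolding \<D>_def by blast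
  qed
  have disj: "disjoint_family_on (\<lambda>R. R) \<D>"
    unfolding disjoint_family_on_def \<D>_def using cell_eq by blast
  have cnt: "countable \<D>"
    unfolding \<D>_def by (rule countable_subset[OF _ countable_cells[of n a l k]]) auto
  have setsD: "R \<in> sets P" if "R \<in> \<D>" for R
    using that sets_PiM_cell[OF l] unfolding \<D>_def P_def by blast
  have "emeasure M (S \<inter> D) = emeasure P (\<Union>R\<in>\<D>. S \<inter> R)"
  proof -
    have "Q \<inter> (S \<inter> D) = (\<Union>R\<in>\<D>. S \<inter> R)" using UD SP by blast
    then show ?thesis using emM[of "S \<inter> D"] SP D(1) setsM by simp
  qed
  also have "\<dots> = (\<integral>\<^sup>+R. emeasure P (S \<inter> R) \<partial>count_space \<D>)"
    using disj SP setsD by (intro emeasure_UN_countable cnt) (auto simp: disjoint_family_on_def)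
  also have "\<dots> \<le> (\<integral>\<^sup>+R. ennreal \<theta> * emeasure P R \<partial>count_space \<D>)"
  proof (rule nn_integral_mono)
    fix R assume "R \<in> space (count_space \<D>)"
    then obtain y where "y \<in> Q" "R = cell n a l k y" "R \<in> \<D>" by (auto simp: \<D>_def)
    then show "emeasure P (S \<inter> R) \<le> ennreal \<theta> * emeasure P R"
      using neg setsD[of R] SP emL[of R] emL[of "S \<inter> R"] by (auto simp: Q_def not_less)
  qed
  also have "\<dots> = ennreal \<theta> * emeasure P (\<Union>R\<in>\<D>. R)"
    using disj setsD by (subst emeasure_UN_countable[OF _ cnt]) (auto simp: nn_integral_cmult)
  also have "\<dots> = ennreal \<theta> * emeasure M D"
    using UD emM[of D] D(1) setsM by (simp add: Int_commute)
  finally have "measure M (S \<inter> D) \<le> \<theta> * measure M D"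
    using \<theta> by (simp add: emeasure_eq_measure ennreal_mult[symmetric])
  moreover have SM: "S \<in> sets M" using SP setsM by simp
  have "s \<le> measure M ((S \<inter> D) \<union> ((S - D) \<union> (D - S)))"
    unfolding s_def using SM D(1) by (intro finite_measure_mono) auto
  then have "s < measure M (S \<inter> D) + e"
    using measure_Un_le[of "S \<inter> D" M "(S - D) \<union> (D - S)"] SM D by simp
  moreover have "measure M D \<le> measure M (S \<union> ((S - D) \<union> (D - S)))"
    using SM D(1) by (intro finite_measure_mono) auto
  then have "measure M D < s + e"
    using measure_Un_le[of S M "(S - D) \<union> (D - S)"] SM D by (simp add: s_def)
  ultimately have "s - e < \<theta> * (s + e)"
    using mult_strict_left_mono[of "measure M D" "s + e" \<theta>] \<theta> by linarith
  then have "s * (1 - \<theta>) < e * (1 + \<theta>)" by (simp add: algebra_simps)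
  also have "\<dots> \<le> e * 2" using e \<theta> by (intro mult_left_mono) auto
  finally show False by (simp add: e_def)
qed

text \<open>A substitute for Lebesgue's differentiation theorem.\<close>

lemma AE_le_of_cell_averages:
  fixes f :: "(nat \<Rightarrow> real) \<Rightarrow> real"
  assumes l: "0 < l" and f[measurable]: "f \<in> borel_measurable (lebesgue_n n)"
    and nn: "\<And>x. 0 \<le> f x" and G: "G \<in> sets (lebesgue_n n)" "G \<subseteq> hcube n a l" and lam: "0 < lam"
    and avg: "\<And>y k. y \<in> G \<Longrightarrow> (\<integral>\<^sup>+x\<in>cell n a l k y. ennreal (f x) \<partial>lebesgue_n n)
        \<le> ennreal lam * emeasure (lebesgue_n n) (cell n a l k y)"
  shows "AE x in lebesgue_n n. x \<in> G \<longrightarrow> f x \<le> lam"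
proof -
  let ?L = "lebesgue_n n"
  have main: "AE x in ?L. x \<in> G \<longrightarrow> f x \<le> lam + 1 / real (Suc j)" for j
  proof -
    define \<epsilon> where "\<epsilon> = 1 / real (Suc j)"
    have \<epsilon>: "0 < \<epsilon>" by (simp add: \<epsilon>_def)
    define A where "A = {x \<in> space ?L. x \<in> G \<and> lam + \<epsilon> < f x}"
    have A[measurable]: "A \<in> sets ?L" unfolding A_def using G(1) by measurable
    have "emeasure ?L A = 0"
    proof (rule ccontr)
      assume ne: "emeasure ?L A \<noteq> 0"
      define P where "P = (PiM {..<n} (\<lambda>_. lborel) :: (nat \<Rightarrow> real) measure)"
      \<comment> \<open>\<open>A\<close> is measurable only for the completed measure; its main part
        has the same measure and lies in the uncompleted product \<open>\<sigma>\<close>-algebra, as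
        \<open>cell_density\<close> requires.\<close>
      define S where "S = main_part P A"
      have AP: "A \<in> sets (completion P)" using A by (simp add: lebesgue_n_def P_def)
      have SP: "S \<in> sets P" unfolding S_def using AP by (rule main_part_sets)
      have SA: "S \<subseteq> A" using main_part_null_part_Un[OF AP] by (auto simp: S_def)
      have "emeasure ?L A = emeasure P S" using AP by (simp add: lebesgue_n_def P_def S_def)
      then have pos: "0 < emeasure ?L S"
        using ne SP emeasure_lebesgue_n[of S n] by (simp add: P_def zero_less_iff_neq_zero)
      \<comment> \<open>A cell in which \<open>f\<close> exceeds \<open>lam + \<epsilon>\<close> on
        a portion \<open>\<theta>\<close> has average at least \<open>lam + \<epsilon> / 2\<close>,
        which is above \<open>lam\<close>.\<close>
      define \<theta> where "\<theta> = (lam + \<epsilon> / 2) / (lam + \<epsilon>)"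
      have \<theta>: "0 < \<theta>" "\<theta> < 1" "\<theta> * (lam + \<epsilon>) = lam + \<epsilon> / 2" using lam \<epsilon> by (simp_all add: \<theta>_def field_simps)
      obtain k y where y: "y \<in> hcube n a l"
        "ennreal \<theta> * emeasure ?L (cell n a l k y) < emeasure ?L (S \<inter> cell n a l k y)"
        using cell_density[OF l _ _ pos \<theta>(1,2), of a] SP SA G(2) by (auto simp: P_def A_def)
      define R where "R = cell n a l k y"
      have R[measurable]: "R \<in> sets ?L" unfolding R_def by (rule sets_cell[OF l])
      have emR: "emeasure ?L R = ennreal ((l / 2 ^ k) ^ n)" unfolding R_def by (rule emeasure_cell[OF l])
      have SL[measurable]: "S \<in> sets ?L" using SP by (auto intro!: sets_lebesgue_nI simp: P_def)
      \<comment> \<open>The dense cell meets \<open>S\<close> and is therefore the cell of a point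
        of \<open>G\<close>, to which \<open>avg\<close> applies.\<close>
      have "S \<inter> R \<noteq> {}" using y(2) by (auto simp: R_def)
      then obtain z where z: "z \<in> S" "z \<in> R" by blast
      then have "z \<in> G" "cell n a l k z = R" using SA cell_eq[of z n a l k y] by (auto simp: A_def R_def)
      then have up: "(\<integral>\<^sup>+x\<in>R. ennreal (f x) \<partial>?L) \<le> ennreal lam * emeasure ?L R" using avg[of z k] by simp
      define v where "v = (l / 2 ^ k) ^ n"
      have v: "0 < v" using l by (simp add: v_def)
      have "ennreal ((lam + \<epsilon>) * (\<theta> * v)) = ennreal (lam + \<epsilon>) * (ennreal \<theta> * emeasure ?L R)"
        unfolding emR v_def[symmetric] using lam \<epsilon> \<theta> v by (subst ennreal_mult, simp, simp, subst ennreal_mult) auto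
      also have "\<dots> \<le> ennreal (lam + \<epsilon>) * emeasure ?L (S \<inter> R)"
        using y(2) by (intro mult_left_mono) (auto simp: R_def)
      also have "\<dots> = (\<integral>\<^sup>+x. ennreal (lam + \<epsilon>) * indicator (S \<inter> R) x \<partial>?L)"
        by (subst nn_integral_cmult_indicator) auto
      also have "\<dots> \<le> (\<integral>\<^sup>+x\<in>R. ennreal (f x) \<partial>?L)"
        using SA by (intro nn_integral_mono) (auto simp: A_def indicator_def subset_iff intro!: ennreal_leI)
      also have "\<dots> \<le> ennreal (lam * v)"
        using up lam v unfolding emR v_def[symmetric] by (simp add: ennreal_mult)
      finally have "(\<theta> * (lam + \<epsilon>)) * v \<le> lam * v"
        using lam v by (subst (asm) ennreal_le_iff) (auto simp: mult_ac)
      then show False unfolding \<theta>(3) using v \<epsilon> by (simp add: mult_le_cancel_right)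
    qed
    then have "AE x in ?L. x \<notin> A" by (intro AE_not_in) auto
    then show ?thesis
      by (rule AE_mp) (auto simp: A_def \<epsilon>_def not_less intro!: AE_I2)
  qed
  have "AE x in ?L. \<forall>j. x \<in> G \<longrightarrow> f x \<le> lam + 1 / real (Suc j)"
    unfolding AE_all_countable by (intro allI main)
  then show ?thesis
  proof eventually_elim
    case (elim x)
    show ?case
    proof
      assume "x \<in> G"
      have "(\<lambda>j. lam + 1 / real (Suc j)) \<longlonglongrightarrow> lam + 0"
        using LIMSEQ_inverse_real_of_nat by (intro tendsto_intros) (simp add: inverse_eq_divide)
      then show "f x \<le> lam"
        using elim \<open>x \<in> G\<close> by (intro LIMSEQ_le_const[of _ lam]) auto
    qed
  qed
qed

lemma nn_integral_disjoint_Union: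
  assumes [measurable]: "f \<in> borel_measurable M" and "countable \<R>" "disjoint_family_on (\<lambda>R. R) \<R>"
    and sets: "\<And>R. R \<in> \<R> \<Longrightarrow> R \<in> sets M"
  shows "(\<integral>\<^sup>+x\<in>\<Union>\<R>. f x \<partial>M) = (\<integral>\<^sup>+R. (\<integral>\<^sup>+x\<in>R. f x \<partial>M) \<partial>count_space \<R>)"
proof -
  have "\<Union>\<R> \<in> sets M" using assms by (intro sets.countable_Union) auto
  then have "(\<integral>\<^sup>+x\<in>\<Union>\<R>. f x \<partial>M) = emeasure (density M f) (\<Union>R\<in>\<R>. R)"
    by (subst emeasure_density) auto
  also have "\<dots> = (\<integral>\<^sup>+R. emeasure (density M f) R \<partial>count_space \<R>)"
    by (rule emeasure_UN_countable) (use assms in auto)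
  also have "\<dots> = (\<integral>\<^sup>+R. (\<integral>\<^sup>+x\<in>R. f x \<partial>M) \<partial>count_space \<R>)"
    by (intro nn_integral_cong emeasure_density) (auto simp: sets)
  finally show ?thesis .
qed

section \<open>Calderon-Zygmund decomposition\<close>

text \<open>Stop at the first level where the average exceeds \<open>lam\<close>. The parent still
  has average at most \<open>lam\<close> and \<open>2 ^ n\<close> times the volume, hence the upper
  bound on a stopped cell. At points outside all stopped cells no cell average exceeds
  \<open>lam\<close>.\<close>

lemma calderon_zygmund:
  fixes f :: "(nat \<Rightarrow> real) \<Rightarrow> real"
  assumes l: "0 < l" and f[measurable]: "f \<in> borel_measurable (lebesgue_n n)"
    and nn: "\<And>x. 0 \<le> f x" and lam: "0 < lam" and C: "0 \<le> C" "C \<le> lam"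
    and avg: "(\<integral>\<^sup>+x\<in>hcube n a l. ennreal (f x) \<partial>lebesgue_n n) \<le> ennreal C * emeasure (lebesgue_n n) (hcube n a l)"
  obtains \<R> where "countable \<R>" "disjoint_family_on (\<lambda>R. R) \<R>"
    "\<And>R. R \<in> \<R> \<Longrightarrow> \<exists>b s. 0 < s \<and> R = hcube n b s" "\<And>R. R \<in> \<R> \<Longrightarrow> R \<subseteq> hcube n a l"
    "\<And>R. R \<in> \<R> \<Longrightarrow> (\<integral>\<^sup>+x\<in>R. ennreal (f x) \<partial>lebesgue_n n) \<le> ennreal (2 ^ n * lam) * emeasure (lebesgue_n n) R"
    "ennreal lam * emeasure (lebesgue_n n) (\<Union>\<R>) \<le> ennreal C * emeasure (lebesgue_n n) (hcube n a l)"
    "AE x in lebesgue_n n. x \<in> hcube n a l - \<Union>\<R> \<longrightarrow> f x \<le> lam"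
proof -
  let ?L = "lebesgue_n n"
  define Q where "Q = hcube n a l"
  define c where "c = cell n a l"
  define bad where "bad k y \<longleftrightarrow> ennreal lam * emeasure ?L (c k y) < (\<integral>\<^sup>+x\<in>c k y. ennreal (f x) \<partial>?L)" for k y
  define \<R> where "\<R> = {c k y | k y. y \<in> Q \<and> bad k y \<and> (\<forall>j<k. \<not> bad j y)}"
  have c_sets[measurable]: "c k y \<in> sets ?L" for k y unfolding c_def by (rule sets_cell[OF l])
  have c_eq: "c k z = c k y" if "z \<in> c k y" for k y z using cell_eq that by (simp add: c_def)
  have c_anti: "c k y \<subseteq> c j y" if "j \<le> k" for j k y using cell_antimono[OF that] by (simp add: c_def)
  have c0: "c 0 y = Q" if "y \<in> Q" for y using cell_0[OF l] that by (simp add: c_def Q_def)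
  have ext: "y \<in> PiE {..<n} (\<lambda>_. UNIV)" if "y \<in> Q" for y using that by (auto simp: Q_def hcube_def PiE_iff)
  have c_self: "y \<in> c k y" if "y \<in> Q" for k y unfolding c_def by (rule cell_self[OF ext[OF that]])
  have bad_cong: "bad k z \<longleftrightarrow> bad k y" if "z \<in> c k y" for k y z using c_eq[OF that] by (simp add: bad_def)
  \<comment> \<open>The whole cube is not stopped because \<open>C \<le> lam\<close>; so every
    stopped cell has a parent within the cube.\<close>
  have bad0: "\<not> bad 0 y" if "y \<in> Q" for y
    using avg mult_right_mono[OF ennreal_leI[OF C(2)], of "emeasure ?L Q"]
    unfolding bad_def c0[OF that] by (simp add: Q_def not_less order_trans)
  have c_sub: "c k y \<subseteq> Q" if "y \<in> Q" for k y using c_anti[of 0 k y] c0[OF that] by simp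
  have cnt: "countable \<R>"
  proof (rule countable_subset)
    show "\<R> \<subseteq> (\<Union>k. range (c k))" unfolding \<R>_def by blast
    show "countable (\<Union>k. range (c k))" unfolding c_def using countable_cells by blast
  qed
  \<comment> \<open>Badness depends on the cell alone, so a common point of two stopped cells gives
    both the same first bad level.\<close>
  have key: "c k y = c k' y'" if y: "bad k y" "\<forall>j<k. \<not> bad j y" and y': "bad k' y'" "\<forall>j<k'. \<not> bad j y'"
    and z: "z \<in> c k y" "z \<in> c k' y'" for k k' y y' z
  proof -
    have "\<not> bad j z" if "j < k" for j
      using bad_cong[of z j y] c_anti[of j k y] z(1) y(2) that by auto
    then have 1: "bad k z" "\<forall>j<k. \<not> bad j z" using y(1) bad_cong[OF z(1)] by simp_all
    have "\<not> bad j z" if "j < k'" for j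
      using bad_cong[of z j y'] c_anti[of j k' y'] z(2) y'(2) that by auto
    then have 2: "bad k' z" "\<forall>j<k'. \<not> bad j z" using y'(1) bad_cong[OF z(2)] by simp_all
    have "k = k'" using 1 2 by (meson linorder_neqE_nat)
    then show ?thesis using c_eq[OF z(1)] c_eq[OF z(2)] by simp
  qed
  have disj: "disjoint_family_on (\<lambda>R. R) \<R>"
    unfolding disjoint_family_on_def \<R>_def using key by blast
  have cube: "\<exists>b s. 0 < s \<and> R = hcube n b s" if "R \<in> \<R>" for R
  proof -
    obtain k y where "R = c k y" using \<open>R \<in> \<R>\<close> by (auto simp: \<R>_def)
    then have "R = hcube n (\<lambda>i. a i + of_int \<lfloor>2 ^ k * (y i - a i) / l\<rfloor> * (l / 2 ^ k)) (l / 2 ^ k)"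
      by (simp add: c_def cell_eq_hcube[OF l])
    then show ?thesis using l by (intro exI conjI) auto
  qed
  have sub: "R \<subseteq> Q" if "R \<in> \<R>" for R using that c_sub by (auto simp: \<R>_def)
  have Rsets[measurable]: "R \<in> sets ?L" if "R \<in> \<R>" for R using that by (auto simp: \<R>_def)
  have upper: "(\<integral>\<^sup>+x\<in>R. ennreal (f x) \<partial>?L) \<le> ennreal (2 ^ n * lam) * emeasure ?L R" if "R \<in> \<R>" for R
  proof -
    obtain k y where R: "R = c k y" and y: "y \<in> Q" "bad k y" "\<forall>j<k. \<not> bad j y"
      using \<open>R \<in> \<R>\<close> unfolding \<R>_def mem_Collect_eq by blast
    obtain k' where k: "k = Suc k'" using bad0[OF y(1)] y(2) by (cases k) auto
    have "(\<integral>\<^sup>+x\<in>R. ennreal (f x) \<partial>?L) \<le> (\<integral>\<^sup>+x\<in>c k' y. ennreal (f x) \<partial>?L)"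
      using c_anti[of k' k y] by (intro nn_integral_mono) (auto simp: R k indicator_def)
    also have "\<dots> \<le> ennreal lam * emeasure ?L (c k' y)"
      using y(3) by (auto simp: bad_def k not_less)
    also have "\<dots> = ennreal (lam * (l / 2 ^ k') ^ n)"
      unfolding c_def emeasure_cell[OF l] using lam l by (simp add: ennreal_mult)
    also have "lam * (l / 2 ^ k') ^ n = (2 ^ n * lam) * (l / 2 ^ k) ^ n"
      by (simp add: k power_divide power_mult_distrib field_simps)
    also have "ennreal \<dots> = ennreal (2 ^ n * lam) * emeasure ?L R"
      unfolding R c_def emeasure_cell[OF l] using lam l by (simp add: ennreal_mult)
    finally show ?thesis .
  qed
  have UR: "\<Union>\<R> \<in> sets ?L" using cnt Rsets by (intro sets.countable_Union) auto
  have "ennreal lam * emeasure ?L (\<Union>R\<in>\<R>. R) = (\<integral>\<^sup>+R. ennreal lam * emeasure ?L R \<partial>count_space \<R>)"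
    using disj Rsets by (subst emeasure_UN_countable[OF _ cnt]) (auto simp: nn_integral_cmult)
  also have "\<dots> \<le> (\<integral>\<^sup>+R. (\<integral>\<^sup>+x\<in>R. ennreal (f x) \<partial>?L) \<partial>count_space \<R>)"
    by (intro nn_integral_mono) (auto simp: \<R>_def bad_def less_imp_le)
  also have "\<dots> = (\<integral>\<^sup>+x\<in>\<Union>\<R>. ennreal (f x) \<partial>?L)"
    by (rule nn_integral_disjoint_Union[symmetric]) (use cnt disj Rsets in auto)
  also have "\<dots> \<le> (\<integral>\<^sup>+x\<in>Q. ennreal (f x) \<partial>?L)"
    using sub by (intro nn_integral_mono) (auto simp: indicator_def)
  also have "\<dots> \<le> ennreal C * emeasure ?L Q" using avg by (simp add: Q_def)
  finally have small: "ennreal lam * emeasure ?L (\<Union>\<R>) \<le> ennreal C * emeasure ?L Q" by simp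
  have "AE x in ?L. x \<in> Q - \<Union>\<R> \<longrightarrow> f x \<le> lam"
  proof (rule AE_le_of_cell_averages[OF l f nn _ _ lam])
    show "Q - \<Union>\<R> \<in> sets ?L" using UR by (simp add: Q_def sets_hcube sets.Diff)
    show "Q - \<Union>\<R> \<subseteq> hcube n a l" by (auto simp: Q_def)
    fix y k assume y: "y \<in> Q - \<Union>\<R>"
    have "\<not> bad k y"
    proof
      assume "bad k y"
      then have "bad (LEAST k. bad k y) y" by (rule LeastI)
      then have "c (LEAST k. bad k y) y \<in> \<R>"
        using y not_less_Least[of _ "\<lambda>k. bad k y"] unfolding \<R>_def by blast
      then show False using y c_self[of y] by blast
    qed
    then show "(\<integral>\<^sup>+x\<in>cell n a l k y. ennreal (f x) \<partial>?L) \<le> ennreal lam * emeasure ?L (cell n a l k y)"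
      by (simp add: bad_def c_def not_less)
  qed
  then show ?thesis using that[of \<R>] cnt disj cube sub upper small by (simp add: Q_def)
qed


section \<open>Exponential integrability\<close>

text \<open>One stopping at height \<open>lam\<close>. Off the stopped cubes the exponent is at most
  \<open>\<delta> * lam\<close>. On a stopped cube \<open>R\<close> the function of the large cube
  exceeds \<open>\<psi> R\<close> by at most \<open>2 ^ n * lam + K\<close>, and the assumed bound
  \<open>M\<close> applies to \<open>\<psi> R\<close>. The factor 1/2 is the share of the stopped
  cubes.\<close>

lemma john_nirenberg_step:
  fixes \<psi> :: "(nat \<Rightarrow> real) set \<Rightarrow> (nat \<Rightarrow> real) \<Rightarrow> real"
  assumes l: "0 < l" and C: "0 \<le> C" and K: "0 \<le> K" and \<delta>: "0 \<le> \<delta>"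
    and meas: "\<And>b s. 0 < s \<Longrightarrow> \<psi> (hcube n b s) \<in> borel_measurable (lebesgue_n n)"
    and nn: "\<And>Q x. 0 \<le> \<psi> Q x"
    and avg: "\<And>b s. 0 < s \<Longrightarrow> (\<integral>\<^sup>+x\<in>hcube n b s. ennreal (\<psi> (hcube n b s) x) \<partial>lebesgue_n n)
        \<le> ennreal C * emeasure (lebesgue_n n) (hcube n b s)"
    and change: "\<And>b s t. 0 < s \<Longrightarrow> 0 \<le> t \<Longrightarrow> hcube n b s \<subseteq> hcube n a l \<Longrightarrow>
        (\<integral>\<^sup>+x\<in>hcube n b s. ennreal (\<psi> (hcube n a l) x) \<partial>lebesgue_n n) \<le> ennreal t * emeasure (lebesgue_n n) (hcube n b s) \<Longrightarrow>
        AE x in lebesgue_n n. x \<in> hcube n b s \<longrightarrow> \<psi> (hcube n a l) x \<le> t + K + \<psi> (hcube n b s) x"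
    and M: "\<And>b s. 0 < s \<Longrightarrow> (\<integral>\<^sup>+x\<in>hcube n b s. min (ennreal (exp (\<delta> * \<psi> (hcube n b s) x))) N \<partial>lebesgue_n n)
        \<le> M * emeasure (lebesgue_n n) (hcube n b s)"
  defines "lam \<equiv> 2 * C + 1"
  shows "(\<integral>\<^sup>+x\<in>hcube n a l. min (ennreal (exp (\<delta> * \<psi> (hcube n a l) x))) N \<partial>lebesgue_n n)
    \<le> (ennreal (exp (\<delta> * lam)) + ennreal (exp (\<delta> * (2 ^ n * lam + K)) / 2) * M) * emeasure (lebesgue_n n) (hcube n a l)"
proof -
  let ?L = "lebesgue_n n"
  define Q where "Q = hcube n a l"
  define g where "g R x = min (ennreal (exp (\<delta> * \<psi> R x))) N" for R x
  define b where "b = exp (\<delta> * (2 ^ n * lam + K))"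
  have lam: "0 < lam" "C \<le> lam" using C by (simp_all add: lam_def)
  have [measurable]: "\<psi> Q \<in> borel_measurable ?L" using meas[OF l] by (simp add: Q_def)
  have gm: "g (hcube n b s) \<in> borel_measurable ?L" if "0 < s" for b s
    using meas[OF that, of b] unfolding g_def by measurable
  obtain \<R> where \<R>: "countable \<R>" "disjoint_family_on (\<lambda>R. R) \<R>"
    "\<And>R. R \<in> \<R> \<Longrightarrow> \<exists>b s. 0 < s \<and> R = hcube n b s" "\<And>R. R \<in> \<R> \<Longrightarrow> R \<subseteq> Q"
    "\<And>R. R \<in> \<R> \<Longrightarrow> (\<integral>\<^sup>+x\<in>R. ennreal (\<psi> Q x) \<partial>?L) \<le> ennreal (2 ^ n * lam) * emeasure ?L R"
    "ennreal lam * emeasure ?L (\<Union>\<R>) \<le> ennreal C * emeasure ?L Q"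
    "AE x in ?L. x \<in> Q - \<Union>\<R> \<longrightarrow> \<psi> Q x \<le> lam"
    using calderon_zygmund[OF l meas[OF l] nn lam(1) C lam(2) avg[OF l]] unfolding Q_def by blast
  have Rsets: "R \<in> sets ?L" if "R \<in> \<R>" for R using \<R>(3)[OF that] sets_hcube by auto
  have UR[measurable]: "\<Union>\<R> \<in> sets ?L" using \<R>(1) Rsets by (intro sets.countable_Union) auto
  have Qs[measurable]: "Q \<in> sets ?L" unfolding Q_def by (rule sets_hcube)
  have gQ[measurable]: "g Q \<in> borel_measurable ?L" unfolding Q_def by (rule gm[OF l])
  \<comment> \<open>Because \<open>lam\<close> is at least \<open>2 * C\<close>. The added 1 keeps
    \<open>lam\<close> positive when \<open>C = 0\<close>; the stopped cubes then have measure
    0.\<close>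
  have half: "emeasure ?L (\<Union>\<R>) \<le> ennreal (1 / 2) * emeasure ?L Q"
  proof -
    have fin: "emeasure ?L (\<Union>\<R>) \<le> emeasure ?L Q" using \<R>(4) by (intro emeasure_mono) auto
    have emQ: "emeasure ?L Q = ennreal (l ^ n)" unfolding Q_def using l by (simp add: emeasure_hcube)
    then have "emeasure ?L (\<Union>\<R>) < \<infinity>" using fin by (simp add: order_le_less_trans)
    then obtain u where u: "0 \<le> u" "emeasure ?L (\<Union>\<R>) = ennreal u" by (cases "emeasure ?L (\<Union>\<R>)") auto
    then have "lam * u \<le> C * l ^ n"
      using \<R>(6) lam C l unfolding emQ u(2) by (simp add: ennreal_mult[symmetric])
    moreover have "2 * (C * u) \<le> lam * u" using u(1) unfolding lam_def by (simp add: algebra_simps)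
    ultimately have "u \<le> l ^ n / 2"
    proof (cases "C = 0")
      case True
      then show ?thesis using \<open>lam * u \<le> C * l ^ n\<close> l u(1) by (simp add: lam_def)
    next
      case False
      then have "0 < C" using C by simp
      moreover have "C * (2 * u) = 2 * (C * u)" by simp
      then have "C * (2 * u) \<le> C * l ^ n"
        using \<open>lam * u \<le> C * l ^ n\<close> \<open>2 * (C * u) \<le> lam * u\<close> by linarith
      ultimately
      have "2 * u \<le> l ^ n" by (simp only: mult_le_cancel_left_pos)
      then show ?thesis by simp
    qed
    moreover have "ennreal (1 / 2) * ennreal (l ^ n) = ennreal (l ^ n / 2)"
      using l by (subst ennreal_mult[symmetric]) auto
    ultimately show ?thesis unfolding emQ u(2) by (simp only: ennreal_leI)
  qed
  have onR: "(\<integral>\<^sup>+x\<in>R. g Q x \<partial>?L) \<le> ennreal b * M * emeasure ?L R" if R: "R \<in> \<R>" for R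
  proof -
    obtain b' s where bs: "0 < s" "R = hcube n b' s" using \<R>(3)[OF R] by blast
    have "AE x in ?L. x \<in> R \<longrightarrow> \<psi> Q x \<le> 2 ^ n * lam + K + \<psi> R x"
      using change[OF bs(1), of "2 ^ n * lam" b'] \<R>(4,5)[OF R] lam by (simp add: Q_def bs(2))
    then have "(\<integral>\<^sup>+x\<in>R. g Q x \<partial>?L) \<le> (\<integral>\<^sup>+x. ennreal b * (g R x * indicator R x) \<partial>?L)"
    proof (intro nn_integral_mono_AE, eventually_elim)
      case (elim x)
      show ?case
      proof (cases "x \<in> R")
        case True
        \<comment> \<open>This lets \<open>b\<close> pass through the truncation: the minimum of
          \<open>b * e\<close> and \<open>N\<close> is at most \<open>b\<close> times the minimum of
          \<open>e\<close> and \<open>N\<close>.\<close>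
        have b1: "1 \<le> b" unfolding b_def using \<delta> K lam by simp
        have "\<delta> * \<psi> Q x \<le> \<delta> * (2 ^ n * lam + K + \<psi> R x)" using elim True \<delta> by (intro mult_left_mono) auto
        then have "exp (\<delta> * \<psi> Q x) \<le> b * exp (\<delta> * \<psi> R x)"
          unfolding b_def exp_add[symmetric] by (simp add: algebra_simps)
        then have 1: "ennreal (exp (\<delta> * \<psi> Q x)) \<le> ennreal b * ennreal (exp (\<delta> * \<psi> R x))"
          using b1 by (simp add: ennreal_mult[symmetric])
        have "1 * N \<le> ennreal b * N" using b1 by (intro mult_right_mono) auto
        then have "g Q x \<le> ennreal b * g R x"
          using 1 unfolding g_def by (auto simp: min_def)
        then show ?thesis using True by simp
      qed simp
    qed
    also have "\<dots> = ennreal b * (\<integral>\<^sup>+x\<in>R. g R x \<partial>?L)"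
      using gm[OF bs(1), of b'] sets_hcube[of n b' s] unfolding bs(2) by (intro nn_integral_cmult) auto
    also have "\<dots> \<le> ennreal b * (M * emeasure ?L R)"
      using M[OF bs(1), of b'] unfolding bs(2) g_def by (intro mult_left_mono) auto
    finally show ?thesis by (simp add: mult.assoc)
  qed
  have "(\<integral>\<^sup>+x\<in>Q. g Q x \<partial>?L) = (\<integral>\<^sup>+x. g Q x * indicator (Q - \<Union>\<R>) x + g Q x * indicator (\<Union>\<R>) x \<partial>?L)"
    using \<R>(4) by (intro nn_integral_cong) (auto simp: indicator_def)
  also have "\<dots> = (\<integral>\<^sup>+x\<in>Q - \<Union>\<R>. g Q x \<partial>?L) + (\<integral>\<^sup>+x\<in>\<Union>\<R>. g Q x \<partial>?L)"
    by (rule nn_integral_add) measurable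
  also have "(\<integral>\<^sup>+x\<in>\<Union>\<R>. g Q x \<partial>?L) = (\<integral>\<^sup>+R. (\<integral>\<^sup>+x\<in>R. g Q x \<partial>?L) \<partial>count_space \<R>)"
    by (rule nn_integral_disjoint_Union) (use \<R> Rsets in auto)
  also have "\<dots> \<le> (\<integral>\<^sup>+R. ennreal b * M * emeasure ?L R \<partial>count_space \<R>)"
    by (intro nn_integral_mono) (auto simp: onR)
  also have "\<dots> = ennreal b * M * emeasure ?L (\<Union>R\<in>\<R>. R)"
    using \<R> Rsets by (subst emeasure_UN_countable) (auto simp: nn_integral_cmult)
  also have "\<dots> \<le> ennreal b * M * (ennreal (1 / 2) * emeasure ?L Q)"
    using half by (intro mult_left_mono) auto
  also have "(\<integral>\<^sup>+x\<in>Q - \<Union>\<R>. g Q x \<partial>?L) \<le> (\<integral>\<^sup>+x. ennreal (exp (\<delta> * lam)) * indicator Q x \<partial>?L)"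
    using \<R>(7)
  proof (intro nn_integral_mono_AE, eventually_elim)
    case (elim x)
    then show ?case
      using \<delta> by (auto simp: g_def indicator_def min_le_iff_disj intro!: ennreal_leI mult_left_mono)
  qed
  also have "\<dots> = ennreal (exp (\<delta> * lam)) * emeasure ?L Q" by (rule nn_integral_cmult_indicator) simp
  finally have "(\<integral>\<^sup>+x\<in>Q. g Q x \<partial>?L)
      \<le> ennreal (exp (\<delta> * lam)) * emeasure ?L Q + ennreal b * M * (ennreal (1 / 2) * emeasure ?L Q)"
    by (simp add: add_mono)
  also have "\<dots> = (ennreal (exp (\<delta> * lam)) + ennreal (b * (1 / 2)) * M) * emeasure ?L Q"
  proof -
    have "ennreal (b * (1 / 2)) = ennreal b * ennreal (1 / 2)" by (rule ennreal_mult) (simp_all add: b_def)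
    then show ?thesis by (simp only: algebra_simps)
  qed
  finally show ?thesis by (simp add: g_def Q_def b_def)
qed

text \<open>The best constant \<open>M\<close> for the truncated exponential satisfies
  \<open>M \<le> c + 3 / 4 * M\<close>. Truncation at \<open>N\<close> makes \<open>M\<close>
  finite, so it can be absorbed; the bound \<open>4 * c\<close> is free of \<open>N\<close>, and
  monotone convergence removes the truncation.\<close>

theorem john_nirenberg:
  fixes \<psi> :: "(nat \<Rightarrow> real) set \<Rightarrow> (nat \<Rightarrow> real) \<Rightarrow> real"
  assumes C: "0 \<le> C" and K: "0 \<le> K"
    and meas: "\<And>b s. 0 < s \<Longrightarrow> \<psi> (hcube n b s) \<in> borel_measurable (lebesgue_n n)"
    and nn: "\<And>Q x. 0 \<le> \<psi> Q x"
    and avg: "\<And>b s. 0 < s \<Longrightarrow> (\<integral>\<^sup>+x\<in>hcube n b s. ennreal (\<psi> (hcube n b s) x) \<partial>lebesgue_n n)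
        \<le> ennreal C * emeasure (lebesgue_n n) (hcube n b s)"
    and change: "\<And>a l b s t. 0 < l \<Longrightarrow> 0 < s \<Longrightarrow> 0 \<le> t \<Longrightarrow> hcube n b s \<subseteq> hcube n a l \<Longrightarrow>
        (\<integral>\<^sup>+x\<in>hcube n b s. ennreal (\<psi> (hcube n a l) x) \<partial>lebesgue_n n) \<le> ennreal t * emeasure (lebesgue_n n) (hcube n b s) \<Longrightarrow>
        AE x in lebesgue_n n. x \<in> hcube n b s \<longrightarrow> \<psi> (hcube n a l) x \<le> t + K + \<psi> (hcube n b s) x"
  obtains \<delta> c :: real where "0 < \<delta>" "0 \<le> c"
    "\<And>a l. 0 < l \<Longrightarrow> (\<integral>\<^sup>+x\<in>hcube n a l. ennreal (exp (\<delta> * \<psi> (hcube n a l) x)) \<partial>lebesgue_n n)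
        \<le> ennreal c * emeasure (lebesgue_n n) (hcube n a l)"
proof -
  let ?L = "lebesgue_n n"
  define lam where "lam = 2 * C + 1"
  define B where "B = 2 ^ n * lam + K"
  have "0 < lam" using C by (simp add: lam_def)
  then have B: "0 < B" using K by (simp add: B_def add_pos_nonneg)
  \<comment> \<open>Chosen to make \<open>exp (\<delta> * B)\<close> equal to \<open>3 / 2\<close>;
    half of it is \<open>3 / 4\<close>, which is below 1 as the absorption requires.\<close>
  define \<delta> where "\<delta> = ln (3 / 2) / B"
  have \<delta>: "0 < \<delta>" using B by (simp add: \<delta>_def)
  have expB: "exp (\<delta> * B) = 3 / 2" using B by (simp add: \<delta>_def)
  define c where "c = exp (\<delta> * lam)"
  have c0: "0 < c" by (simp add: c_def)
  define g where "g N R x = min (ennreal (exp (\<delta> * \<psi> R x))) (of_nat N)" for N R x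
  have trunc: "(\<integral>\<^sup>+x\<in>hcube n a l. g N (hcube n a l) x \<partial>?L) \<le> ennreal (4 * c) * emeasure ?L (hcube n a l)"
    if l: "0 < l" for a l and N :: nat
  proof -
    define \<I> where "\<I> = {(b :: nat \<Rightarrow> real, s :: real). 0 < s}"
    \<comment> \<open>The supremum runs over all cubes at once, because a step leads from one
      \<open>\<psi> Q\<close> to the different functions \<open>\<psi> R\<close>.\<close>
    define M where "M = (SUP (b, s)\<in>\<I>. (\<integral>\<^sup>+x\<in>hcube n b s. g N (hcube n b s) x \<partial>?L) / emeasure ?L (hcube n b s))"
    have em: "emeasure ?L (hcube n b s) \<noteq> 0" "emeasure ?L (hcube n b s) \<noteq> \<infinity>" if "0 < s" for b s
      using that by (simp_all add: emeasure_hcube)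
    have bound: "(\<integral>\<^sup>+x\<in>hcube n b s. g N (hcube n b s) x \<partial>?L) \<le> M * emeasure ?L (hcube n b s)" if s: "0 < s" for b s
    proof -
      have "(\<integral>\<^sup>+x\<in>hcube n b s. g N (hcube n b s) x \<partial>?L) / emeasure ?L (hcube n b s) \<le> M"
        unfolding M_def by (rule SUP_upper2[of "(b, s)"]) (auto simp: \<I>_def s)
      then have "(\<integral>\<^sup>+x\<in>hcube n b s. g N (hcube n b s) x \<partial>?L) / emeasure ?L (hcube n b s) * emeasure ?L (hcube n b s)
          \<le> M * emeasure ?L (hcube n b s)" by (rule mult_right_mono) simp
      then show ?thesis using em[OF s, of b] by (simp add: ennreal_divide_times ennreal_divide_self less_top)
    qed
    have le: "M \<le> u" if "\<And>b s. 0 < s \<Longrightarrow> (\<integral>\<^sup>+x\<in>hcube n b s. g N (hcube n b s) x \<partial>?L) \<le> u * emeasure ?L (hcube n b s)" for u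
      unfolding M_def
    proof (rule SUP_least, clarsimp simp: \<I>_def)
      fix b and s :: real assume s: "0 < s"
      have "(\<integral>\<^sup>+x\<in>hcube n b s. g N (hcube n b s) x \<partial>?L) / emeasure ?L (hcube n b s)
          \<le> u * emeasure ?L (hcube n b s) / emeasure ?L (hcube n b s)"
        by (rule divide_right_mono_ennreal[OF that[OF s]])
      then show "(\<integral>\<^sup>+x\<in>hcube n b s. g N (hcube n b s) x \<partial>?L) / emeasure ?L (hcube n b s) \<le> u"
        using em[OF s, of b] by (simp add: mult_divide_eq_ennreal)
    qed
    have "M \<le> of_nat N"
    proof (rule le)
      fix b and s :: real assume "0 < s"
      have "(\<integral>\<^sup>+x\<in>hcube n b s. g N (hcube n b s) x \<partial>?L) \<le> (\<integral>\<^sup>+x. of_nat N * indicator (hcube n b s) x \<partial>?L)"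
        by (intro nn_integral_mono mult_right_mono) (auto simp: g_def)
      then show "(\<integral>\<^sup>+x\<in>hcube n b s. g N (hcube n b s) x \<partial>?L) \<le> of_nat N * emeasure ?L (hcube n b s)"
        using sets_hcube[of n b s] by (simp add: nn_integral_cmult_indicator)
    qed
    then have "M < \<infinity>" by (simp add: order_le_less_trans of_nat_less_top)
    then obtain m where m: "0 \<le> m" "M = ennreal m" by (cases M) auto
    have "M \<le> ennreal c + ennreal (3 / 4) * M"
    proof (rule le)
      fix b and s :: real assume s: "0 < s"
      show "(\<integral>\<^sup>+x\<in>hcube n b s. g N (hcube n b s) x \<partial>?L) \<le> (ennreal c + ennreal (3 / 4) * M) * emeasure ?L (hcube n b s)"
      proof -
        have e: "exp (\<delta> * (2 ^ n * (2 * C + 1) + K)) / 2 = 3 / 4" "exp (\<delta> * (2 * C + 1)) = c"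
          using expB by (simp_all add: B_def lam_def c_def)
        note john_nirenberg_step[OF s C K less_imp_le[OF \<delta>] meas nn avg change[OF s] bound[unfolded g_def], of b]
        then show ?thesis unfolding g_def e by assumption
      qed
    qed
    then have "m \<le> c + 3 / 4 * m"
      using m c0 by (simp add: ennreal_mult[symmetric] ennreal_plus[symmetric] del: ennreal_plus)
    then have "M \<le> ennreal (4 * c)" unfolding m(2) by (intro ennreal_leI) simp
    then have "M * emeasure ?L (hcube n a l) \<le> ennreal (4 * c) * emeasure ?L (hcube n a l)"
      by (rule mult_right_mono) simp
    with bound[OF l] show ?thesis by (rule order_trans)
  qed
  have "(\<integral>\<^sup>+x\<in>hcube n a l. ennreal (exp (\<delta> * \<psi> (hcube n a l) x)) \<partial>?L) \<le> ennreal (4 * c) * emeasure ?L (hcube n a l)"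
    if l: "0 < l" for a l
  proof -
    have [measurable]: "\<psi> (hcube n a l) \<in> borel_measurable ?L" by (rule meas[OF l])
    have Qs[measurable]: "hcube n a l \<in> sets ?L" by (rule sets_hcube)
    have sup: "(SUP N. g N R x * indicator A x) = ennreal (exp (\<delta> * \<psi> R x)) * indicator A x" for R x A
    proof -
      obtain N0 where N0: "exp (\<delta> * \<psi> R x) \<le> real N0" using real_arch_simple by blast
      have "(SUP N. g N R x) = ennreal (exp (\<delta> * \<psi> R x))"
      proof (rule antisym)
        show "(SUP N. g N R x) \<le> ennreal (exp (\<delta> * \<psi> R x))" by (rule SUP_least) (simp add: g_def)
        have "ennreal (exp (\<delta> * \<psi> R x)) \<le> of_nat N0"
          using N0 by (simp add: ennreal_of_nat_eq_real_of_nat ennreal_leI)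
        then have "g N0 R x = ennreal (exp (\<delta> * \<psi> R x))" by (simp add: g_def)
        then show "ennreal (exp (\<delta> * \<psi> R x)) \<le> (SUP N. g N R x)" by (metis SUP_upper UNIV_I)
      qed
      then show ?thesis by (cases "x \<in> A") auto
    qed
    have "(\<integral>\<^sup>+x\<in>hcube n a l. ennreal (exp (\<delta> * \<psi> (hcube n a l) x)) \<partial>?L)
        = (SUP N. \<integral>\<^sup>+x\<in>hcube n a l. g N (hcube n a l) x \<partial>?L)"
      unfolding sup[symmetric]
    proof (rule nn_integral_monotone_convergence_SUP)
      show "incseq (\<lambda>N x. g N (hcube n a l) x * indicator (hcube n a l) x)"
        unfolding g_def by (intro incseq_SucI le_funI mult_right_mono min.mono order_refl of_nat_mono) simp_all
      show "(\<lambda>x. g N (hcube n a l) x * indicator (hcube n a l) x) \<in> borel_measurable ?L" for N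
        unfolding g_def by measurable
    qed
    also have "\<dots> \<le> ennreal (4 * c) * emeasure ?L (hcube n a l)" by (rule SUP_least) (rule trunc[OF l])
    finally show ?thesis .
  qed
  with \<delta> c0 show ?thesis by (intro that[of \<delta> "4 * c"]) auto
qed

subsection \<open>Weights on a probability space\<close>

text \<open>Isolates what concerns a single cube: \<open>M\<close> will be its normalised Lebesgue
  measure, so that averages become integrals over a probability space.\<close>

locale weight_space = prob_space M for M :: "(nat \<Rightarrow> real) measure" +
  fixes W :: "'m::finite matrix_fun"
  assumes measurable_W [measurable]: "W \<in> borel_measurable M"
    and nonneg_W: "\<And>x. x \<in> space M \<Longrightarrow> nonneg_definite (W x)"
    and invertible_W: "AE x in M. invertible (W x)"
    and integrable_W: "integrable M (\<lambda>x. op_norm (W x))"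
begin

definition pow :: "real \<Rightarrow> (nat \<Rightarrow> real) \<Rightarrow> complex^'m^'m" where
  "pow s x = mat_rpow (W x) s"

definition ratio_integral :: "real \<Rightarrow> (nat \<Rightarrow> real) \<Rightarrow> real" where
  "ratio_integral p y = (\<integral>x. weight_ratio p W x y powr p \<partial>M)"

lemma measurable_pow [measurable]: "pow s \<in> borel_measurable M"
  unfolding pow_def[abs_def] by (rule borel_measurable_mat_rpow[OF measurable_W nonneg_W])

lemma weight_ratio_eq: "weight_ratio p W x y = op_norm (pow (1 / p) x ** pow (- (1 / p)) y)"
  by (simp add: weight_ratio_def pow_def)

text \<open>Adjoints reverse the order of the self-adjoint factors. This puts the power at
  \<open>x\<close> on the right, where it can serve as the test matrix for a reducing operator of
  the inverse power.\<close>

lemma weight_ratio_eq': "x \<in> space M \<Longrightarrow> y \<in> space M \<Longrightarrow>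
    weight_ratio p W x y = op_norm (pow (- (1 / p)) y ** pow (1 / p) x)"
  using op_norm_adjoint[of "pow (1 / p) x ** pow (- (1 / p)) y"]
  by (simp add: weight_ratio_eq mat_adjoint_mult) (simp add: pow_def mat_adjoint_rpow nonneg_W)

lemma weight_ratio_nonneg [simp]: "0 \<le> weight_ratio p W x y"
  by (simp add: weight_ratio_eq)

lemma measurable_weight_ratio [measurable]:
  "(\<lambda>z. weight_ratio p W (fst z) (snd z)) \<in> borel_measurable (M \<Otimes>\<^sub>M M)"
  "(\<lambda>x. weight_ratio p W x y) \<in> borel_measurable M"
  "(\<lambda>y. weight_ratio p W x y) \<in> borel_measurable M"
  unfolding weight_ratio_eq by measurable

lemma pow_minus_mult:
  assumes "x \<in> space M" "invertible (W x)"
  shows "pow s x ** pow (- s) x = mat 1" "pow (- s) x ** pow s x = mat 1"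
  using mat_rpow_minus_mult[OF nonneg_W[OF assms(1)] assms(2)] by (simp_all add: pow_def)

lemma invertible_pow: "x \<in> space M \<Longrightarrow> invertible (W x) \<Longrightarrow> invertible (pow s x)"
  by (simp add: pow_def invertible_mat_rpow nonneg_W)

lemma AE_invertible: "AE x in M. x \<in> space M \<and> invertible (W x)"
  using invertible_W AE_space by eventually_elim simp

lemma AE_invertible_pow: "AE x in M. invertible (pow s x)"
  using AE_invertible by eventually_elim (simp add: invertible_pow)

lemma op_norm_pow_le: "0 < p \<Longrightarrow> x \<in> space M \<Longrightarrow> op_norm (pow (1 / p) x) powr p \<le> op_norm (W x)"
proof -
  assume p: "0 < p" and x: "x \<in> space M"
  have "op_norm (pow (1 / p) x) powr p \<le> (op_norm (W x) powr (1 / p)) powr p"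
    unfolding pow_def using p x by (intro powr_mono2 op_norm_rpow_le nonneg_W) auto
  then show ?thesis using p by (simp add: powr_powr)
qed

lemma integrable_pow: "0 < p \<Longrightarrow> integrable M (\<lambda>x. op_norm (pow (1 / p) x) powr p)"
  by (rule Bochner_Integration.integrable_bound[OF integrable_W]) (auto simp: op_norm_pow_le)

lemma integrable_pow_mult: "0 < p \<Longrightarrow> integrable M (\<lambda>x. op_norm (pow (1 / p) x ** X) powr p)"
  by (intro integrable_op_norm_mult_powr integrable_pow) auto

lemma integrable_weight_ratio: "0 < p \<Longrightarrow> integrable M (\<lambda>x. weight_ratio p W x y powr p)"
  unfolding weight_ratio_eq by (rule integrable_pow_mult)

lemma nn_integral_weight_ratio:
  "0 < p \<Longrightarrow> (\<integral>\<^sup>+x. ennreal (weight_ratio p W x y powr p) \<partial>M) = ennreal (ratio_integral p y)"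
  unfolding ratio_integral_def by (rule nn_integral_eq_integral[OF integrable_weight_ratio]) auto

lemma ratio_integral_nonneg [simp]: "0 \<le> ratio_integral p y"
  unfolding ratio_integral_def by (rule integral_nonneg_AE) simp

lemma measurable_ratio_integral [measurable]: "ratio_integral p \<in> borel_measurable M"
proof -
  have "(\<lambda>y. \<integral>x. weight_ratio p W (fst (x, y)) (snd (x, y)) powr p \<partial>M) \<in> borel_measurable M"
    by measurable
  then show ?thesis by (simp add: ratio_integral_def[abs_def])
qed

text \<open>Since \<open>op_norm (pow (1 / p) x) \<le> weight_ratio p W x y * op_norm (pow (1 / p) y)\<close>.\<close>

lemma ratio_integral_lower_bound:
  assumes p: "0 < p"
  obtains c where "0 < c"
    "\<And>y. y \<in> space M \<Longrightarrow> invertible (W y) \<Longrightarrow> c \<le> ratio_integral p y * op_norm (W y)"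
proof
  define c where "c = (\<integral>x. op_norm (pow (1 / p) x) powr p \<partial>M)"
  have "0 \<le> c" unfolding c_def by (rule integral_nonneg_AE) simp
  moreover have "c \<noteq> 0"
  proof
    assume "c = 0"
    then have "AE x in M. op_norm (pow (1 / p) x) powr p = 0"
      unfolding c_def by (subst (asm) integral_nonneg_eq_0_iff_AE[OF integrable_pow[OF p]]) auto
    then have "AE x in M. False" using AE_invertible_pow[of "1 / p"]
    proof eventually_elim
      case (elim x)
      then show ?case using op_norm_pos[of "pow (1 / p) x"] by simp
    qed
    then show False by simp
  qed
  ultimately show "0 < c" by simp
  fix y assume y: "y \<in> space M" "invertible (W y)"
  have "op_norm (pow (1 / p) x) powr p \<le> weight_ratio p W x y powr p * op_norm (W y)" for x
  proof -
    have "pow (1 / p) x = (pow (1 / p) x ** pow (- (1 / p)) y) ** pow (1 / p) y"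
      by (simp add: matrix_mul_assoc[symmetric] pow_minus_mult[OF y])
    then have "op_norm (pow (1 / p) x) \<le> weight_ratio p W x y * op_norm (pow (1 / p) y)"
      unfolding weight_ratio_eq by (metis op_norm_mult_le)
    then have "op_norm (pow (1 / p) x) powr p \<le> (weight_ratio p W x y * op_norm (pow (1 / p) y)) powr p"
      using p by (intro powr_mono2) auto
    also have "\<dots> = weight_ratio p W x y powr p * op_norm (pow (1 / p) y) powr p" by (rule powr_mult)
    also have "\<dots> \<le> weight_ratio p W x y powr p * op_norm (W y)"
      by (intro mult_left_mono op_norm_pow_le p y) simp
    finally show ?thesis .
  qed
  then have "c \<le> (\<integral>x. weight_ratio p W x y powr p * op_norm (W y) \<partial>M)"
    unfolding c_def
    by (intro integral_mono integrable_pow p integrable_mult_left integrable_weight_ratio) auto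
  then show "c \<le> ratio_integral p y * op_norm (W y)" by (simp add: ratio_integral_def)
qed

lemma AE_ratio_integral_pos: "0 < p \<Longrightarrow> AE y in M. 0 < ratio_integral p y"
proof -
  assume "0 < p"
  from ratio_integral_lower_bound[OF this] obtain c where c: "0 < c"
    "\<And>y. y \<in> space M \<Longrightarrow> invertible (W y) \<Longrightarrow> c \<le> ratio_integral p y * op_norm (W y)" by blast
  show ?thesis using AE_invertible
  proof eventually_elim
    case (elim y)
    then have "0 < ratio_integral p y * op_norm (W y)" using c by fastforce
    then show ?case using op_norm_nonneg[of "W y"] ratio_integral_nonneg[of p y] by (simp add: zero_less_mult_iff)
  qed
qed

text \<open>The logarithm is very negative only where \<open>W\<close> is large:
  \<open>ratio_integral_lower_bound\<close> and \<open>ln u \<le> u - 1\<close> bound its negative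
  part by a constant plus the integrable function \<open>op_norm (W y)\<close>.\<close>

lemma integrable_ln_ratio_integral:
  assumes p: "0 < p" and int: "integrable M (\<lambda>y. log_plus (ratio_integral p y))"
  shows "integrable M (\<lambda>y. ln (ratio_integral p y))"
proof -
  obtain c where c: "0 < c"
    "\<And>y. y \<in> space M \<Longrightarrow> invertible (W y) \<Longrightarrow> c \<le> ratio_integral p y * op_norm (W y)"
    using ratio_integral_lower_bound[OF p] by blast
  have "integrable M (\<lambda>y. log_plus (ratio_integral p y) + (\<bar>ln c\<bar> + op_norm (W y)))"
    by (intro Bochner_Integration.integrable_add int integrable_W integrable_const)
  then show ?thesis
  proof (rule Bochner_Integration.integrable_bound)
    show "AE y in M. norm (ln (ratio_integral p y)) \<le> norm (log_plus (ratio_integral p y) + (\<bar>ln c\<bar> + op_norm (W y)))"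
      using AE_invertible AE_ratio_integral_pos[OF p]
    proof eventually_elim
      case (elim y)
      have pos: "0 < op_norm (W y)" using elim by (intro op_norm_pos) simp
      have "ln c \<le> ln (ratio_integral p y * op_norm (W y))"
        using c elim pos by (subst ln_le_cancel_iff) auto
      also have "\<dots> = ln (ratio_integral p y) + ln (op_norm (W y))"
        using elim pos by (intro ln_mult_pos) auto
      finally have "- ln (ratio_integral p y) \<le> \<bar>ln c\<bar> + op_norm (W y)"
        using ln_le_minus_one[OF pos] by linarith
      moreover have "ln (ratio_integral p y) \<le> log_plus (ratio_integral p y)" "0 \<le> log_plus (ratio_integral p y)"
        by (simp_all add: log_plus_def)
      ultimately show ?case using op_norm_nonneg[of "W y"] unfolding real_norm_def by linarith
    qed
  qed measurable
qed

section \<open>Monotonicity in the exponent\<close>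

lemma weight_ratio_antimono:
  assumes pq: "0 < p" "p < q" and x: "x \<in> space M" "invertible (W x)" and y: "y \<in> space M" "invertible (W y)"
  shows "weight_ratio q W x y powr q \<le> weight_ratio p W x y powr p"
proof -
  have "invertible (pow (1 / p) x ** pow (- (1 / p)) y)"
    using invertible_pow x y by (intro invertible_mult) auto
  then have "0 < op_norm (pow (1 / p) x ** pow (- (1 / p)) y)" by (rule op_norm_pos)
  then have "op_norm (mat_rpow (pow (1 / p) x) (p / q) ** mat_rpow (pow (- (1 / p)) y) (p / q))
      \<le> op_norm (pow (1 / p) x ** pow (- (1 / p)) y) powr (p / q)"
    using pq x y unfolding pow_def by (intro op_norm_rpow_mult_le nonneg_definite_rpow nonneg_W) auto
  then have "weight_ratio q W x y \<le> weight_ratio p W x y powr (p / q)"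
    using pq x y by (simp add: weight_ratio_eq pow_def mat_rpow_rpow nonneg_W)
  then have "weight_ratio q W x y powr q \<le> (weight_ratio p W x y powr (p / q)) powr q"
    using pq by (intro powr_mono2) auto
  then show ?thesis using pq by (simp add: powr_powr)
qed

lemma ratio_integral_antimono:
  assumes "0 < p" "p < q" "y \<in> space M" "invertible (W y)"
  shows "ratio_integral q y \<le> ratio_integral p y"
  unfolding ratio_integral_def
proof (rule integral_mono_AE)
  show "AE x in M. weight_ratio q W x y powr q \<le> weight_ratio p W x y powr p"
    using AE_invertible by eventually_elim (intro weight_ratio_antimono assms; simp)
qed (use assms in \<open>auto intro!: integrable_weight_ratio\<close>)

lemma Apinf_antimono:
  assumes pq: "0 < p" "p < q" and int: "integrable M (\<lambda>y. log_plus (ratio_integral p y))"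
  shows "integrable M (\<lambda>y. log_plus (ratio_integral q y))"
    "(\<integral>y. ln (ratio_integral q y) \<partial>M) \<le> (\<integral>y. ln (ratio_integral p y) \<partial>M)"
proof -
  have AE: "AE y in M. ln (ratio_integral q y) \<le> ln (ratio_integral p y)"
    using AE_invertible AE_ratio_integral_pos[OF pq(1)] AE_ratio_integral_pos[OF less_trans[OF pq]]
  proof eventually_elim
    case (elim y)
    then show ?case using ratio_integral_antimono[OF pq, of y] pq by (subst ln_le_cancel_iff) auto
  qed
  then have "AE y in M. norm (log_plus (ratio_integral q y)) \<le> norm (log_plus (ratio_integral p y))"
    by eventually_elim (auto simp: log_plus_def)
  then show int': "integrable M (\<lambda>y. log_plus (ratio_integral q y))"
    by (intro Bochner_Integration.integrable_bound[OF int]) (auto simp: log_plus_def)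
  show "(\<integral>y. ln (ratio_integral q y) \<partial>M) \<le> (\<integral>y. ln (ratio_integral p y) \<partial>M)"
    using pq by (intro integral_mono_AE integrable_ln_ratio_integral int int' AE) auto
qed

text \<open>Serves exponents at most 1, where an essential supremum bounds
  \<open>ratio_integral\<close> itself; taking the mean of the logarithm of that bound loses
  nothing, whence the constant 1.\<close>

lemma Apinf_of_bounded:
  assumes p: "0 < p" and c: "AE y in M. ratio_integral p y \<le> c"
  shows "integrable M (\<lambda>y. log_plus (ratio_integral p y))"
    "exp (\<integral>y. ln (ratio_integral p y) \<partial>M) \<le> c"
proof -
  have "AE y in M. norm (log_plus (ratio_integral p y)) \<le> \<bar>ln c\<bar>"
    using c AE_ratio_integral_pos[OF p]
  proof eventually_elim
    case (elim y)
    then have "ln (ratio_integral p y) \<le> ln c" by (subst ln_le_cancel_iff) auto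
    then show ?case by (auto simp: log_plus_def)
  qed
  then show int: "integrable M (\<lambda>y. log_plus (ratio_integral p y))"
    by (intro integrable_const_bound[of _ "\<bar>ln c\<bar>"]) (auto simp: log_plus_def)
  have "0 < c"
  proof (rule ccontr)
    assume "\<not> 0 < c"
    have "AE y in M. False" using c AE_ratio_integral_pos[OF p]
      by eventually_elim (use \<open>\<not> 0 < c\<close> in linarith)
    then show False by simp
  qed
  have "(\<integral>y. ln (ratio_integral p y) \<partial>M) \<le> (\<integral>y. ln c \<partial>M)"
  proof (rule integral_mono_AE)
    show "AE y in M. ln (ratio_integral p y) \<le> ln c"
      using c AE_ratio_integral_pos[OF p]
      by eventually_elim (use \<open>0 < c\<close> in \<open>subst ln_le_cancel_iff; simp\<close>)
  qed (auto intro!: integrable_ln_ratio_integral int p)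
  then have "exp (\<integral>y. ln (ratio_integral p y) \<partial>M) \<le> exp (ln c)" by (simp add: prob_space)
  then show "exp (\<integral>y. ln (ratio_integral p y) \<partial>M) \<le> c" using \<open>0 < c\<close> by simp
qed

section \<open>Reducing operators of a weight\<close>

text \<open>The constant is part of the definition and depends on the matrix size and
  \<open>p\<close> only, so the estimates built on it are uniform in the cube, the weight and the
  dimension.\<close>

definition reducing :: "real \<Rightarrow> complex^'m^'m \<Rightarrow> bool" where
  "reducing p S \<longleftrightarrow> invertible S \<and>
    (\<forall>X. op_norm (S ** X) powr p \<le> real CARD('m) powr (2 * p + 2) * (\<integral>x. op_norm (pow (1 / p) x ** X) powr p \<partial>M)) \<and>
    (\<forall>X. (\<integral>x. op_norm (pow (1 / p) x ** X) powr p \<partial>M) \<le> real CARD('m) powr (2 * p + 2) * op_norm (S ** X) powr p)"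

lemma reducing_exists: "0 < p \<Longrightarrow> \<exists>S. reducing p S"
  unfolding reducing_def
  using reducing_operator[OF _ measurable_pow integrable_pow AE_invertible_pow, of p] by metis

definition reduced :: "real \<Rightarrow> complex^'m^'m \<Rightarrow> (nat \<Rightarrow> real) \<Rightarrow> real" where
  "reduced p S y = op_norm (S ** pow (- (1 / p)) y) powr p"

lemma measurable_reduced [measurable]: "reduced p S \<in> borel_measurable M"
  unfolding reduced_def[abs_def] by measurable

lemma reduced_nonneg [simp]: "0 \<le> reduced p S y" by (simp add: reduced_def)

lemma reduced_le: "reducing p S \<Longrightarrow> reduced p S y \<le> real CARD('m) powr (2 * p + 2) * ratio_integral p y"
  unfolding reducing_def reduced_def ratio_integral_def weight_ratio_eq by blast

lemma ratio_integral_le_reduced: "reducing p S \<Longrightarrow> ratio_integral p y \<le> real CARD('m) powr (2 * p + 2) * reduced p S y"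
  unfolding reducing_def reduced_def ratio_integral_def weight_ratio_eq by blast

lemma AE_reduced_pos: "invertible S \<Longrightarrow> AE y in M. 0 < reduced p S y"
  using AE_invertible_pow[of "- (1 / p)"]
  by eventually_elim (simp add: reduced_def op_norm_pos invertible_mult less_imp_neq[THEN not_sym])

end

lemma ennreal_powr_ennreal: "0 \<le> u \<Longrightarrow> ennreal_powr (ennreal u) a = ennreal (u powr a)"
  by (simp add: ennreal_powr_def)

lemma ennreal_powr_mono: "x \<le> y \<Longrightarrow> 0 \<le> a \<Longrightarrow> ennreal_powr x a \<le> ennreal_powr y a"
  by (auto simp: ennreal_powr_def top_unique less_top intro!: ennreal_leI powr_mono2 enn2real_mono)

lemma log_plus_nonneg [simp]: "0 \<le> log_plus t" by (simp add: log_plus_def)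

lemma log_plus_mono: "0 < s \<Longrightarrow> s \<le> t \<Longrightarrow> log_plus s \<le> log_plus t"
  using ln_le_cancel_iff[of s t] unfolding log_plus_def by linarith

lemma log_plus_mult_le: "0 < s \<Longrightarrow> 0 < t \<Longrightarrow> log_plus (s * t) \<le> log_plus s + log_plus t"
  by (simp add: log_plus_def ln_mult_pos)

lemma log_plus_le_self: "0 < t \<Longrightarrow> log_plus t \<le> t"
  using ln_le_minus_one[of t] by (simp add: log_plus_def)

lemma borel_measurable_log_plus [measurable (raw)]:
  assumes [measurable]: "f \<in> borel_measurable M"
  shows "(\<lambda>x. log_plus (f x)) \<in> borel_measurable M"
  unfolding log_plus_def by measurable

lemma matrix_inv_mult:
  fixes S :: "complex^'m::finite^'m"
  assumes "invertible S"
  shows "S ** matrix_inv S = mat 1" "matrix_inv S ** S = mat 1"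
proof -
  have "S ** matrix_inv S = mat 1 \<and> matrix_inv S ** S = mat 1"
    using assms unfolding invertible_def matrix_inv_def by (rule someI_ex)
  then show "S ** matrix_inv S = mat 1" "matrix_inv S ** S = mat 1" by simp_all
qed

lemma invertible_matrix_inv:
  fixes S :: "complex^'m::finite^'m"
  shows "invertible S \<Longrightarrow> invertible (matrix_inv S)"
  unfolding invertible_def[of "matrix_inv S"] using matrix_inv_mult[of S] by blast

context weight_space
begin

definition dual_reduced :: "real \<Rightarrow> complex^'m^'m \<Rightarrow> (nat \<Rightarrow> real) \<Rightarrow> real" where
  "dual_reduced p S x = op_norm (pow (1 / p) x ** matrix_inv S) powr p"

lemma measurable_dual_reduced [measurable]: "dual_reduced p S \<in> borel_measurable M"
  unfolding dual_reduced_def[abs_def] by measurable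

lemma dual_reduced_nonneg [simp]: "0 \<le> dual_reduced p S x"
  by (simp add: dual_reduced_def)

lemma integrable_dual_reduced: "0 < p \<Longrightarrow> integrable M (dual_reduced p S)"
  unfolding dual_reduced_def[abs_def] by (rule integrable_pow_mult)

text \<open>Test the upper estimate with \<open>X = matrix_inv S\<close>. This uniform bound,
  combined with \<open>ln u \<le> u - 1\<close>, absorbs every logarithm of
  \<open>dual_reduced\<close> that appears later.\<close>

lemma integral_dual_reduced:
  assumes "reducing p S"
  shows "(\<integral>x. dual_reduced p S x \<partial>M) \<le> real CARD('m) powr (2 * p + 2)"
proof -
  have S: "invertible S" using assms by (simp add: reducing_def)
  have "(\<integral>x. dual_reduced p S x \<partial>M) \<le> real CARD('m) powr (2 * p + 2) * op_norm (S ** matrix_inv S) powr p"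
    using assms unfolding reducing_def dual_reduced_def by blast
  then show ?thesis by (simp add: matrix_inv_mult(1)[OF S] op_norm_mat1)
qed

lemma AE_dual_reduced_pos: "invertible S \<Longrightarrow> AE y in M. 0 < dual_reduced p S y"
  using AE_invertible_pow[of "1 / p"]
proof eventually_elim
  case (elim y)
  have "invertible (matrix_inv S)" by (rule invertible_matrix_inv[OF elim(1)])
  from op_norm_pos[OF invertible_mult[OF elim(2) this]] show ?case
    by (simp add: dual_reduced_def)
qed

text \<open>Inserting \<open>matrix_inv S ** S\<close> between the two powers separates the
  variables.\<close>

lemma weight_ratio_le_reduced:
  assumes "0 < p" "invertible S"
  shows "weight_ratio p W x y powr p \<le> dual_reduced p S x * reduced p S y"
proof -
  have "pow (1 / p) x ** pow (- (1 / p)) y = (pow (1 / p) x ** matrix_inv S) ** (S ** pow (- (1 / p)) y)"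
  proof -
    have "(pow (1 / p) x ** matrix_inv S) ** (S ** pow (- (1 / p)) y)
        = pow (1 / p) x ** (matrix_inv S ** S) ** pow (- (1 / p)) y"
      by (simp only: matrix_mul_assoc)
    then show ?thesis by (simp add: matrix_inv_mult(2)[OF assms(2)])
  qed
  then show ?thesis
    using op_norm_mult_powr_le[of p "pow (1 / p) x ** matrix_inv S" "S ** pow (- (1 / p)) y"] assms(1)
    by (simp add: weight_ratio_eq dual_reduced_def reduced_def)
qed

text \<open>Both quantities compare \<open>S'\<close> with \<open>S\<close> through the factorisations
  \<open>S' W\<^bsup>-1/p\<^esup> = (S' S\<^sup>-\<^sup>1)(S W\<^bsup>-1/p\<^esup>)\<close> and \<open>S' S\<^sup>-\<^sup>1 = (S' W\<^bsup>-1/p\<^esup>)(W\<^bsup>1/p\<^esup> S\<^sup>-\<^sup>1)\<close>.\<close>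

lemma reduced_change:
  assumes "0 < p" "invertible S"
  shows "reduced p S' y \<le> op_norm (S' ** matrix_inv S) powr p * reduced p S y"
    and "y \<in> space M \<Longrightarrow> invertible (W y) \<Longrightarrow>
      op_norm (S' ** matrix_inv S) powr p \<le> reduced p S' y * dual_reduced p S y"
proof -
  have "(S' ** matrix_inv S) ** (S ** pow (- (1 / p)) y) = S' ** (matrix_inv S ** S) ** pow (- (1 / p)) y"
    by (simp only: matrix_mul_assoc)
  then have "S' ** pow (- (1 / p)) y = (S' ** matrix_inv S) ** (S ** pow (- (1 / p)) y)"
    by (simp add: matrix_inv_mult(2)[OF assms(2)])
  then show "reduced p S' y \<le> op_norm (S' ** matrix_inv S) powr p * reduced p S y"
    using op_norm_mult_powr_le[of p "S' ** matrix_inv S" "S ** pow (- (1 / p)) y"] assms(1)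
    by (simp add: reduced_def)
next
  assume y: "y \<in> space M" "invertible (W y)"
  have "(S' ** pow (- (1 / p)) y) ** (pow (1 / p) y ** matrix_inv S)
      = S' ** (pow (- (1 / p)) y ** pow (1 / p) y) ** matrix_inv S"
    by (simp only: matrix_mul_assoc)
  then have "S' ** matrix_inv S = (S' ** pow (- (1 / p)) y) ** (pow (1 / p) y ** matrix_inv S)"
    by (simp add: pow_minus_mult[OF y])
  then show "op_norm (S' ** matrix_inv S) powr p \<le> reduced p S' y * dual_reduced p S y"
    using op_norm_mult_powr_le[of p "S' ** pow (- (1 / p)) y" "pow (1 / p) y ** matrix_inv S"] assms(1)
    by (simp add: reduced_def dual_reduced_def)
qed

text \<open>A mean of logarithms controls the positive part only together with the negative part.
  The latter is handled by \<open>1 \<le> reduced p S y * dual_reduced p S y\<close>, which is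
  \<open>reduced_change\<close> for \<open>S' = S\<close>: the negative part of
  \<open>ln (reduced p S y)\<close> is at most \<open>dual_reduced p S y\<close>, of mean at most
  \<open>K\<close>.\<close>

lemma nn_integral_log_plus_reduced:
  assumes p: "0 < p" and S: "reducing p S" and int: "integrable M (\<lambda>y. log_plus (ratio_integral p y))"
  defines "K \<equiv> real CARD('m) powr (2 * p + 2)"
  shows "(\<integral>\<^sup>+y. ennreal (log_plus (reduced p S y)) \<partial>M)
    \<le> ennreal (ln K + (\<integral>y. ln (ratio_integral p y) \<partial>M) + K)"
proof -
  have K: "0 < K" by (simp add: K_def)
  have inv: "invertible S" using S by (simp add: reducing_def)
  define g where "g y = ln K + ln (ratio_integral p y) + dual_reduced p S y" for y
  have g: "integrable M g" unfolding g_def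
    by (intro Bochner_Integration.integrable_add integrable_const integrable_ln_ratio_integral p int integrable_dual_reduced)
  have AE: "AE y in M. log_plus (reduced p S y) \<le> g y"
    using AE_invertible AE_reduced_pos[OF inv, of p] AE_dual_reduced_pos[OF inv, of p] AE_ratio_integral_pos[OF p]
  proof eventually_elim
    case (elim y)
    have "1 \<le> reduced p S y * dual_reduced p S y"
      using reduced_change(2)[OF p inv, of y S] elim by (simp add: matrix_inv_mult(1)[OF inv] op_norm_mat1)
    then have "0 \<le> ln (reduced p S y * dual_reduced p S y)" by (rule ln_ge_zero)
    also have "\<dots> = ln (reduced p S y) + ln (dual_reduced p S y)"
      using elim by (intro ln_mult_pos) auto
    finally have "0 \<le> ln (reduced p S y) + dual_reduced p S y"
      using ln_le_minus_one[of "dual_reduced p S y"] elim by linarith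
    moreover have "ln (reduced p S y) \<le> ln (K * ratio_integral p y)"
      using reduced_le[OF S, of y] elim K by (subst ln_le_cancel_iff) (auto simp: K_def)
    moreover have "ln (K * ratio_integral p y) = ln K + ln (ratio_integral p y)"
      using elim K by (intro ln_mult_pos) auto
    ultimately show ?case using elim unfolding g_def log_plus_def by auto
  qed
  then have nn: "AE y in M. 0 \<le> g y"
    by eventually_elim (rule order_trans[OF log_plus_nonneg])
  have "(\<integral>\<^sup>+y. ennreal (log_plus (reduced p S y)) \<partial>M) \<le> (\<integral>\<^sup>+y. ennreal (g y) \<partial>M)"
    using AE by (intro nn_integral_mono_AE) (auto elim!: eventually_mono intro: ennreal_leI)
  also have "\<dots> = ennreal (\<integral>y. g y \<partial>M)" by (rule nn_integral_eq_integral[OF g nn])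
  also have "(\<integral>y. g y \<partial>M) = ln K + (\<integral>y. ln (ratio_integral p y) \<partial>M) + (\<integral>y. dual_reduced p S y \<partial>M)"
    unfolding g_def using p
    by (simp add: integrable_ln_ratio_integral int integrable_dual_reduced prob_space)
  also have "ennreal \<dots> \<le> ennreal (ln K + (\<integral>y. ln (ratio_integral p y) \<partial>M) + K)"
    using integral_dual_reduced[OF S] by (intro ennreal_leI) (simp add: K_def)
  finally show ?thesis .
qed

text \<open>The number \<open>c\<close> does not depend on \<open>y\<close>: averaging the second
  estimate of \<open>reduced_change\<close> bounds \<open>log_plus c\<close> by
  \<open>t + K\<close>, and the first estimate then compares pointwise. In the application
  \<open>M\<close> and \<open>S\<close> belong to the subcube, \<open>S'\<close> to the larger
  cube.\<close>

lemma log_plus_reduced_change: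
  assumes p: "0 < p" and S: "reducing p S" and S': "invertible S'" and t: "0 \<le> t"
    and avg: "(\<integral>\<^sup>+y. ennreal (log_plus (reduced p S' y)) \<partial>M) \<le> ennreal t"
  shows "AE y in M. log_plus (reduced p S' y) \<le> t + real CARD('m) powr (2 * p + 2) + log_plus (reduced p S y)"
proof -
  define K where "K = real CARD('m) powr (2 * p + 2)"
  have inv: "invertible S" using S by (simp add: reducing_def)
  define c where "c = op_norm (S' ** matrix_inv S) powr p"
  have "invertible (matrix_inv S)" by (rule invertible_matrix_inv[OF inv])
  from op_norm_pos[OF invertible_mult[OF S' this]] have c: "0 < c" by (simp add: c_def)
  have AE: "AE y in M. log_plus c \<le> log_plus (reduced p S' y) + dual_reduced p S y"
    using AE_invertible AE_reduced_pos[OF S', of p] AE_dual_reduced_pos[OF inv, of p]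
  proof eventually_elim
    case (elim y)
    have "log_plus c \<le> log_plus (reduced p S' y * dual_reduced p S y)"
      using reduced_change(2)[OF p inv, of y S'] elim c by (intro log_plus_mono) (auto simp: c_def)
    also have "\<dots> \<le> log_plus (reduced p S' y) + log_plus (dual_reduced p S y)"
      using elim by (intro log_plus_mult_le) auto
    finally show ?case using log_plus_le_self[of "dual_reduced p S y"] elim by linarith
  qed
  have "ennreal (log_plus c) = (\<integral>\<^sup>+y. ennreal (log_plus c) \<partial>M)" by (simp add: emeasure_space_1)
  also have "\<dots> \<le> (\<integral>\<^sup>+y. ennreal (log_plus (reduced p S' y)) + ennreal (dual_reduced p S y) \<partial>M)"
    using AE by (intro nn_integral_mono_AE) (auto elim!: eventually_mono simp: ennreal_plus[symmetric] simp del: ennreal_plus intro: ennreal_leI)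
  also have "\<dots> = (\<integral>\<^sup>+y. ennreal (log_plus (reduced p S' y)) \<partial>M) + (\<integral>\<^sup>+y. ennreal (dual_reduced p S y) \<partial>M)"
    by (rule nn_integral_add) measurable
  also have "(\<integral>\<^sup>+y. ennreal (dual_reduced p S y) \<partial>M) = ennreal (\<integral>y. dual_reduced p S y \<partial>M)"
    by (rule nn_integral_eq_integral[OF integrable_dual_reduced[OF p]]) simp
  also have "(\<integral>\<^sup>+y. ennreal (log_plus (reduced p S' y)) \<partial>M) + \<dots> \<le> ennreal t + ennreal K"
    using integral_dual_reduced[OF S] by (intro add_mono avg ennreal_leI) (simp add: K_def)
  finally have "ennreal (log_plus c) \<le> ennreal (t + K)" using t by (simp add: K_def)
  then have lc: "log_plus c \<le> t + K" using t by (subst (asm) ennreal_le_iff) (auto simp: K_def)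
  show ?thesis
    using AE_reduced_pos[OF S', of p] AE_reduced_pos[OF inv, of p]
  proof eventually_elim
    case (elim y)
    have "log_plus (reduced p S' y) \<le> log_plus (c * reduced p S y)"
      using reduced_change(1)[OF p inv, of S' y] elim by (intro log_plus_mono) (auto simp: c_def)
    also have "\<dots> \<le> log_plus c + log_plus (reduced p S y)" using elim c by (intro log_plus_mult_le) auto
    finally show ?case using lc by (simp add: K_def)
  qed
qed

text \<open>Cordes' inequality leads from \<open>q\<close> back to \<open>p\<close>, where the
  variables separate: the inner integral sees \<open>reduced\<close>, the outer one
  \<open>dual_reduced\<close>, whose mean is bounded.\<close>

lemma Ap_bound_of_exponential_integrability:
  assumes p: "0 < p" and q: "1 < q" "p < q" and S: "reducing p S" and c: "0 \<le> c"
    and \<delta>: "1 / (q - 1) \<le> \<delta>"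
    and exp: "(\<integral>\<^sup>+y. ennreal (exp (\<delta> * log_plus (reduced p S y))) \<partial>M) \<le> ennreal c"
  shows "(\<integral>\<^sup>+x. ennreal_powr (\<integral>\<^sup>+y. ennreal (weight_ratio q W x y powr (q / (q - 1))) \<partial>M) (q / (q / (q - 1))) \<partial>M)
    \<le> ennreal (c powr (q - 1) * real CARD('m) powr (2 * p + 2))"
proof -
  have inv: "invertible S" using S by (simp add: reducing_def)
  \<comment> \<open>The conjugate exponent of \<open>q\<close> is \<open>q * e\<close>, so both
    factors enter the inner integral with power \<open>e\<close>; the outer exponent
    \<open>q - 1\<close> undoes this and leaves \<open>dual_reduced\<close> to the first
    power.\<close>
  define e where "e = 1 / (q - 1)"
  have e: "0 < e" "e * (q - 1) = 1" using q by (simp_all add: e_def)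
  have qq: "q / (q * e) = q - 1" "q / (q - 1) = q * e" using q by (simp_all add: e_def)
  have "AE x in M. ennreal_powr (\<integral>\<^sup>+y. ennreal (weight_ratio q W x y powr (q * e)) \<partial>M) (q - 1)
      \<le> ennreal (c powr (q - 1)) * ennreal (dual_reduced p S x)"
    using AE_invertible
  proof eventually_elim
    case (elim x)
    have "(\<integral>\<^sup>+y. ennreal (weight_ratio q W x y powr (q * e)) \<partial>M)
        \<le> (\<integral>\<^sup>+y. ennreal (dual_reduced p S x powr e) * ennreal (exp (\<delta> * log_plus (reduced p S y))) \<partial>M)"
    proof (intro nn_integral_mono_AE)
      show "AE y in M. ennreal (weight_ratio q W x y powr (q * e))
          \<le> ennreal (dual_reduced p S x powr e) * ennreal (exp (\<delta> * log_plus (reduced p S y)))"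
        using AE_invertible AE_reduced_pos[OF inv, of p]
      proof eventually_elim
        case (elim y)
        have "weight_ratio q W x y powr q \<le> dual_reduced p S x * reduced p S y"
          using weight_ratio_antimono[OF p q(2), of x y] weight_ratio_le_reduced[OF p inv, of x y]
            \<open>x \<in> space M \<and> invertible (W x)\<close> elim by simp
        then have "(weight_ratio q W x y powr q) powr e \<le> (dual_reduced p S x * reduced p S y) powr e"
          using e by (intro powr_mono2) auto
        then have 1: "weight_ratio q W x y powr (q * e) \<le> dual_reduced p S x powr e * reduced p S y powr e"
          by (simp add: powr_powr powr_mult)
        have "reduced p S y powr e = exp (e * ln (reduced p S y))" using elim by (simp add: powr_def)
        also have "e * ln (reduced p S y) \<le> e * log_plus (reduced p S y)"
          using e by (intro mult_left_mono) (auto simp: log_plus_def)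
        also have "\<dots> \<le> \<delta> * log_plus (reduced p S y)"
          using \<delta> by (intro mult_right_mono) (auto simp: e_def)
        finally have "reduced p S y powr e \<le> exp (\<delta> * log_plus (reduced p S y))" by simp
        then have "weight_ratio q W x y powr (q * e) \<le> dual_reduced p S x powr e * exp (\<delta> * log_plus (reduced p S y))"
          using 1 by (meson mult_left_mono order_trans powr_ge_zero)
        then show ?case by (simp add: ennreal_mult[symmetric] ennreal_leI)
      qed
    qed
    also have "\<dots> = ennreal (dual_reduced p S x powr e) * (\<integral>\<^sup>+y. ennreal (exp (\<delta> * log_plus (reduced p S y))) \<partial>M)"
      by (rule nn_integral_cmult) measurable
    also have "\<dots> \<le> ennreal (dual_reduced p S x powr e) * ennreal c" by (intro mult_left_mono exp) simp
    also have "\<dots> = ennreal (dual_reduced p S x powr e * c)" using c by (simp add: ennreal_mult)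
    finally have "ennreal_powr (\<integral>\<^sup>+y. ennreal (weight_ratio q W x y powr (q * e)) \<partial>M) (q - 1)
        \<le> ennreal_powr (ennreal (dual_reduced p S x powr e * c)) (q - 1)"
      using q by (intro ennreal_powr_mono) auto
    also have "\<dots> = ennreal ((dual_reduced p S x powr e * c) powr (q - 1))"
      using c by (intro ennreal_powr_ennreal) simp
    also have "(dual_reduced p S x powr e * c) powr (q - 1) = c powr (q - 1) * dual_reduced p S x"
      using e by (simp add: powr_mult powr_powr)
    finally show ?case by (simp add: ennreal_mult)
  qed
  then have "(\<integral>\<^sup>+x. ennreal_powr (\<integral>\<^sup>+y. ennreal (weight_ratio q W x y powr (q * e)) \<partial>M) (q - 1) \<partial>M)
      \<le> (\<integral>\<^sup>+x. ennreal (c powr (q - 1)) * ennreal (dual_reduced p S x) \<partial>M)"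
    by (rule nn_integral_mono_AE)
  also have "\<dots> = ennreal (c powr (q - 1)) * (\<integral>\<^sup>+x. ennreal (dual_reduced p S x) \<partial>M)"
    by (rule nn_integral_cmult) measurable
  also have "(\<integral>\<^sup>+x. ennreal (dual_reduced p S x) \<partial>M) = ennreal (\<integral>x. dual_reduced p S x \<partial>M)"
    by (rule nn_integral_eq_integral[OF integrable_dual_reduced[OF p]]) simp
  also have "ennreal (c powr (q - 1)) * \<dots> \<le> ennreal (c powr (q - 1)) * ennreal (real CARD('m) powr (2 * p + 2))"
    by (intro mult_left_mono ennreal_leI integral_dual_reduced S) simp
  also have "\<dots> = ennreal (c powr (q - 1) * real CARD('m) powr (2 * p + 2))"
    by (rule ennreal_mult[symmetric]) simp_all
  finally show ?thesis unfolding qq .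
qed

section \<open>From \<open>A_p\<close> to \<open>A_{p,\<infinity>}\<close> for
  \<open>p > 1\<close>\<close>

lemma measurable_inner_integral [measurable]:
  "(\<lambda>x. \<integral>\<^sup>+y. ennreal (weight_ratio p W x y powr r) \<partial>M) \<in> borel_measurable M"
proof -
  have "(\<lambda>x. \<integral>\<^sup>+y. ennreal (weight_ratio p W (fst (x, y)) (snd (x, y)) powr r) \<partial>M) \<in> borel_measurable M"
    by measurable
  then show ?thesis by simp
qed

text \<open>A finite integral has an almost everywhere finite integrand, and
  \<open>ennreal_powr\<close> keeps the value infinity for every exponent, so the inner integral is
  finite as well.\<close>

lemma finite_inner_integral:
  assumes "(\<integral>\<^sup>+x. ennreal_powr (\<integral>\<^sup>+y. ennreal (weight_ratio p W x y powr r) \<partial>M) s \<partial>M) < \<infinity>"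
  shows "\<exists>x. x \<in> space M \<and> invertible (W x) \<and> (\<integral>\<^sup>+y. ennreal (weight_ratio p W x y powr r) \<partial>M) < \<infinity>"
proof -
  define H where "H x = (\<integral>\<^sup>+y. ennreal (weight_ratio p W x y powr r) \<partial>M)" for x
  have [measurable]: "H \<in> borel_measurable M" unfolding H_def[abs_def] by measurable
  have Hs[measurable]: "(\<lambda>x. ennreal_powr (H x) s) \<in> borel_measurable M"
    unfolding ennreal_powr_def by measurable
  have "AE x in M. ennreal_powr (H x) s \<noteq> \<infinity>"
    using assms unfolding H_def[symmetric] by (intro nn_integral_PInf_AE) auto
  then have AE: "AE x in M. x \<in> space M \<and> invertible (W x) \<and> H x < \<infinity>"
    using AE_invertible
  proof eventually_elim
    case (elim x)
    then show ?case by (cases "H x = \<infinity>") (auto simp: ennreal_powr_def less_top)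
  qed
  have "\<exists>x. x \<in> space M \<and> invertible (W x) \<and> H x < \<infinity>"
  proof (rule ccontr)
    assume none: "\<not> ?thesis"
    from AE have "AE x in M. False" by eventually_elim (use none in blast)
    then show False by simp
  qed
  then show ?thesis by (simp add: H_def)
qed

text \<open>Here \<open>S\<close> and \<open>T\<close> are reducing operators of \<open>W\<^bsup>1/p\<^esup>\<close> of order \<open>p\<close> and of \<open>W\<^bsup>-1/p\<^esup>\<close> of order
  \<open>p'\<close>; both sides are comparable to \<open>op_norm (S T\<^sup>*) ^ p\<close>.\<close>

lemma Apinf_of_Ap:
  assumes p: "1 < p"
  defines "r \<equiv> p / (p - 1)"
  assumes fin: "(\<integral>\<^sup>+x. ennreal_powr (\<integral>\<^sup>+y. ennreal (weight_ratio p W x y powr r) \<partial>M) (p / r) \<partial>M) < \<infinity>"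
  defines "K \<equiv> real CARD('m) powr (2 * p + 2)" and "K' \<equiv> real CARD('m) powr (2 * r + 2)"
  shows "integrable M (\<lambda>y. log_plus (ratio_integral p y))"
    and "ennreal (exp (\<integral>y. ln (ratio_integral p y) \<partial>M))
      \<le> ennreal (K\<^sup>2 * K' powr (2 * (p / r))) * (\<integral>\<^sup>+x. ennreal_powr (\<integral>\<^sup>+y. ennreal (weight_ratio p W x y powr r) \<partial>M) (p / r) \<partial>M)"
proof -
  have p0: "0 < p" using p by simp
  have r: "0 < r" using p by (simp add: r_def)
  define s where "s = p / r"
  have s: "0 < s" "r * s = p" using p0 r by (simp_all add: s_def)
  define H where "H x = (\<integral>\<^sup>+y. ennreal (weight_ratio p W x y powr r) \<partial>M)" for x
  have H[measurable]: "H \<in> borel_measurable M" unfolding H_def[abs_def] by measurable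
  have Hs[measurable]: "(\<lambda>x. ennreal_powr (H x) s) \<in> borel_measurable M"
    unfolding ennreal_powr_def by measurable
  obtain x0 where x0: "x0 \<in> space M" "invertible (W x0)" "H x0 < \<infinity>"
    using finite_inner_integral[OF fin] unfolding H_def by blast
  \<comment> \<open>One good point \<open>x0\<close> suffices: \<open>pow (- (1 / p)) y\<close> is a
    fixed matrix times the product occurring in \<open>H x0\<close>. This integrability is what the
    reducing operator \<open>T\<close> needs.\<close>
  have int_minus: "integrable M (\<lambda>y. op_norm (pow (- (1 / p)) y) powr r)"
  proof (rule integrableI_bounded)
    define k where "k = op_norm (pow (- (1 / p)) x0) powr r"
    have "(\<integral>\<^sup>+y. ennreal (norm (op_norm (pow (- (1 / p)) y) powr r)) \<partial>M)
        \<le> (\<integral>\<^sup>+y. ennreal k * ennreal (weight_ratio p W x0 y powr r) \<partial>M)"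
    proof (rule nn_integral_mono)
      fix y
      have "pow (- (1 / p)) y = pow (- (1 / p)) x0 ** (pow (1 / p) x0 ** pow (- (1 / p)) y)"
        by (simp add: matrix_mul_assoc pow_minus_mult[OF x0(1,2)])
      then have "op_norm (pow (- (1 / p)) y) \<le> op_norm (pow (- (1 / p)) x0) * weight_ratio p W x0 y"
        unfolding weight_ratio_eq by (metis op_norm_mult_le)
      then have "op_norm (pow (- (1 / p)) y) powr r \<le> k * weight_ratio p W x0 y powr r"
        unfolding k_def powr_mult[symmetric] using r by (intro powr_mono2) auto
      then show "ennreal (norm (op_norm (pow (- (1 / p)) y) powr r)) \<le> ennreal k * ennreal (weight_ratio p W x0 y powr r)"
        by (simp add: k_def ennreal_mult[symmetric] ennreal_leI)
    qed
    also have "\<dots> = ennreal k * H x0" unfolding H_def by (rule nn_integral_cmult) measurable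
    also have "\<dots> < \<infinity>" using x0(3) by (simp add: ennreal_mult_less_top)
    finally show "(\<integral>\<^sup>+y. ennreal (norm (op_norm (pow (- (1 / p)) y) powr r)) \<partial>M) < \<infinity>" .
  qed measurable
  obtain S where S: "reducing p S" using reducing_exists[OF p0] by blast
  have invS: "invertible S" using S by (simp add: reducing_def)
  obtain T :: "complex^'m^'m" where T: "invertible T"
    "\<And>X. op_norm (T ** X) powr r \<le> K' * (\<integral>y. op_norm (pow (- (1 / p)) y ** X) powr r \<partial>M)"
    "\<And>X. (\<integral>y. op_norm (pow (- (1 / p)) y ** X) powr r \<partial>M) \<le> K' * op_norm (T ** X) powr r"
    using reducing_operator[OF r measurable_pow int_minus AE_invertible_pow] unfolding K'_def by blast
  have K: "1 \<le> K" "1 \<le> K'"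
    unfolding K_def K'_def using p0 r zero_less_card_finite[where 'a='m] by (auto intro!: ge_one_powr_ge_zero simp: Suc_leI)
  have int_minus_mult: "integrable M (\<lambda>y. op_norm (pow (- (1 / p)) y ** X) powr r)" for X
    by (rule integrable_op_norm_mult_powr) (use r int_minus in auto)
  define e where "e y = op_norm (S ** pow (- (1 / p)) y) powr r" for y
  have e_adj: "e y = op_norm (pow (- (1 / p)) y ** mat_adjoint S) powr r" if "y \<in> space M" for y
    using op_norm_adjoint[of "S ** pow (- (1 / p)) y"] that
    by (simp add: e_def mat_adjoint_mult pow_def mat_adjoint_rpow nonneg_W)
  have int_e: "integrable M e"
    by (subst Bochner_Integration.integrable_cong[OF refl e_adj]) (auto intro: int_minus_mult)
  define E where "E = (\<integral>y. e y \<partial>M)"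
  have red: "reduced p S y = e y powr s" for y using s by (simp add: reduced_def e_def powr_powr)
  have e_pos: "AE y in M. 0 < e y"
    using AE_invertible_pow[of "- (1 / p)"]
  proof eventually_elim
    case (elim y)
    from op_norm_pos[OF invertible_mult[OF invS this]] show ?case by (simp add: e_def)
  qed
  have E: "0 < E"
  proof -
    have "0 \<le> E" unfolding E_def by (rule integral_nonneg_AE) (simp add: e_def)
    moreover have "E \<noteq> 0"
    proof
      assume "E = 0"
      then have "AE y in M. e y = 0"
        unfolding E_def by (subst (asm) integral_nonneg_eq_0_iff_AE[OF int_e]) (auto simp: e_def)
      then have "AE y in M. False" using e_pos by eventually_elim simp
      then show False by simp
    qed
    ultimately show ?thesis by simp
  qed
  \<comment> \<open>Jensen's inequality through the tangent of the logarithm at \<open>E\<close>.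
    The pointwise form yields the integrability of \<open>log_plus\<close> together with the bound
    for the mean.\<close>
  have ln_le: "AE y in M. ln (ratio_integral p y) \<le> ln K + s * (ln E + (e y / E - 1))"
    using e_pos AE_ratio_integral_pos[OF p0]
  proof eventually_elim
    case (elim y)
    have "ln (ratio_integral p y) \<le> ln (K * e y powr s)"
      using ratio_integral_le_reduced[OF S, of y] elim K
      by (subst ln_le_cancel_iff) (auto simp: red K_def intro!: mult_pos_pos)
    also have "\<dots> = ln K + s * ln (e y)" using elim K by (simp add: ln_mult_pos ln_powr)
    also have "ln (e y) \<le> ln E + (e y / E - 1)"
      using ln_le_minus_one[of "e y / E"] elim E by (simp add: ln_div)
    finally show ?case using s by (simp add: mult_left_mono)
  qed
  have int_rhs: "integrable M (\<lambda>y. ln K + s * (ln E + (e y / E - 1)))"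
    using int_e by simp
  show int: "integrable M (\<lambda>y. log_plus (ratio_integral p y))"
  proof (rule Bochner_Integration.integrable_bound[OF int_rhs[THEN integrable_abs]])
    show "AE y in M. norm (log_plus (ratio_integral p y)) \<le> norm \<bar>ln K + s * (ln E + (e y / E - 1))\<bar>"
      using ln_le by eventually_elim (auto simp: log_plus_def)
  qed measurable
  have "(\<integral>y. ln (ratio_integral p y) \<partial>M) \<le> (\<integral>y. ln K + s * (ln E + (e y / E - 1)) \<partial>M)"
    by (rule integral_mono_AE[OF integrable_ln_ratio_integral[OF p0 int] int_rhs ln_le])
  also have "\<dots> = ln K + s * ln E"
    using int_e E by (simp add: prob_space E_def[symmetric])
  also have "\<dots> = ln (K * E powr s)" using K E by (simp add: ln_mult_pos ln_powr)
  finally have "exp (\<integral>y. ln (ratio_integral p y) \<partial>M) \<le> exp (ln (K * E powr s))" by simp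
  then have main: "exp (\<integral>y. ln (ratio_integral p y) \<partial>M) \<le> K * E powr s" using K E by simp
  \<comment> \<open>Adjoints put \<open>S\<close> on the right, where the property of
    \<open>T\<close> applies to it, and afterwards put \<open>T\<close> on the right, where the
    property of \<open>S\<close> applies.\<close>
  have "E = (\<integral>y. op_norm (pow (- (1 / p)) y ** mat_adjoint S) powr r \<partial>M)"
    unfolding E_def by (rule Bochner_Integration.integral_cong[OF refl e_adj])
  also have "\<dots> \<le> K' * op_norm (T ** mat_adjoint S) powr r" by (rule T)
  also have "op_norm (T ** mat_adjoint S) = op_norm (S ** mat_adjoint T)"
    using op_norm_adjoint[of "T ** mat_adjoint S"] by (simp add: mat_adjoint_mult)
  finally have "E powr s \<le> (K' * op_norm (S ** mat_adjoint T) powr r) powr s"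
    using E s by (intro powr_mono2) auto
  also have "\<dots> = K' powr s * op_norm (S ** mat_adjoint T) powr p"
    using s by (simp add: powr_mult powr_powr)
  also have "\<dots> \<le> K' powr s * (K * (\<integral>x. op_norm (pow (1 / p) x ** mat_adjoint T) powr p \<partial>M))"
    using S unfolding reducing_def K_def by (intro mult_left_mono) auto
  finally have Es: "E powr s \<le> K' powr s * K * (\<integral>x. op_norm (pow (1 / p) x ** mat_adjoint T) powr p \<partial>M)"
    by (simp add: mult.assoc)
  \<comment> \<open>The remaining \<open>T\<close> is traded for the inner integral
    \<open>H x\<close>, at the price of a second factor \<open>K' powr s\<close>.\<close>
  have T_le: "ennreal (op_norm (pow (1 / p) x ** mat_adjoint T) powr p) \<le> ennreal (K' powr s) * ennreal_powr (H x) s"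
    if x: "x \<in> space M" for x
  proof -
    have H_eq: "H x = ennreal (\<integral>y. op_norm (pow (- (1 / p)) y ** pow (1 / p) x) powr r \<partial>M)"
      unfolding H_def
      by (subst nn_integral_eq_integral[OF int_minus_mult, symmetric])
        (auto intro!: nn_integral_cong simp: weight_ratio_eq'[OF x])
    have nn: "0 \<le> (\<integral>y. op_norm (pow (- (1 / p)) y ** pow (1 / p) x) powr r \<partial>M)" (is "0 \<le> ?h")
      by (rule integral_nonneg_AE) simp
    have "op_norm (pow (1 / p) x ** mat_adjoint T) = op_norm (T ** pow (1 / p) x)"
      using op_norm_adjoint[of "T ** pow (1 / p) x"] x
      by (simp add: mat_adjoint_mult pow_def mat_adjoint_rpow nonneg_W)
    then have "op_norm (pow (1 / p) x ** mat_adjoint T) powr p = (op_norm (T ** pow (1 / p) x) powr r) powr s"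
      using s by (simp add: powr_powr)
    also have "\<dots> \<le> (K' * ?h) powr s" using s by (intro powr_mono2 T) auto
    also have "\<dots> = K' powr s * ?h powr s" by (rule powr_mult)
    finally show ?thesis
      unfolding H_eq ennreal_powr_ennreal[OF nn] by (simp add: ennreal_mult[symmetric] ennreal_leI)
  qed
  have "ennreal (\<integral>x. op_norm (pow (1 / p) x ** mat_adjoint T) powr p \<partial>M)
      = (\<integral>\<^sup>+x. ennreal (op_norm (pow (1 / p) x ** mat_adjoint T) powr p) \<partial>M)"
    by (rule nn_integral_eq_integral[OF integrable_pow_mult[OF p0], symmetric]) simp
  also have "\<dots> \<le> (\<integral>\<^sup>+x. ennreal (K' powr s) * ennreal_powr (H x) s \<partial>M)"
    by (rule nn_integral_mono[OF T_le])
  also have "\<dots> = ennreal (K' powr s) * (\<integral>\<^sup>+x. ennreal_powr (H x) s \<partial>M)"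
    by (rule nn_integral_cmult) measurable
  finally have int_le: "ennreal (\<integral>x. op_norm (pow (1 / p) x ** mat_adjoint T) powr p \<partial>M)
      \<le> ennreal (K' powr s) * (\<integral>\<^sup>+x. ennreal_powr (H x) s \<partial>M)" .
  have "exp (\<integral>y. ln (ratio_integral p y) \<partial>M) \<le> K * (K' powr s * K * (\<integral>x. op_norm (pow (1 / p) x ** mat_adjoint T) powr p \<partial>M))"
    using main Es K by (meson mult_left_mono order_trans zero_le_one)
  also have "\<dots> = (K\<^sup>2 * K' powr s) * (\<integral>x. op_norm (pow (1 / p) x ** mat_adjoint T) powr p \<partial>M)"
    by (simp add: power2_eq_square)
  finally have "ennreal (exp (\<integral>y. ln (ratio_integral p y) \<partial>M))
      \<le> ennreal (K\<^sup>2 * K' powr s) * ennreal (\<integral>x. op_norm (pow (1 / p) x ** mat_adjoint T) powr p \<partial>M)"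
    by (subst ennreal_mult[symmetric]) (auto intro!: ennreal_leI integral_nonneg_AE)
  also have "\<dots> \<le> ennreal (K\<^sup>2 * K' powr s) * (ennreal (K' powr s) * (\<integral>\<^sup>+x. ennreal_powr (H x) s \<partial>M))"
    by (intro mult_left_mono int_le) simp
  also have "\<dots> = ennreal (K\<^sup>2 * K' powr (2 * s)) * (\<integral>\<^sup>+x. ennreal_powr (H x) s \<partial>M)"
    unfolding mult.assoc[symmetric] by (subst ennreal_mult[symmetric]) (auto simp: powr_add[symmetric] mult.assoc)
  finally show "ennreal (exp (\<integral>y. ln (ratio_integral p y) \<partial>M))
      \<le> ennreal (K\<^sup>2 * K' powr (2 * (p / r))) * (\<integral>\<^sup>+x. ennreal_powr (\<integral>\<^sup>+y. ennreal (weight_ratio p W x y powr r) \<partial>M) (p / r) \<partial>M)"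
    by (simp add: s_def H_def)
qed

end

subsection \<open>Weights on cubes\<close>

abbreviation uniform_on :: "nat \<Rightarrow> (nat \<Rightarrow> real) set \<Rightarrow> (nat \<Rightarrow> real) measure" where
  "uniform_on n Q \<equiv> uniform_measure (lebesgue_n n) Q"

lemma uniform_measure_cube:
  assumes "Q \<in> cubes n"
  shows "prob_space (uniform_on n Q)" "Q \<in> sets (lebesgue_n n)"
    "emeasure (lebesgue_n n) Q \<noteq> 0" "emeasure (lebesgue_n n) Q \<noteq> \<infinity>" "0 < measure (lebesgue_n n) Q"
proof -
  obtain a l where l: "0 < l" "Q \<in> sets (lebesgue_n n)" "AE x in lebesgue_n n. x \<in> Q \<longleftrightarrow> x \<in> hcube n a l"
    "emeasure (lebesgue_n n) Q = ennreal (l ^ n)" "Q \<subseteq> PiE {..<n} (\<lambda>i. {a i..a i + l})"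
    by (rule cubeE[OF assms])
  then show Q: "Q \<in> sets (lebesgue_n n)" "emeasure (lebesgue_n n) Q \<noteq> 0" "emeasure (lebesgue_n n) Q \<noteq> \<infinity>" by simp_all
  show "0 < measure (lebesgue_n n) Q" using l by (simp add: measure_def)
  show "prob_space (uniform_on n Q)"
    using Q by (intro prob_space_uniform_measure) auto
qed

text \<open>Sets that differ by a null set have the same normalised measure, so estimates on
  half-open cubes reach all cubes.\<close>

lemma uniform_measure_cube_eq_hcube:
  assumes "Q \<in> cubes n"
  obtains a l where "0 < l" "uniform_on n Q = uniform_on n (hcube n a l)"
proof -
  obtain a l where l: "0 < l" and Q: "Q \<in> sets (lebesgue_n n)" "AE x in lebesgue_n n. x \<in> Q \<longleftrightarrow> x \<in> hcube n a l"
    and em: "emeasure (lebesgue_n n) Q = ennreal (l ^ n)" and "Q \<subseteq> PiE {..<n} (\<lambda>i. {a i..a i + l})"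
    by (rule cubeE[OF assms])
  have [measurable]: "Q \<in> sets (lebesgue_n n)" "hcube n a l \<in> sets (lebesgue_n n)" using Q sets_hcube by auto
  have "uniform_on n Q = uniform_on n (hcube n a l)"
    unfolding uniform_measure_def em emeasure_hcube[OF less_imp_le[OF l]]
  proof (rule density_cong)
    show "AE x in lebesgue_n n. indicator Q x / ennreal (l ^ n) = indicator (hcube n a l) x / ennreal (l ^ n)"
      using Q(2) by eventually_elim (simp add: indicator_def)
  qed measurable
  then show ?thesis using that l by blast
qed

lemma nn_average_eq:
  "f \<in> borel_measurable (lebesgue_n n) \<Longrightarrow> Q \<in> cubes n \<Longrightarrow>
    nn_average (lebesgue_n n) Q f = (\<integral>\<^sup>+x. f x \<partial>uniform_on n Q)"
  unfolding nn_average_def by (rule nn_integral_uniform_measure[symmetric]) (auto dest: uniform_measure_cube)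

lemma uniform_measure_eq_density:
  assumes "Q \<in> cubes n"
  shows "uniform_on n Q = density (lebesgue_n n) (\<lambda>x. ennreal (indicator Q x / measure (lebesgue_n n) Q))"
proof -
  have "emeasure (lebesgue_n n) Q = ennreal (measure (lebesgue_n n) Q)"
    using uniform_measure_cube[OF assms] by (intro emeasure_eq_ennreal_measure) simp
  then show ?thesis
    unfolding uniform_measure_def using uniform_measure_cube(5)[OF assms]
    by (intro arg_cong[of _ _ "density (lebesgue_n n)"] ext) (simp add: divide_ennreal[symmetric] indicator_def ennreal_0)
qed

lemma average_eq:
  assumes [measurable]: "f \<in> borel_measurable (lebesgue_n n)" and Q: "Q \<in> cubes n"
  shows "average (lebesgue_n n) Q f = (\<integral>x. f x \<partial>uniform_on n Q)"
proof -
  have [measurable]: "Q \<in> sets (lebesgue_n n)" by (rule uniform_measure_cube[OF Q])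
  have "(\<integral>x. f x \<partial>uniform_on n Q)
      = (\<integral>x. (indicator Q x / measure (lebesgue_n n) Q) *\<^sub>R f x \<partial>lebesgue_n n)"
    unfolding uniform_measure_eq_density[OF Q] by (rule integral_density) (auto simp: indicator_def)
  also have "\<dots> = (\<integral>x. (indicator Q x *\<^sub>R f x) / measure (lebesgue_n n) Q \<partial>lebesgue_n n)"
    by (intro Bochner_Integration.integral_cong) auto
  finally show ?thesis by (simp add: average_def set_lebesgue_integral_def)
qed

lemma set_integrable_cube_iff:
  assumes [measurable]: "f \<in> borel_measurable (lebesgue_n n)" and Q: "Q \<in> cubes n"
  shows "set_integrable (lebesgue_n n) Q f \<longleftrightarrow> integrable (uniform_on n Q) (f :: _ \<Rightarrow> real)"
proof -
  have [measurable]: "Q \<in> sets (lebesgue_n n)" by (rule uniform_measure_cube[OF Q])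
  have "integrable (uniform_on n Q) f
      \<longleftrightarrow> integrable (lebesgue_n n) (\<lambda>x. (indicator Q x / measure (lebesgue_n n) Q) *\<^sub>R f x)"
    unfolding uniform_measure_eq_density[OF Q] by (rule integrable_density) (auto simp: indicator_def)
  also have "\<dots> \<longleftrightarrow> integrable (lebesgue_n n) (\<lambda>x. (1 / measure (lebesgue_n n) Q) * (indicator Q x *\<^sub>R f x))"
    by (intro Bochner_Integration.integrable_cong) auto
  finally show ?thesis
    unfolding set_integrable_def integrable_mult_left_iff using uniform_measure_cube(5)[OF Q] by simp
qed

lemma set_nn_integral_le_iff:
  assumes "f \<in> borel_measurable (lebesgue_n n)" and Q: "Q \<in> cubes n"
  shows "(\<integral>\<^sup>+x\<in>Q. f x \<partial>lebesgue_n n) \<le> t * emeasure (lebesgue_n n) Q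
    \<longleftrightarrow> (\<integral>\<^sup>+x. f x \<partial>uniform_on n Q) \<le> t"
proof -
  let ?e = "emeasure (lebesgue_n n) Q"
  have e: "?e \<noteq> 0" "?e \<noteq> \<infinity>" using uniform_measure_cube[OF Q] by auto
  have "(\<integral>\<^sup>+x. f x \<partial>uniform_on n Q) = (\<integral>\<^sup>+x\<in>Q. f x \<partial>lebesgue_n n) / ?e"
    using nn_average_eq[OF assms] by (simp add: nn_average_def)
  moreover have "t * ?e / ?e = t" using e by (simp add: mult_divide_eq_ennreal)
  moreover have "(\<integral>\<^sup>+x\<in>Q. f x \<partial>lebesgue_n n) / ?e * ?e = (\<integral>\<^sup>+x\<in>Q. f x \<partial>lebesgue_n n)"
    using e by (simp add: ennreal_divide_times ennreal_divide_self less_top)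
  ultimately show ?thesis
    by (metis divide_right_mono_ennreal mult_right_mono zero_le)
qed

lemma AE_uniform_measure_cube:
  assumes "Q \<in> cubes n"
  shows "(AE x in uniform_on n Q. P x) \<longleftrightarrow> (AE x in lebesgue_n n. x \<in> Q \<longrightarrow> P x)"
  using uniform_measure_cube[OF assms] by (intro AE_uniform_measure) (auto simp: less_top)

section \<open>Local integrability and restriction to a cube\<close>

text \<open>Tychonoff's theorem in the full product over \<open>nat\<close>: for an extensional
  function the coordinates from \<open>n\<close> on lie in the compact set
  \<open>{undefined}\<close>.\<close>

lemma compact_box: "compact (PiE {..<n} (\<lambda>i. {a i..b i :: real}))"
proof -
  have "compactin (product_topology (\<lambda>i. euclidean) UNIV) (PiE UNIV (\<lambda>i. if i < n then {a i..b i} else {undefined}))"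
    unfolding compactin_PiE by auto
  moreover have "PiE UNIV (\<lambda>i. if i < n then {a i..b i} else {undefined}) = PiE {..<n} (\<lambda>i. {a i..b i})"
    by (auto simp: PiE_iff extensional_def split: if_splits)
  ultimately show ?thesis by (simp add: euclidean_product_topology)
qed

lemma locally_integrable_box:
  "locally_integrable n f \<Longrightarrow> set_integrable (lebesgue_n n) (PiE {..<n} (\<lambda>i. {a i..b i})) f"
  unfolding locally_integrable_def using compact_box[of n a b] by (auto simp: space_lebesgue_n PiE_iff)

text \<open>Integrability is given on compact sets only, so measurability is assembled from boxes
  that exhaust the space.\<close>

lemma locally_integrable_measurable:
  assumes "locally_integrable n f"
  shows "f \<in> borel_measurable (lebesgue_n n)"
proof (rule borel_measurable_LIMSEQ_metric)
  define B where "B j = PiE {..<n} (\<lambda>i. {- real j..real j})" for j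
  show "(\<lambda>x. indicator (B j) x *\<^sub>R f x) \<in> borel_measurable (lebesgue_n n)" for j
    using locally_integrable_box[OF assms, of "\<lambda>_. - real j" "\<lambda>_. real j"]
    unfolding B_def set_integrable_def by (rule borel_measurable_integrable)
  fix x assume "x \<in> space (lebesgue_n n)"
  then have x: "x \<in> PiE {..<n} (\<lambda>_. UNIV)" by (simp add: space_lebesgue_n)
  obtain N where N: "(\<Sum>i<n. \<bar>x i\<bar>) \<le> real N" using real_arch_simple by blast
  have "x \<in> B j" if "N \<le> j" for j
  proof -
    have "\<bar>x i\<bar> \<le> real j" if "i < n" for i
      using member_le_sum[of i "{..<n}" "\<lambda>i. \<bar>x i\<bar>"] N \<open>N \<le> j\<close> that by simp
    then show ?thesis using x by (auto simp: B_def PiE_iff abs_le_iff minus_le_iff)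
  qed
  then have "\<forall>\<^sub>F j in sequentially. indicator (B j) x *\<^sub>R f x = f x"
    by (intro eventually_sequentiallyI[of N]) simp
  then show "(\<lambda>j. indicator (B j) x *\<^sub>R f x) \<longlonglongrightarrow> f x" by (rule tendsto_eventually)
qed

lemma matrix_weight_measurable: "matrix_weight n W \<Longrightarrow> W \<in> borel_measurable (lebesgue_n n)"
  unfolding matrix_weight_def by (intro borel_measurable_matrixI locally_integrable_measurable) blast

lemma op_norm_le_sum_entries: "op_norm A \<le> (\<Sum>j\<in>UNIV. \<Sum>i\<in>UNIV. cmod (A $ i $ j))"
proof -
  have "norm (A *v axis j 1) \<le> (\<Sum>i\<in>UNIV. cmod (A $ i $ j))" for j
    unfolding norm_vec_def[of "A *v axis j 1"] matrix_vector_axis_nth by (rule L2_set_le_sum) simp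
  then have "(\<Sum>j\<in>UNIV. norm (A *v axis j 1)) \<le> (\<Sum>j\<in>UNIV. \<Sum>i\<in>UNIV. cmod (A $ i $ j))"
    by (rule sum_mono)
  then show ?thesis using op_norm_le_sum_columns[of A] by linarith
qed

lemma weight_space_cube:
  assumes W: "matrix_weight n W" and Q: "Q \<in> cubes n"
  shows "weight_space (uniform_on n Q) W"
proof -
  let ?U = "uniform_on n Q"
  interpret prob_space ?U by (rule uniform_measure_cube[OF Q])
  have meas[measurable]: "W \<in> borel_measurable (lebesgue_n n)" by (rule matrix_weight_measurable[OF W])
  obtain a l where "0 < l" and Qs[measurable]: "Q \<in> sets (lebesgue_n n)"
    and "AE x in lebesgue_n n. x \<in> Q \<longleftrightarrow> x \<in> hcube n a l" "emeasure (lebesgue_n n) Q = ennreal (l ^ n)"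
    and Qsub: "Q \<subseteq> PiE {..<n} (\<lambda>i. {a i..a i + l})"
    by (rule cubeE[OF Q])
  have "set_integrable (lebesgue_n n) Q (\<lambda>x. op_norm (W x))"
    unfolding set_integrable_def
  proof (rule Bochner_Integration.integrable_bound)
    \<comment> \<open>The cube need not be closed; the majorant lives on the closed box around it,
      where local integrability applies.\<close>
    have "integrable (lebesgue_n n) (\<lambda>x. indicator (PiE {..<n} (\<lambda>i. {a i..a i + l})) x *\<^sub>R (W x $ i $ j))" for i j
      using W locally_integrable_box[of n "\<lambda>x. W x $ i $ j" a "\<lambda>i. a i + l"] unfolding matrix_weight_def set_integrable_def by blast
    then show "integrable (lebesgue_n n) (\<lambda>x. \<Sum>j\<in>UNIV. \<Sum>i\<in>UNIV.
        norm (indicator (PiE {..<n} (\<lambda>i. {a i..a i + l})) x *\<^sub>R (W x $ i $ j)))"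
      by (intro Bochner_Integration.integrable_sum integrable_norm)
    show "AE x in lebesgue_n n. norm (indicator Q x *\<^sub>R op_norm (W x)) \<le> norm (\<Sum>j\<in>UNIV. \<Sum>i\<in>UNIV.
        norm (indicator (PiE {..<n} (\<lambda>i. {a i..a i + l})) x *\<^sub>R (W x $ i $ j)))"
    proof (rule AE_I2)
      fix x
      show "norm (indicator Q x *\<^sub>R op_norm (W x)) \<le> norm (\<Sum>j\<in>UNIV. \<Sum>i\<in>UNIV.
          norm (indicator (PiE {..<n} (\<lambda>i. {a i..a i + l})) x *\<^sub>R (W x $ i $ j)))"
      proof (cases "x \<in> Q")
        case True
        then have "x \<in> PiE {..<n} (\<lambda>i. {a i..a i + l})" using Qsub by blast
        then show ?thesis using True op_norm_le_sum_entries[of "W x"] by (simp add: sum_nonneg)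
      qed simp
    qed
  qed measurable
  then have int: "integrable ?U (\<lambda>x. op_norm (W x))"
    by (subst (asm) set_integrable_cube_iff) (use Q in measurable)
  show ?thesis
  proof
    show "W \<in> borel_measurable ?U" by simp
    show "nonneg_definite (W x)" if "x \<in> space ?U" for x
      using W that by (simp add: matrix_weight_def)
    show "AE x in ?U. invertible (W x)"
      unfolding AE_uniform_measure_cube[OF Q] using W unfolding matrix_weight_def by (auto elim: eventually_mono)
    show "integrable ?U (\<lambda>x. op_norm (W x))" by (rule int)
  qed
qed

abbreviation ratio_integral_on :: "nat \<Rightarrow> 'm::finite matrix_fun \<Rightarrow> (nat \<Rightarrow> real) set \<Rightarrow> real \<Rightarrow> (nat \<Rightarrow> real) \<Rightarrow> real" where
  "ratio_integral_on n W Q \<equiv> weight_space.ratio_integral (uniform_on n Q) W"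

context
  fixes n :: nat and W :: "'m::finite matrix_fun"
  assumes W: "matrix_weight n W"
begin

lemma weight_average_eq:
  assumes p: "0 < p" and Q: "Q \<in> cubes n"
  shows "weight_average n p W Q y = ennreal (ratio_integral_on n W Q p y)"
proof -
  interpret weight_space "uniform_on n Q" W by (rule weight_space_cube[OF W Q])
  have "(\<lambda>x. ennreal (weight_ratio p W x y powr p)) \<in> borel_measurable (lebesgue_n n)"
    using measurable_weight_ratio(2)[of p y] by simp
  then show ?thesis
    unfolding weight_average_def by (simp add: nn_average_eq[OF _ Q] nn_integral_weight_ratio[OF p])
qed

lemma measurable_ratio_integral_on:
  assumes Q: "Q \<in> cubes n"
  shows "ratio_integral_on n W Q p \<in> borel_measurable (lebesgue_n n)"
proof -
  interpret weight_space "uniform_on n Q" W by (rule weight_space_cube[OF W Q])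
  show ?thesis using measurable_ratio_integral[of p] by simp
qed

lemma Apinf_integrable_iff:
  assumes p: "0 < p"
  shows "Apinf_integrable n p W \<longleftrightarrow>
    (\<forall>Q\<in>cubes n. integrable (uniform_on n Q) (\<lambda>y. log_plus (ratio_integral_on n W Q p y)))"
  unfolding Apinf_integrable_def
proof (rule ball_cong[OF refl])
  fix Q assume Q: "Q \<in> cubes n"
  interpret weight_space "uniform_on n Q" W by (rule weight_space_cube[OF W Q])
  have [measurable]: "ratio_integral p \<in> borel_measurable (lebesgue_n n)" by (rule measurable_ratio_integral_on[OF Q])
  show "set_integrable (lebesgue_n n) Q (\<lambda>y. log_plus (enn2real (weight_average n p W Q y)))
    \<longleftrightarrow> integrable (uniform_on n Q) (\<lambda>y. log_plus (ratio_integral p y))"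
    by (simp add: weight_average_eq[OF p Q]) (rule set_integrable_cube_iff[OF _ Q], measurable)
qed

lemma Apinf_const_eq:
  assumes p: "0 < p" and int: "Apinf_integrable n p W"
  shows "Apinf_const n p W =
    (SUP Q\<in>cubes n. ennreal (exp (\<integral>y. ln (ratio_integral_on n W Q p y) \<partial>uniform_on n Q)))"
proof -
  have "average (lebesgue_n n) Q (\<lambda>y. ln (enn2real (weight_average n p W Q y)))
      = (\<integral>y. ln (ratio_integral_on n W Q p y) \<partial>uniform_on n Q)" if Q: "Q \<in> cubes n" for Q
  proof -
    interpret weight_space "uniform_on n Q" W by (rule weight_space_cube[OF W Q])
    have [measurable]: "ratio_integral p \<in> borel_measurable (lebesgue_n n)" by (rule measurable_ratio_integral_on[OF Q])
    show ?thesis by (simp add: weight_average_eq[OF p Q]) (rule average_eq[OF _ Q], measurable)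
  qed
  then show ?thesis using int by (simp add: Apinf_const_def)
qed

lemma Ap_const_gt_one:
  assumes p: "1 < p"
  shows "Ap_const n p W = (SUP Q\<in>cubes n. \<integral>\<^sup>+x. ennreal_powr
    (\<integral>\<^sup>+y. ennreal (weight_ratio p W x y powr (p / (p - 1))) \<partial>uniform_on n Q) (p / (p / (p - 1)))
      \<partial>uniform_on n Q)"
proof -
  let ?r = "p / (p - 1)"
  have "nn_average (lebesgue_n n) Q (\<lambda>x. ennreal_powr
        (nn_average (lebesgue_n n) Q (\<lambda>y. ennreal (weight_ratio p W x y powr ?r))) (p / ?r))
      = (\<integral>\<^sup>+x. ennreal_powr
        (\<integral>\<^sup>+y. ennreal (weight_ratio p W x y powr ?r) \<partial>uniform_on n Q) (p / ?r)
          \<partial>uniform_on n Q)" if Q: "Q \<in> cubes n" for Q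
  proof -
    interpret weight_space "uniform_on n Q" W by (rule weight_space_cube[OF W Q])
    have "(\<lambda>y. ennreal (weight_ratio p W x y powr ?r)) \<in> borel_measurable (lebesgue_n n)" for x
      using measurable_weight_ratio(3)[of p x] by simp
    then have inner: "nn_average (lebesgue_n n) Q (\<lambda>y. ennreal (weight_ratio p W x y powr ?r))
        = (\<integral>\<^sup>+y. ennreal (weight_ratio p W x y powr ?r) \<partial>uniform_on n Q)" for x
      by (rule nn_average_eq[OF _ Q])
    have "(\<lambda>x. \<integral>\<^sup>+y. ennreal (weight_ratio p W (fst (x, y)) (snd (x, y)) powr ?r) \<partial>uniform_on n Q)
        \<in> borel_measurable (uniform_on n Q)"
      by measurable
    then have [measurable]: "(\<lambda>x. \<integral>\<^sup>+y. ennreal (weight_ratio p W x y powr ?r) \<partial>uniform_on n Q)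
        \<in> borel_measurable (lebesgue_n n)" by simp
    show ?thesis
      unfolding inner by (rule nn_average_eq[OF _ Q]) (unfold ennreal_powr_def, measurable)
  qed
  then show ?thesis using p by (simp add: Ap_const_def Let_def)
qed

lemma Ap_const_le_one:
  assumes p: "0 < p" "p \<le> 1" and Q: "Q \<in> cubes n"
  shows "AE y in uniform_on n Q. ennreal (ratio_integral_on n W Q p y) \<le> Ap_const n p W"
proof -
  have Qs: "Q \<in> sets (lebesgue_n n)" by (rule uniform_measure_cube[OF Q])
  have "AE y in restrict_space (lebesgue_n n) Q. weight_average n p W Q y
      \<le> esssup (restrict_space (lebesgue_n n) Q) (weight_average n p W Q)"
    by (rule esssup_AE)
  then have "AE y in lebesgue_n n. y \<in> Q \<longrightarrow> weight_average n p W Q y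
      \<le> esssup (restrict_space (lebesgue_n n) Q) (weight_average n p W Q)"
    using Qs by (subst (asm) AE_restrict_space_iff) auto
  moreover have "esssup (restrict_space (lebesgue_n n) Q) (weight_average n p W Q) \<le> Ap_const n p W"
  proof -
    have "Ap_const n p W = (SUP Q\<in>cubes n. esssup (restrict_space (lebesgue_n n) Q) (weight_average n p W Q))"
      using p by (simp add: Ap_const_def)
    then show ?thesis
      using SUP_upper[OF Q, of "\<lambda>Q. esssup (restrict_space (lebesgue_n n) Q) (weight_average n p W Q)"] by simp
  qed
  ultimately show ?thesis
    unfolding AE_uniform_measure_cube[OF Q] weight_average_eq[OF p(1) Q]
    by (auto elim!: eventually_mono intro: order_trans)
qed

section \<open>Inclusions between the classes\<close>

lemma Apinf_mono:
  assumes pq: "0 < p" "p < q"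
  shows "Apinf_integrable n p W \<Longrightarrow> Apinf_integrable n q W"
    and "Apinf_const n q W \<le> Apinf_const n p W"
proof -
  have q: "0 < q" using pq by simp
  show *: "Apinf_integrable n q W" if int: "Apinf_integrable n p W"
    unfolding Apinf_integrable_iff[OF q]
  proof
    fix Q assume Q: "Q \<in> cubes n"
    interpret weight_space "uniform_on n Q" W by (rule weight_space_cube[OF W Q])
    show "integrable (uniform_on n Q) (\<lambda>y. log_plus (ratio_integral q y))"
      using int Q unfolding Apinf_integrable_iff[OF pq(1)] by (intro Apinf_antimono(1)[OF pq]) blast
  qed
  show "Apinf_const n q W \<le> Apinf_const n p W"
  proof (cases "Apinf_integrable n p W")
    case True
    show ?thesis
      unfolding Apinf_const_eq[OF pq(1) True] Apinf_const_eq[OF q *[OF True]]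
    proof (rule SUP_mono, intro bexI)
      fix Q assume Q: "Q \<in> cubes n"
      interpret weight_space "uniform_on n Q" W by (rule weight_space_cube[OF W Q])
      show "ennreal (exp (\<integral>y. ln (ratio_integral q y) \<partial>uniform_on n Q))
          \<le> ennreal (exp (\<integral>y. ln (ratio_integral p y) \<partial>uniform_on n Q))"
        using True Q unfolding Apinf_integrable_iff[OF pq(1)]
        by (intro ennreal_leI) (simp add: Apinf_antimono(2)[OF pq])
    qed
  qed (simp add: Apinf_const_def)
qed

lemma Apinf_of_Ap_le_one:
  assumes p: "0 < p" "p \<le> 1"
  shows "Ap_const n p W < \<infinity> \<Longrightarrow> Apinf_integrable n p W"
    and "Apinf_const n p W \<le> Ap_const n p W"
proof -
  have *: "integrable (uniform_on n Q) (\<lambda>y. log_plus (ratio_integral_on n W Q p y))"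
    "ennreal (exp (\<integral>y. ln (ratio_integral_on n W Q p y) \<partial>uniform_on n Q)) \<le> Ap_const n p W"
    if fin: "Ap_const n p W < \<infinity>" and Q: "Q \<in> cubes n" for Q
  proof -
    interpret weight_space "uniform_on n Q" W by (rule weight_space_cube[OF W Q])
    obtain c where c: "0 \<le> c" "Ap_const n p W = ennreal c" using fin by (cases "Ap_const n p W") auto
    have "AE y in uniform_on n Q. ratio_integral p y \<le> c"
      using Ap_const_le_one[OF p Q] unfolding c(2) by eventually_elim (use c(1) in simp)
    from Apinf_of_bounded[OF p(1) this]
    show "integrable (uniform_on n Q) (\<lambda>y. log_plus (ratio_integral p y))"
      "ennreal (exp (\<integral>y. ln (ratio_integral p y) \<partial>uniform_on n Q)) \<le> Ap_const n p W"
      unfolding c(2) by (auto intro: ennreal_leI)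
  qed
  show int: "Apinf_integrable n p W" if "Ap_const n p W < \<infinity>"
    unfolding Apinf_integrable_iff[OF p(1)] using *(1)[OF that] by blast
  show "Apinf_const n p W \<le> Ap_const n p W"
  proof (cases "Ap_const n p W < \<infinity>")
    case True
    show ?thesis unfolding Apinf_const_eq[OF p(1) int[OF True]] by (rule SUP_least) (rule *(2)[OF True])
  qed (simp add: less_top[symmetric])
qed

lemma Apinf_of_Ap_gt_one:
  assumes p: "1 < p"
  defines "C \<equiv> (real CARD('m) powr (2 * p + 2))\<^sup>2 * (real CARD('m) powr (2 * (p / (p - 1)) + 2)) powr (2 * (p / (p / (p - 1))))"
  shows "Ap_const n p W < \<infinity> \<Longrightarrow> Apinf_integrable n p W"
    and "Apinf_const n p W \<le> ennreal C * Ap_const n p W"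
proof -
  have p0: "0 < p" using p by simp
  have C: "0 < C" by (simp add: C_def)
  have *: "integrable (uniform_on n Q) (\<lambda>y. log_plus (ratio_integral_on n W Q p y))"
    "ennreal (exp (\<integral>y. ln (ratio_integral_on n W Q p y) \<partial>uniform_on n Q)) \<le> ennreal C * Ap_const n p W"
    if fin: "Ap_const n p W < \<infinity>" and Q: "Q \<in> cubes n" for Q
  proof -
    interpret weight_space "uniform_on n Q" W by (rule weight_space_cube[OF W Q])
    let ?G = "\<integral>\<^sup>+x. ennreal_powr
      (\<integral>\<^sup>+y. ennreal (weight_ratio p W x y powr (p / (p - 1))) \<partial>uniform_on n Q) (p / (p / (p - 1)))
        \<partial>uniform_on n Q"
    have G: "?G \<le> Ap_const n p W" unfolding Ap_const_gt_one[OF p] by (rule SUP_upper[OF Q])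
    then have Gfin: "?G < \<infinity>" using fin by (rule order_le_less_trans)
    show "integrable (uniform_on n Q) (\<lambda>y. log_plus (ratio_integral p y))"
      by (rule Apinf_of_Ap(1)[OF p Gfin])
    have "ennreal (exp (\<integral>y. ln (ratio_integral p y) \<partial>uniform_on n Q)) \<le> ennreal C * ?G"
      unfolding C_def by (rule Apinf_of_Ap(2)[OF p Gfin])
    also have "\<dots> \<le> ennreal C * Ap_const n p W" by (intro mult_left_mono G) simp
    finally show "ennreal (exp (\<integral>y. ln (ratio_integral p y) \<partial>uniform_on n Q)) \<le> ennreal C * Ap_const n p W" .
  qed
  show int: "Apinf_integrable n p W" if "Ap_const n p W < \<infinity>"
    unfolding Apinf_integrable_iff[OF p0] using *(1)[OF that] by blast
  show "Apinf_const n p W \<le> ennreal C * Ap_const n p W"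
  proof (cases "Ap_const n p W < \<infinity>")
    case True
    show ?thesis unfolding Apinf_const_eq[OF p0 int[OF True]] by (rule SUP_least) (rule *(2)[OF True])
  next
    case False
    then have "Ap_const n p W = \<infinity>" by (simp add: less_top[symmetric])
    then show ?thesis using C by (simp add: ennreal_mult_top)
  qed
qed

lemma Ap_of_Apinf:
  assumes p: "0 < p" and int: "Apinf_integrable n p W" and fin: "Apinf_const n p W < \<infinity>"
  shows "\<exists>q>0. Ap_const n q W < \<infinity>"
proof -
  let ?L = "lebesgue_n n"
  let ?U = "\<lambda>Q. uniform_on n Q"
  define K where "K = real CARD('m) powr (2 * p + 2)"
  have K: "0 < K" by (simp add: K_def)
  obtain w where w: "0 \<le> w" "Apinf_const n p W = ennreal w" using fin by (cases "Apinf_const n p W") auto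
  \<comment> \<open>\<open>w + 1\<close> in place of \<open>w\<close> ensures that the logarithm is
    taken of a positive number.\<close>
  have w_bound: "(\<integral>y. ln (ratio_integral_on n W Q p y) \<partial>?U Q) \<le> ln (w + 1)" if Q: "Q \<in> cubes n" for Q
  proof -
    have "ennreal (exp (\<integral>y. ln (ratio_integral_on n W Q p y) \<partial>?U Q)) \<le> ennreal w"
      unfolding w(2)[symmetric] Apinf_const_eq[OF p int] by (rule SUP_upper[OF Q])
    then have "exp (\<integral>y. ln (ratio_integral_on n W Q p y) \<partial>?U Q) \<le> w + 1" using w(1) by simp
    then show ?thesis using w(1) by (simp add: ln_ge_iff)
  qed
  define S where "S Q = (SOME S. weight_space.reducing (?U Q) W p S)" for Q
  have S: "weight_space.reducing (?U Q) W p (S Q)" if Q: "Q \<in> cubes n" for Q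
    unfolding S_def using weight_space.reducing_exists[OF weight_space_cube[OF W Q] p] by (rule someI_ex)
  define \<psi> where "\<psi> Q y = log_plus (weight_space.reduced W p (S Q) y)" for Q y
  have meas: "\<psi> Q \<in> borel_measurable ?L" if Q: "Q \<in> cubes n" for Q
  proof -
    interpret weight_space "?U Q" W by (rule weight_space_cube[OF W Q])
    have "reduced p (S Q) \<in> borel_measurable ?L" using measurable_reduced[of p "S Q"] by simp
    then show ?thesis unfolding \<psi>_def[abs_def] by measurable
  qed
  define C where "C = max 0 (ln K + ln (w + 1) + K)"
  have avg: "(\<integral>\<^sup>+x\<in>Q. ennreal (\<psi> Q x) \<partial>?L) \<le> ennreal C * emeasure ?L Q" if Q: "Q \<in> cubes n" for Q
  proof -
    interpret weight_space "?U Q" W by (rule weight_space_cube[OF W Q])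
    have [measurable]: "\<psi> Q \<in> borel_measurable ?L" by (rule meas[OF Q])
    have "(\<integral>\<^sup>+y. ennreal (\<psi> Q y) \<partial>?U Q) \<le> ennreal (ln K + (\<integral>y. ln (ratio_integral p y) \<partial>?U Q) + K)"
      unfolding \<psi>_def K_def using int S[OF Q] Q
      by (intro nn_integral_log_plus_reduced p) (auto simp: Apinf_integrable_iff[OF p])
    also have "\<dots> \<le> ennreal C" using w_bound[OF Q] by (intro ennreal_leI) (simp add: C_def)
    finally show ?thesis by (subst set_nn_integral_le_iff[OF _ Q]) auto
  qed
  \<comment> \<open>The measure is that of \<open>R\<close>, although \<open>S Q\<close> belongs to
    \<open>Q\<close>: \<open>log_plus_reduced_change\<close> compares an arbitrary invertible matrix
    with a reducing operator of \<open>R\<close>.\<close>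
  have change: "AE x in ?L. x \<in> R \<longrightarrow> \<psi> Q x \<le> t + K + \<psi> R x"
    if Q: "Q \<in> cubes n" and R: "R \<in> cubes n" and t: "0 \<le> t"
      and le: "(\<integral>\<^sup>+x\<in>R. ennreal (\<psi> Q x) \<partial>?L) \<le> ennreal t * emeasure ?L R" for Q R t
  proof -
    interpret weight_space "?U R" W by (rule weight_space_cube[OF W R])
    have [measurable]: "\<psi> Q \<in> borel_measurable ?L" by (rule meas[OF Q])
    have inv: "invertible (S Q)"
      using S[OF Q] weight_space.reducing_def[OF weight_space_cube[OF W Q]] by blast
    have "(\<integral>\<^sup>+x. ennreal (\<psi> Q x) \<partial>?U R) \<le> ennreal t"
      using le by (subst (asm) set_nn_integral_le_iff[OF _ R]) auto
    then have "AE y in ?U R. \<psi> Q y \<le> t + K + \<psi> R y"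
      unfolding \<psi>_def K_def by (rule log_plus_reduced_change[OF p S[OF R] inv t])
    then show ?thesis unfolding AE_uniform_measure_cube[OF R] .
  qed
  obtain \<delta> c where \<delta>: "0 < \<delta>" "0 \<le> c" and
    exp: "\<And>a l. 0 < l \<Longrightarrow> (\<integral>\<^sup>+x\<in>hcube n a l. ennreal (exp (\<delta> * \<psi> (hcube n a l) x)) \<partial>?L)
      \<le> ennreal c * emeasure ?L (hcube n a l)"
  proof (rule john_nirenberg[of C K \<psi> n])
    show "0 \<le> C" by (simp add: C_def)
    show "0 \<le> K" using K by simp
    show "0 \<le> \<psi> Q x" for Q x by (simp add: \<psi>_def)
  qed (use meas avg change hcube_in_cubes in blast)+
  \<comment> \<open>The summands secure \<open>q > 1\<close>, then \<open>q > p\<close> for Cordes'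
    inequality, and \<open>q - 1 \<ge> 1 / \<delta>\<close> for the available exponential
    integrability.\<close>
  define q where "q = 1 + p + 1 / \<delta>"
  have q: "1 < q" "p < q" "1 / (q - 1) \<le> \<delta>"
  proof -
    show "1 < q" "p < q" using p \<delta> by (simp_all add: q_def add_pos_pos)
    have "1 \<le> (p + 1 / \<delta>) * \<delta>" using p \<delta> by (simp add: distrib_right)
    then show "1 / (q - 1) \<le> \<delta>" using p \<delta> by (simp add: q_def divide_le_eq add_pos_pos mult.commute)
  qed
  have "Ap_const n q W \<le> ennreal (c powr (q - 1) * K)"
    unfolding Ap_const_gt_one[OF q(1)]
  proof (rule SUP_least)
    fix Q' assume Q': "Q' \<in> cubes n"
    \<comment> \<open>\<open>john_nirenberg\<close> speaks of half-open cubes; \<open>Q'\<close>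
      shares its normalised measure with one of them.\<close>
    obtain a l where l: "0 < l" and U: "?U Q' = ?U (hcube n a l)" by (rule uniform_measure_cube_eq_hcube[OF Q'])
    define Q where "Q = hcube n a l"
    have Q: "Q \<in> cubes n" unfolding Q_def by (rule hcube_in_cubes[OF l])
    interpret weight_space "?U Q" W by (rule weight_space_cube[OF W Q])
    have [measurable]: "\<psi> Q \<in> borel_measurable ?L" by (rule meas[OF Q])
    have "(\<integral>\<^sup>+y. ennreal (exp (\<delta> * \<psi> Q y)) \<partial>?U Q) \<le> ennreal c"
      using exp[OF l, of a] unfolding Q_def[symmetric] by (subst (asm) set_nn_integral_le_iff[OF _ Q]) auto
    then show "(\<integral>\<^sup>+x. ennreal_powr (\<integral>\<^sup>+y. ennreal (weight_ratio q W x y powr (q / (q - 1))) \<partial>?U Q') (q / (q / (q - 1))) \<partial>?U Q')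
        \<le> ennreal (c powr (q - 1) * K)"
      unfolding U Q_def[symmetric] \<psi>_def K_def
      by (intro Ap_bound_of_exponential_integrability[OF p q(1,2) S[OF Q] \<delta>(2) q(3)])
  qed
  then have "Ap_const n q W < \<infinity>" by (rule order_le_less_trans) simp
  then show ?thesis using q p by (intro exI[of _ q]) auto
qed

end

subsection \<open>The power weight\<close>

definition power_weight :: "real \<Rightarrow> 'm::finite matrix_fun" where
  "power_weight a x = diag_of (\<lambda>_. \<bar>x 0\<bar> powr a)"

lemma unitary_mat_one: "unitary_mat (mat 1)"
  by (simp add: unitary_mat_def)

lemma diag_of_conj_one: "diag_of d = mat 1 ** diag_of d ** mat_adjoint (mat 1)"
  by simp

lemma op_norm_diag_of_const: "op_norm (diag_of (\<lambda>_. c) :: complex^'m::finite^'m) = \<bar>c\<bar>"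
proof (rule antisym)
  show "op_norm (diag_of (\<lambda>_. c) :: complex^'m::finite^'m) \<le> \<bar>c\<bar>" by (rule op_norm_diag_of_le) simp
  have "diag_of (\<lambda>_. c) *v axis undefined 1 = of_real c *s (axis undefined 1 :: complex^'m)"
    by (simp add: vec_eq_iff diag_of_vector)
  then show "\<bar>c\<bar> \<le> op_norm (diag_of (\<lambda>_. c) :: complex^'m::finite^'m)"
    using norm_column_le_op_norm[of "diag_of (\<lambda>_. c) :: complex^'m::finite^'m" undefined]
    by (simp add: norm_vector_smult norm_axis_1)
qed

lemma weight_ratio_power_weight:
  "weight_ratio p (power_weight a :: 'm::finite matrix_fun) x y powr r = \<bar>x 0\<bar> powr (a / p * r) * \<bar>y 0\<bar> powr (- (a / p * r))"
proof -
  have rpow: "mat_rpow (power_weight a z :: complex^'m^'m) s = diag_of (\<lambda>_. \<bar>z 0\<bar> powr (a * s))" for z s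
    using mat_rpow_eqI[OF unitary_mat_one diag_of_conj_one, of "\<lambda>_. \<bar>z 0\<bar> powr a" s]
    by (simp add: power_weight_def powr_powr)
  show ?thesis
    unfolding weight_ratio_def rpow diag_of_mult op_norm_diag_of_const
    by (simp add: powr_mult powr_powr abs_mult)
qed

lemma measurable_lebesgue_n_component [measurable]:
  "i < n \<Longrightarrow> (\<lambda>x. x i) \<in> borel_measurable (lebesgue_n n)"
  unfolding lebesgue_n_def
  using measurable_completion[OF measurable_component_singleton[of i "{..<n}" "\<lambda>_. lborel :: real measure"]] by simp

lemma AE_lebesgue_n_component_nonzero:
  assumes "0 < n"
  shows "AE x in lebesgue_n n. x 0 \<noteq> 0"
proof -
  let ?N = "PiE {..<n} (\<lambda>i. if i = 0 then {0} else UNIV :: real set)"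
  have N: "?N \<in> sets (lebesgue_n n)" by (intro sets_lebesgue_nI sets_PiM_I_finite) auto
  have "emeasure (lebesgue_n n) ?N = (\<Prod>i<n. emeasure lborel (if i = 0 then {0} else UNIV :: real set))"
    by (rule emeasure_lebesgue_n_PiE) auto
  also have "\<dots> = 0" by (rule prod_zero) (use assms in \<open>auto intro!: bexI[of _ 0]\<close>)
  finally have "AE x in lebesgue_n n. x \<notin> ?N" using N by (intro AE_not_in) auto
  then show ?thesis using AE_space
    by eventually_elim (auto simp: space_lebesgue_n PiE_iff split: if_splits)
qed

text \<open>Compactness refers to functions on all of \<open>nat\<close>, measurability to the
  product over \<open>{..<n}\<close>. The inclusion map is Borel because the coordinates from
  \<open>n\<close> on are constant.\<close>

lemma sets_compact:
  assumes K: "compact K" "K \<subseteq> space (lebesgue_n n)"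
  shows "K \<in> sets (lebesgue_n n)"
proof -
  have "(\<lambda>x. x) \<in> borel_measurable (lebesgue_n n)"
  proof (rule measurable_coordinatewise_then_product)
    fix i
    show "(\<lambda>x. x i) \<in> borel_measurable (lebesgue_n n)"
    proof (cases "i < n")
      case False
      have "(\<lambda>x. x i) \<in> borel_measurable (lebesgue_n n) \<longleftrightarrow> (\<lambda>x. undefined :: real) \<in> borel_measurable (lebesgue_n n)"
        using False by (intro measurable_cong) (auto simp: space_lebesgue_n PiE_iff extensional_def)
      then show ?thesis by simp
    qed (rule measurable_lebesgue_n_component)
  qed
  from measurable_sets[OF this borel_closed[OF compact_imp_closed[OF K(1)]]]
  show ?thesis using K(2) by (simp add: Int_absorb2)
qed

lemma compact_component_bound:
  assumes "compact (K :: (nat \<Rightarrow> real) set)"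
  obtains b where "\<And>x. x \<in> K \<Longrightarrow> \<bar>x i\<bar> \<le> b"
proof -
  have "compact ((\<lambda>x. x i) ` K)"
    by (rule compact_continuous_image[OF continuous_on_subset[OF continuous_on_product_coordinates] assms]) simp
  then have "bounded ((\<lambda>x. x i) ` K)" by (rule compact_imp_bounded)
  then show ?thesis using that by (auto simp: bounded_iff)
qed

lemma emeasure_compact_finite:
  assumes K: "compact K" "K \<subseteq> space (lebesgue_n n)"
  shows "emeasure (lebesgue_n n) K < \<infinity>"
proof -
  have "\<exists>b. \<forall>x\<in>K. \<bar>x i\<bar> \<le> b" for i using compact_component_bound[OF K(1)] by metis
  then obtain b where b: "\<And>i x. x \<in> K \<Longrightarrow> \<bar>x i\<bar> \<le> b i" by metis
  have "K \<subseteq> PiE {..<n} (\<lambda>i. {- \<bar>b i\<bar>..\<bar>b i\<bar>})"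
  proof
    fix x assume x: "x \<in> K"
    have "x i \<in> {- \<bar>b i\<bar>..\<bar>b i\<bar>}" for i using b[OF x, of i] by auto
    then show "x \<in> PiE {..<n} (\<lambda>i. {- \<bar>b i\<bar>..\<bar>b i\<bar>})"
      using K(2) x by (auto simp: space_lebesgue_n PiE_iff)
  qed
  then have "emeasure (lebesgue_n n) K \<le> emeasure (lebesgue_n n) (PiE {..<n} (\<lambda>i. {- \<bar>b i\<bar>..\<bar>b i\<bar>}))"
    by (intro emeasure_mono sets_lebesgue_nI sets_PiM_I_finite) auto
  also have "\<dots> < \<infinity>" by (subst emeasure_lebesgue_n_PiE) (auto simp: prod_ennreal)
  finally show ?thesis .
qed

lemma matrix_weight_power_weight:
  assumes n: "0 < n" and a: "0 < a"
  shows "matrix_weight n (power_weight a :: 'm::finite matrix_fun)"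
  unfolding matrix_weight_def
proof (intro conjI ballI allI)
  show "nonneg_definite (power_weight a x :: complex^'m^'m)" for x
    using nonneg_definite_unitary_diag[of "\<lambda>_. \<bar>x 0\<bar> powr a" "mat 1"] by (simp add: power_weight_def)
  show "AE x in lebesgue_n n. invertible (power_weight a x :: complex^'m^'m)"
    using AE_lebesgue_n_component_nonzero[OF n]
  proof eventually_elim
    case (elim x)
    have "(power_weight a x :: complex^'m^'m) ** diag_of (\<lambda>_. \<bar>x 0\<bar> powr (- a)) = mat 1"
      using elim by (simp add: power_weight_def diag_of_mult diag_of_one powr_minus)
    then show ?case unfolding invertible_right_inverse by blast
  qed
  fix i j :: 'm
  show "locally_integrable n (\<lambda>x. (power_weight a x :: complex^'m^'m) $ i $ j)"
    unfolding locally_integrable_def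
  proof (intro allI impI, elim conjE)
    fix K assume K: "compact K" "K \<subseteq> space (lebesgue_n n)"
    obtain b where b: "\<And>x. x \<in> K \<Longrightarrow> \<bar>x 0\<bar> \<le> b" using compact_component_bound[OF K(1)] by metis
    have [measurable]: "K \<in> sets (lebesgue_n n)" "(\<lambda>x. x 0) \<in> borel_measurable (lebesgue_n n)"
      using sets_compact[OF K] n by auto
    show "set_integrable (lebesgue_n n) K (\<lambda>x. (power_weight a x :: complex^'m^'m) $ i $ j)"
      unfolding set_integrable_def
    proof (rule Bochner_Integration.integrable_bound)
      show "integrable (lebesgue_n n) (\<lambda>x. indicator K x * \<bar>b\<bar> powr a :: real)"
        using emeasure_compact_finite[OF K] by (intro integrable_mult_left integrable_real_indicator) auto
      show "AE x in lebesgue_n n. norm (indicator K x *\<^sub>R ((power_weight a x :: complex^'m^'m) $ i $ j))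
          \<le> norm (indicator K x * \<bar>b\<bar> powr a :: real)"
      proof (rule AE_I2)
        fix x
        have "\<bar>x 0\<bar> powr a \<le> \<bar>b\<bar> powr a" if "x \<in> K" using b[OF that] a by (intro powr_mono2) auto
        then show "norm (indicator K x *\<^sub>R ((power_weight a x :: complex^'m^'m) $ i $ j)) \<le> norm (indicator K x * \<bar>b\<bar> powr a :: real)"
          by (auto simp: power_weight_def diag_of_def indicator_def)
      qed
      show "(\<lambda>x. indicator K x *\<^sub>R ((power_weight a x :: complex^'m^'m) $ i $ j)) \<in> borel_measurable (lebesgue_n n)"
        unfolding power_weight_def diag_of_def by (cases "i = j") simp_all
    qed
  qed
qed

text \<open>The edges in the other directions cancel, leaving a ratio of one-dimensional
  lengths.\<close>

lemma emeasure_uniform_slab: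
  assumes n: "0 < n" and l: "0 < l" and J: "J \<in> sets borel"
  shows "emeasure (uniform_on n (hcube n a l)) {x \<in> space (lebesgue_n n). x 0 \<in> J}
    = emeasure lborel ({a 0..<a 0 + l} \<inter> J) / ennreal l"
proof -
  have [measurable]: "(\<lambda>x. x 0) \<in> borel_measurable (lebesgue_n n)" using n by measurable
  obtain m where m: "n = Suc m" using n by (cases n) auto
  define A where "A i = (if i = 0 then {a 0..<a 0 + l} \<inter> J else {a i..<a i + l})" for i
  have "hcube n a l \<inter> {x \<in> space (lebesgue_n n). x 0 \<in> J} = PiE {..<n} A"
  proof (intro set_eqI iffI)
    fix x assume "x \<in> hcube n a l \<inter> {x \<in> space (lebesgue_n n). x 0 \<in> J}"
    then show "x \<in> PiE {..<n} A" by (auto simp: hcube_def A_def PiE_iff)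
  next
    fix x assume x: "x \<in> PiE {..<n} A"
    then have A: "x i \<in> A i" if "i < n" for i using that by (auto simp: PiE_iff)
    have "x i \<in> {a i..<a i + l}" if "i < n" for i using A[OF that] by (cases "i = 0") (auto simp: A_def)
    moreover have "x 0 \<in> J" using A[OF n] by (simp add: A_def)
    ultimately show "x \<in> hcube n a l \<inter> {x \<in> space (lebesgue_n n). x 0 \<in> J}"
      using x by (simp add: hcube_def space_lebesgue_n PiE_iff)
  qed
  moreover have "emeasure (lebesgue_n n) (PiE {..<n} A) = (\<Prod>i<n. emeasure lborel (A i))"
    using J by (intro emeasure_lebesgue_n_PiE) (auto simp: A_def)
  moreover have "\<dots> = emeasure lborel ({a 0..<a 0 + l} \<inter> J) * ennreal (l ^ m)"
    unfolding m prod.lessThan_Suc_shift using l by (simp add: A_def ennreal_power)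
  ultimately have "emeasure (uniform_on n (hcube n a l)) {x \<in> space (lebesgue_n n). x 0 \<in> J}
      = emeasure lborel ({a 0..<a 0 + l} \<inter> J) * ennreal (l ^ m) / ennreal (l ^ n)"
    using J l sets_hcube[of n a l] by (subst emeasure_uniform_measure) (auto simp: emeasure_hcube)
  also have "\<dots> = emeasure lborel ({a 0..<a 0 + l} \<inter> J) / ennreal l"
  proof -
    have "emeasure lborel ({a 0..<a 0 + l} \<inter> J) \<le> emeasure lborel {a 0..<a 0 + l}"
      using J by (intro emeasure_mono) auto
    then have "emeasure lborel ({a 0..<a 0 + l} \<inter> J) < \<infinity>" using l by (simp add: order_le_less_trans)
    then obtain r where r: "0 \<le> r" "emeasure lborel ({a 0..<a 0 + l} \<inter> J) = ennreal r"
      by (cases "emeasure lborel ({a 0..<a 0 + l} \<inter> J)") auto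
    show ?thesis unfolding r(2) m using r(1) l
      by (simp add: ennreal_mult[symmetric] divide_ennreal)
  qed
  finally show ?thesis .
qed

text \<open>The right-hand side counts the \<open>k\<close> with \<open>2 ^ k \<le> t\<close>. There
  are at least \<open>m\<close> of them, \<open>m\<close> being the least number with
  \<open>t < 2 ^ m\<close>, and \<open>ln t \<le> m * ln 2 \<le> m\<close>. Integration turns the
  logarithm into measures of sets.\<close>

lemma ln_le_sum_dyadic_indicators:
  assumes "1 \<le> t"
  shows "ennreal (ln t) \<le> (\<Sum>k. indicator {k. 2 ^ k \<le> t} k)"
proof -
  obtain m0 where "t < 2 ^ m0" using real_arch_pow[of 2 t] by auto
  define m where "m = (LEAST m. t < 2 ^ m)"
  have m: "t < 2 ^ m" unfolding m_def by (rule LeastI[of "\<lambda>m. t < 2 ^ m", OF \<open>t < 2 ^ m0\<close>])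
  have less: "2 ^ k \<le> t" if "k < m" for k using not_less_Least[of k "\<lambda>m. t < 2 ^ m"] that by (simp add: m_def)
  have "ln t \<le> ln (2 ^ m)" using m assms by (subst ln_le_cancel_iff) auto
  also have "\<dots> = real m * ln 2" by (rule ln_realpow)
  also have "\<dots> \<le> real m * 1" using ln_le_minus_one[of 2] by (intro mult_left_mono) auto
  finally have "ennreal (ln t) \<le> (\<Sum>k<m. 1)" by (simp add: ennreal_of_nat_eq_real_of_nat ennreal_leI)
  also have "\<dots> = (\<Sum>k<m. indicator {k. 2 ^ k \<le> t} k)" using less by (intro sum.cong) auto
  also have "\<dots> \<le> (\<Sum>k. indicator {k. 2 ^ k \<le> t} k)" by (rule sum_le_suminf) auto
  finally show ?thesis .
qed

text \<open>If the edge is short compared with the distance from the hyperplane \<open>x 0 = 0\<close>, the integrand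
  is bounded by \<open>ln 2\<close>; otherwise sum the measures of the slabs \<open>\<bar>x 0\<bar> \<le> b / 2 ^ k\<close>.\<close>

lemma nn_integral_log_distance:
  fixes a :: "nat \<Rightarrow> real"
  assumes n: "0 < n" and l: "0 < l"
  defines "b \<equiv> max \<bar>a 0\<bar> \<bar>a 0 + l\<bar>"
  shows "(\<integral>\<^sup>+y. ennreal (ln (b / \<bar>y 0\<bar>)) \<partial>uniform_on n (hcube n a l)) \<le> ennreal 8"
    and "AE y in uniform_on n (hcube n a l). \<bar>y 0\<bar> \<le> b \<and> y 0 \<noteq> 0"
proof -
  let ?U = "uniform_on n (hcube n a l)"
  note Q = hcube_in_cubes[OF l, of n a]
  interpret prob_space ?U by (rule uniform_measure_cube[OF Q])
  have [measurable]: "(\<lambda>x. x 0) \<in> borel_measurable (lebesgue_n n)" using n by measurable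
  have b: "0 < b" using l by (auto simp: b_def max_def abs_if)
  have AE: "AE y in ?U. y \<in> hcube n a l \<and> y 0 \<noteq> 0"
    unfolding AE_uniform_measure_cube[OF Q] using AE_lebesgue_n_component_nonzero[OF n] by eventually_elim simp
  have le_b: "\<bar>y 0\<bar> \<le> b" if "y \<in> hcube n a l" for y
  proof -
    have "a 0 \<le> y 0" "y 0 < a 0 + l" using that n by (auto simp: hcube_def PiE_iff)
    then show ?thesis by (auto simp: b_def max_def abs_if)
  qed
  show "AE y in ?U. \<bar>y 0\<bar> \<le> b \<and> y 0 \<noteq> 0" using AE by eventually_elim (simp add: le_b)
  show "(\<integral>\<^sup>+y. ennreal (ln (b / \<bar>y 0\<bar>)) \<partial>?U) \<le> ennreal 8"
  proof (cases "l < b / 2")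
    case True
    have "(\<integral>\<^sup>+y. ennreal (ln (b / \<bar>y 0\<bar>)) \<partial>?U) \<le> (\<integral>\<^sup>+y. ennreal 8 \<partial>?U)"
    proof (rule nn_integral_mono_AE)
      show "AE y in ?U. ennreal (ln (b / \<bar>y 0\<bar>)) \<le> ennreal 8"
        using AE
      proof eventually_elim
        case (elim y)
        have "a 0 \<le> y 0" "y 0 < a 0 + l" using elim n by (auto simp: hcube_def PiE_iff)
        then have "b / 2 \<le> \<bar>y 0\<bar>" using True by (auto simp: b_def max_def abs_if split: if_splits)
        then have "b / \<bar>y 0\<bar> \<le> 2" using elim by (simp add: field_simps)
        then have "ln (b / \<bar>y 0\<bar>) \<le> ln 2" using b elim by (subst ln_le_cancel_iff) auto
        then show ?case using ln_le_minus_one[of 2] by (intro ennreal_leI) simp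
      qed
    qed
    then show ?thesis using emeasure_space_1 by simp
  next
    case False
    define A where "A k = {x \<in> space (lebesgue_n n). x 0 \<in> {- (b / 2 ^ k)..b / 2 ^ k}}" for k :: nat
    have [measurable]: "A k \<in> sets (lebesgue_n n)" for k unfolding A_def by measurable
    have "(\<integral>\<^sup>+y. ennreal (ln (b / \<bar>y 0\<bar>)) \<partial>?U) \<le> (\<integral>\<^sup>+y. (\<Sum>k. indicator (A k) y) \<partial>?U)"
    proof (rule nn_integral_mono_AE)
      show "AE y in ?U. ennreal (ln (b / \<bar>y 0\<bar>)) \<le> (\<Sum>k. indicator (A k) y)"
        using AE AE_space
      proof eventually_elim
        case (elim y)
        have "1 \<le> b / \<bar>y 0\<bar>" using le_b[of y] elim by simp
        from ln_le_sum_dyadic_indicators[OF this]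
        have "ennreal (ln (b / \<bar>y 0\<bar>)) \<le> (\<Sum>k. indicator {k. 2 ^ k \<le> b / \<bar>y 0\<bar>} k)" .
        also have "\<dots> = (\<Sum>k. indicator (A k) y)"
        proof (intro suminf_cong)
          fix k
          have "2 ^ k \<le> b / \<bar>y 0\<bar> \<longleftrightarrow> \<bar>y 0\<bar> \<le> b / 2 ^ k" using elim by (simp add: field_simps)
          also have "\<dots> \<longleftrightarrow> y \<in> A k" using elim by (auto simp: A_def abs_le_iff)
          finally show "indicator {k. 2 ^ k \<le> b / \<bar>y 0\<bar>} k = (indicator (A k) y :: ennreal)"
            by (simp add: indicator_def)
        qed
        finally show ?case .
      qed
    qed
    also have "\<dots> = (\<Sum>k. emeasure ?U (A k))" by (subst nn_integral_suminf) auto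
    also have "\<dots> \<le> (\<Sum>k. ennreal (4 * (1 / 2) ^ k))"
    proof (rule suminf_le)
      fix k
      have "emeasure ?U (A k) = emeasure lborel ({a 0..<a 0 + l} \<inter> {- (b / 2 ^ k)..b / 2 ^ k}) / ennreal l"
        unfolding A_def by (rule emeasure_uniform_slab[OF n l]) simp
      also have "\<dots> \<le> emeasure lborel {- (b / 2 ^ k)..b / 2 ^ k} / ennreal l"
        by (intro divide_right_mono_ennreal emeasure_mono) auto
      also have "\<dots> = ennreal (2 * (b / 2 ^ k) / l)" using b l by (simp add: divide_ennreal)
      \<comment> \<open>The case assumption \<open>l \<ge> b / 2\<close> gives
        \<open>4 / 2 ^ k\<close>; these numbers add up to 8.\<close>
      also have "\<dots> \<le> ennreal (4 * (1 / 2) ^ k)"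
        using False l b by (intro ennreal_leI) (simp add: field_simps power_one_over)
      finally show "emeasure ?U (A k) \<le> ennreal (4 * (1 / 2) ^ k)" .
    qed auto
    also have "\<dots> = ennreal 8"
    proof -
      have "(\<lambda>k. 4 * (1 / 2) ^ k) sums (4 * (1 / (1 - 1 / 2)) :: real)"
        by (intro sums_mult geometric_sums) simp
      then show ?thesis by (intro suminf_ennreal_eq) auto
    qed
    finally show ?thesis .
  qed
qed

text \<open>With \<open>b\<close> the largest value of \<open>\<bar>x 0\<bar>\<close> on the closed
  cube, \<open>ratio_integral\<close> is at most \<open>(b / \<bar>y 0\<bar>) powr a\<close>. The
  logarithm of this has mean at most \<open>8 * a\<close> on every cube, near the hyperplane or far
  from it, however large \<open>a\<close> is.\<close>

lemma power_weight_in_Apinf: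
  assumes n: "0 < n" and a: "0 < a" and p: "0 < p"
  shows "(power_weight a :: 'm::finite matrix_fun) \<in> Apinf_class n p"
proof -
  let ?W = "power_weight a :: 'm matrix_fun"
  note W = matrix_weight_power_weight[OF n a, where 'm = 'm]
  have *: "integrable (uniform_on n Q') (\<lambda>y. log_plus (ratio_integral_on n ?W Q' p y))"
    "exp (\<integral>y. ln (ratio_integral_on n ?W Q' p y) \<partial>uniform_on n Q') \<le> exp (8 * a)"
    if Q': "Q' \<in> cubes n" for Q'
  proof -
    obtain c l where l: "0 < l" and U: "uniform_on n Q' = uniform_on n (hcube n c l)"
      by (rule uniform_measure_cube_eq_hcube[OF Q'])
    define M where "M = uniform_on n (hcube n c l)"
    interpret weight_space M ?W unfolding M_def by (rule weight_space_cube[OF W hcube_in_cubes[OF l]])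
    define b where "b = max \<bar>c 0\<bar> \<bar>c 0 + l\<bar>"
    have AE: "AE y in M. \<bar>y 0\<bar> \<le> b \<and> y 0 \<noteq> 0" and nn: "(\<integral>\<^sup>+y. ennreal (ln (b / \<bar>y 0\<bar>)) \<partial>M) \<le> ennreal 8"
      unfolding M_def b_def by (rule nn_integral_log_distance[OF n l])+
    have [measurable]: "(\<lambda>x. x 0) \<in> borel_measurable M" unfolding M_def using n by simp
    define g where "g y = a * ln (b / \<bar>y 0\<bar>)" for y :: "nat \<Rightarrow> real"
    have [measurable]: "g \<in> borel_measurable M" unfolding g_def[abs_def] by measurable
    have g0: "AE y in M. 0 \<le> g y" using AE
    proof eventually_elim
      case (elim y)
      then have "1 \<le> b / \<bar>y 0\<bar>" by simp
      then show ?case unfolding g_def using a by (intro mult_nonneg_nonneg ln_ge_zero) auto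
    qed
    have g8: "(\<integral>\<^sup>+y. ennreal (g y) \<partial>M) \<le> ennreal (8 * a)"
    proof -
      have "(\<integral>\<^sup>+y. ennreal (g y) \<partial>M) = (\<integral>\<^sup>+y. ennreal a * ennreal (ln (b / \<bar>y 0\<bar>)) \<partial>M)"
        unfolding g_def using a by (intro nn_integral_cong ennreal_mult') simp
      also have "\<dots> = ennreal a * (\<integral>\<^sup>+y. ennreal (ln (b / \<bar>y 0\<bar>)) \<partial>M)" by (rule nn_integral_cmult) measurable
      also have "\<dots> \<le> ennreal a * ennreal 8" by (intro mult_left_mono nn) simp
      also have "\<dots> = ennreal (8 * a)" using a by (subst ennreal_mult[symmetric]) (auto simp: mult.commute)
      finally show ?thesis .
    qed
    have g: "integrable M g"
    proof (rule integrableI_nonneg)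
      show "(\<integral>\<^sup>+y. ennreal (g y) \<partial>M) < \<infinity>" using g8 by (rule order_le_less_trans) simp
    qed (use g0 in simp_all)
    have gi: "(\<integral>y. g y \<partial>M) \<le> 8 * a"
      using g8 a unfolding nn_integral_eq_integral[OF g g0] by (subst (asm) ennreal_le_iff) auto
    have upper: "AE y in M. ln (ratio_integral p y) \<le> g y"
      using AE AE_ratio_integral_pos[OF p]
    proof eventually_elim
      case (elim y)
      have "ratio_integral p y \<le> (\<integral>x. b powr a * \<bar>y 0\<bar> powr (- a) \<partial>M)"
        unfolding ratio_integral_def
      proof (rule integral_mono_AE[OF integrable_weight_ratio[OF p]])
        show "AE x in M. weight_ratio p ?W x y powr p \<le> b powr a * \<bar>y 0\<bar> powr (- a)"
          using AE
        proof eventually_elim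
          case (elim x)
          then have "\<bar>x 0\<bar> powr a \<le> b powr a" using a by (intro powr_mono2) auto
          then show ?case unfolding weight_ratio_power_weight using p by (simp add: mult_right_mono)
        qed
      qed simp
      also have "\<dots> = (b / \<bar>y 0\<bar>) powr a"
        using elim by (simp add: prob_space powr_divide powr_minus_divide)
      finally have "ln (ratio_integral p y) \<le> ln ((b / \<bar>y 0\<bar>) powr a)"
        using elim by (subst ln_le_cancel_iff) auto
      also have "\<dots> = g y" using elim by (simp add: g_def ln_powr)
      finally show ?case .
    qed
    have int: "integrable M (\<lambda>y. log_plus (ratio_integral p y))"
    proof (rule Bochner_Integration.integrable_bound[OF g])
      show "AE y in M. norm (log_plus (ratio_integral p y)) \<le> norm (g y)"
        using upper g0 by eventually_elim (auto simp: log_plus_def)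
    qed measurable
    then show "integrable (uniform_on n Q') (\<lambda>y. log_plus (ratio_integral_on n ?W Q' p y))"
      unfolding U M_def .
    have "(\<integral>y. ln (ratio_integral p y) \<partial>M) \<le> (\<integral>y. g y \<partial>M)"
      by (rule integral_mono_AE[OF integrable_ln_ratio_integral[OF p int] g upper])
    then have "exp (\<integral>y. ln (ratio_integral p y) \<partial>M) \<le> exp (8 * a)" using gi by simp
    then show "exp (\<integral>y. ln (ratio_integral_on n ?W Q' p y) \<partial>uniform_on n Q') \<le> exp (8 * a)"
      unfolding U M_def .
  qed
  have int: "Apinf_integrable n p ?W" unfolding Apinf_integrable_iff[OF W p] using *(1) by blast
  have "Apinf_const n p ?W \<le> ennreal (exp (8 * a))"
    unfolding Apinf_const_eq[OF W p int] by (intro SUP_least ennreal_leI *(2))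
  then have "Apinf_const n p ?W < \<infinity>" by (rule order_le_less_trans) simp
  then show ?thesis using W int by (simp add: Apinf_class_def)
qed

text \<open>The unit cube at the origin is a bad one. For \<open>p \<le> 1\<close>,
  \<open>ratio_integral\<close> is a multiple of \<open>\<bar>y 0\<bar> powr (- (2 * p))\<close> and
  unbounded; for \<open>p > 1\<close> the inner integral is that of
  \<open>\<bar>y 0\<bar> powr (- (2 * r))\<close> up to a factor, and it diverges since
  \<open>r \<ge> 1\<close>.\<close>

lemma power_weight_not_in_Ap:
  assumes n: "0 < n" and p: "0 < p"
  shows "(power_weight (2 * p) :: 'm::finite matrix_fun) \<notin> Ap_class n p"
proof
  let ?W = "power_weight (2 * p) :: 'm matrix_fun"
  assume "?W \<in> Ap_class n p"
  then have fin: "Ap_const n p ?W < \<infinity>" by (simp add: Ap_class_def)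
  have W: "matrix_weight n ?W" using p by (intro matrix_weight_power_weight n) simp
  define Q where "Q = hcube n (\<lambda>_. 0) 1"
  have Q: "Q \<in> cubes n" unfolding Q_def by (rule hcube_in_cubes) simp
  define M where "M = uniform_on n Q"
  interpret weight_space M ?W unfolding M_def by (rule weight_space_cube[OF W Q])
  have [measurable]: "(\<lambda>x. x 0) \<in> borel_measurable M" unfolding M_def using n by simp
  define A where "A e = {x \<in> space M. x 0 \<in> {0<..e}}" for e :: real
  have [measurable]: "A e \<in> sets M" for e unfolding A_def by measurable
  \<comment> \<open>Stopping at \<open>e / 2\<close> avoids the excluded right end of the half-open
    cube when \<open>e = 1\<close>.\<close>
  have A: "emeasure M (A e) \<ge> ennreal (e / 2)" if "0 < e" "e \<le> 1" for e
  proof -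
    have "emeasure M (A e) = emeasure lborel ({0..<0 + 1} \<inter> {0<..e}) / ennreal 1"
      using emeasure_uniform_slab[OF n zero_less_one, of "{0<..e}" "\<lambda>_. 0"] by (simp add: A_def M_def Q_def)
    also have "\<dots> = emeasure lborel ({0..<1} \<inter> {0<..e})" by (simp add: divide_ennreal_def)
    also have "\<dots> \<ge> emeasure lborel {0<..e / 2}" using that by (intro emeasure_mono) auto
    finally show ?thesis using that by simp
  qed
  show False
  proof (cases "p \<le> 1")
    case True
    obtain c where c: "0 \<le> c" "Ap_const n p ?W = ennreal c" using fin by (cases "Ap_const n p ?W") auto
    define I where "I = (\<integral>x. \<bar>x 0\<bar> powr (2 * p) \<partial>M)"
    have RI: "ratio_integral p y = I * \<bar>y 0\<bar> powr (- (2 * p))" for y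
      unfolding ratio_integral_def weight_ratio_power_weight I_def using p by simp
    have AE: "AE y in M. ratio_integral p y \<le> c"
      using Ap_const_le_one[OF W p True Q] p unfolding c(2) M_def by (auto elim!: eventually_mono simp: c(1))
    have "0 < I"
    proof (rule ccontr)
      assume "\<not> 0 < I"
      have "AE y in M. False" using AE_ratio_integral_pos[OF p]
        by eventually_elim (use \<open>\<not> 0 < I\<close> in \<open>auto simp: RI zero_less_mult_iff\<close>)
      then show False by simp
    qed
    \<comment> \<open>Small enough that \<open>ratio_integral\<close> is at least
      \<open>c + 1\<close> on \<open>A e\<close>, a set of positive measure.\<close>
    define e where "e = min 1 ((I / (c + 1)) powr (1 / (2 * p)))"
    have e: "0 < e" "e \<le> 1" using \<open>0 < I\<close> c(1) by (simp_all add: e_def)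
    have "AE y in M. y \<notin> A e"
      using AE
    proof eventually_elim
      case (elim y)
      show ?case
      proof
        assume "y \<in> A e"
        then have y: "0 < y 0" "y 0 \<le> (I / (c + 1)) powr (1 / (2 * p))" by (auto simp: A_def e_def)
        then have "y 0 powr (2 * p) \<le> ((I / (c + 1)) powr (1 / (2 * p))) powr (2 * p)"
          using p by (intro powr_mono2) auto
        also have "\<dots> = I / (c + 1)" using p \<open>0 < I\<close> c(1) by (simp add: powr_powr)
        finally have "c + 1 \<le> I * y 0 powr (- (2 * p))"
          using y c(1) by (simp add: powr_minus field_simps)
        then show False using elim y(1) by (simp add: RI)
      qed
    qed
    then have "emeasure M (A e) = 0" by (subst (asm) AE_iff_measurable[of "A e"]) (auto simp: A_def)
    then show False using A[OF e] e by simp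
  next
    case False
    then have p1: "1 < p" by simp
    define r where "r = p / (p - 1)"
    have r: "1 \<le> r" using p1 by (simp add: r_def field_simps)
    have "(\<integral>\<^sup>+x. ennreal_powr (\<integral>\<^sup>+y. ennreal (weight_ratio p ?W x y powr r) \<partial>M) (p / r) \<partial>M) \<le> Ap_const n p ?W"
      unfolding Ap_const_gt_one[OF W p1] r_def M_def by (rule SUP_upper[OF Q])
    then have "(\<integral>\<^sup>+x. ennreal_powr (\<integral>\<^sup>+y. ennreal (weight_ratio p ?W x y powr r) \<partial>M) (p / r) \<partial>M) < \<infinity>"
      using fin by (rule order_le_less_trans)
    from finite_inner_integral[OF this] obtain x where x: "invertible (?W x)"
      "(\<integral>\<^sup>+y. ennreal (weight_ratio p ?W x y powr r) \<partial>M) < \<infinity>" by blast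
    then obtain h where h: "0 \<le> h" "(\<integral>\<^sup>+y. ennreal (weight_ratio p ?W x y powr r) \<partial>M) = ennreal h"
      by (cases "\<integral>\<^sup>+y. ennreal (weight_ratio p ?W x y powr r) \<partial>M") auto
    have "x 0 \<noteq> 0"
    proof
      assume "x 0 = 0"
      then have "op_norm (?W x) = 0" unfolding power_weight_def op_norm_diag_of_const by simp
      then show False using op_norm_pos[OF x(1)] by simp
    qed
    define b where "b = \<bar>x 0\<bar> powr (2 * r)"
    have b: "0 < b" using \<open>x 0 \<noteq> 0\<close> by (simp add: b_def)
    have ratio: "weight_ratio p ?W x y powr r = b * \<bar>y 0\<bar> powr (- (2 * r))" for y
      unfolding weight_ratio_power_weight b_def using p by simp
    \<comment> \<open>Chebyshev's inequality: on \<open>A e\<close> the integrand is at least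
      \<open>b * e powr (- 2)\<close>, and the measure of \<open>A e\<close> is at least
      \<open>e / 2\<close>.\<close>
    have low: "b / (2 * e) \<le> h" if e: "0 < e" "e \<le> 1" for e
    proof -
      have "b / (2 * e) = (b * e powr (- 2)) * (e / 2)"
        using e by (simp add: powr_minus powr_numeral field_simps power2_eq_square)
      also have "ennreal \<dots> \<le> ennreal (b * e powr (- 2)) * emeasure M (A e)"
        using b e A[OF e] by (subst ennreal_mult) (auto intro!: mult_left_mono)
      also have "\<dots> = (\<integral>\<^sup>+y. ennreal (b * e powr (- 2)) * indicator (A e) y \<partial>M)"
        by (rule nn_integral_cmult_indicator[symmetric]) simp
      also have "\<dots> \<le> (\<integral>\<^sup>+y. ennreal (weight_ratio p ?W x y powr r) \<partial>M)"
      proof (rule nn_integral_mono)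
        fix y
        show "ennreal (b * e powr (- 2)) * indicator (A e) y \<le> ennreal (weight_ratio p ?W x y powr r)"
        proof (cases "y \<in> A e")
          case True
          then have y: "0 < y 0" "y 0 \<le> e" by (auto simp: A_def)
          have "e powr (- 2) \<le> y 0 powr (- 2)" using y e by (intro powr_mono2') auto
          also have "\<dots> \<le> y 0 powr (- (2 * r))" using y e r by (intro powr_mono') auto
          finally show ?thesis using True y b unfolding ratio by (simp add: ennreal_leI)
        qed simp
      qed
      also have "\<dots> = ennreal h" by (rule h(2))
      finally show ?thesis using h(1) by simp
    qed
    \<comment> \<open>Solves \<open>b / (2 * e) \<ge> h + 1\<close>, against the bound
      \<open>h\<close>.\<close>
    define e where "e = min 1 (b / (2 * (h + 1)))"
    have e: "0 < e" "e \<le> 1" using b h(1) by (simp_all add: e_def)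
    have "e \<le> b / (2 * (h + 1))" by (simp add: e_def)
    then have "h + 1 \<le> b / (2 * e)" using e h(1) by (simp add: field_simps)
    with low[OF e] show False by simp
  qed
qed

theorem proposition4p2:
  fixes p :: real
  assumes "p > 0"
  shows
    "(\<forall>q>p.
        (\<forall>n\<ge>1. (Apinf_class n p :: 'm::finite matrix_fun set) \<subseteq> Apinf_class n q) \<and>
        (\<exists>C::real. C > 0 \<and>
          (\<forall>n\<ge>1. \<forall>W :: 'm matrix_fun. matrix_weight n W \<longrightarrow>
             Apinf_const n q W \<le> ennreal C * Apinf_const n p W))) \<and>
     (\<forall>n\<ge>1. (Ap_class n p :: 'm matrix_fun set) \<subset> Apinf_class n p \<and>
        (Apinf_class n p :: 'm matrix_fun set) \<subseteq> (\<Union>q\<in>{0<..}. Ap_class n q)) \<and>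
     (\<exists>C::real. C > 0 \<and> (p \<le> 1 \<longrightarrow> C = 1) \<and>
        (\<forall>n\<ge>1. \<forall>W :: 'm matrix_fun. matrix_weight n W \<longrightarrow>
           Apinf_const n p W \<le> ennreal C * Ap_const n p W))"
proof (intro conjI allI impI)
  fix q :: real and n :: nat assume q: "p < q"
  show "(Apinf_class n p :: 'm matrix_fun set) \<subseteq> Apinf_class n q"
  proof
    fix W :: "'m matrix_fun" assume "W \<in> Apinf_class n p"
    then have W: "matrix_weight n W" "Apinf_integrable n p W" "Apinf_const n p W < \<infinity>"
      by (simp_all add: Apinf_class_def)
    then show "W \<in> Apinf_class n q"
      using Apinf_mono(1)[OF W(1) assms q W(2)] order_le_less_trans[OF Apinf_mono(2)[OF W(1) assms q] W(3)]
      by (simp add: Apinf_class_def)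
  qed
next
  fix q :: real assume q: "p < q"
  show "\<exists>C::real. C > 0 \<and> (\<forall>n\<ge>1. \<forall>W :: 'm matrix_fun. matrix_weight n W \<longrightarrow>
      Apinf_const n q W \<le> ennreal C * Apinf_const n p W)"
    by (rule exI[of _ 1]) (auto intro: Apinf_mono(2)[OF _ assms q])
next
  fix n :: nat assume n: "1 \<le> n"
  have "W \<in> Apinf_class n p" if "W \<in> Ap_class n p" for W :: "'m matrix_fun"
  proof -
    have W: "matrix_weight n W" "Ap_const n p W < \<infinity>" using that by (auto simp: Ap_class_def)
    show ?thesis
    proof (cases "p \<le> 1")
      case True
      show ?thesis
        using W Apinf_of_Ap_le_one[OF W(1) assms True] by (auto simp: Apinf_class_def intro: order_le_less_trans)
    next
      case False
      then have p: "1 < p" by simp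
      show ?thesis
        using W Apinf_of_Ap_gt_one(1)[OF W(1) p W(2)] order_le_less_trans[OF Apinf_of_Ap_gt_one(2)[OF W(1) p], of \<infinity>]
        by (simp add: Apinf_class_def ennreal_mult_less_top)
    qed
  qed
  moreover have "(power_weight (2 * p) :: 'm matrix_fun) \<in> Apinf_class n p" "(power_weight (2 * p) :: 'm matrix_fun) \<notin> Ap_class n p"
    using n assms power_weight_in_Apinf[of n "2 * p" p, where 'm = 'm] power_weight_not_in_Ap[of n p, where 'm = 'm] by auto
  ultimately show "(Ap_class n p :: 'm matrix_fun set) \<subset> Apinf_class n p" by blast
  show "(Apinf_class n p :: 'm matrix_fun set) \<subseteq> (\<Union>q\<in>{0<..}. Ap_class n q)"
    using Ap_of_Apinf[OF _ assms] by (auto simp: Apinf_class_def Ap_class_def)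
next
  show "\<exists>C::real. C > 0 \<and> (p \<le> 1 \<longrightarrow> C = 1) \<and> (\<forall>n\<ge>1. \<forall>W :: 'm matrix_fun. matrix_weight n W \<longrightarrow>
      Apinf_const n p W \<le> ennreal C * Ap_const n p W)"
  proof (cases "p \<le> 1")
    case True
    then show ?thesis using Apinf_of_Ap_le_one(2)[OF _ assms True] by (intro exI[of _ 1]) auto
  next
    case False
    then have p: "1 < p" by simp
    \<comment> \<open>The witness is the constant of \<open>Apinf_of_Ap_gt_one\<close>: a product of
      powers of the matrix size with exponents depending on \<open>p\<close>, fixed before
      \<open>n\<close>.\<close>
    show ?thesis
      using p Apinf_of_Ap_gt_one(2)[OF _ p, where 'm = 'm]
      by (intro exI[of _ "(real CARD('m) powr (2 * p + 2))\<^sup>2 * (real CARD('m) powr (2 * (p / (p - 1)) + 2)) powr (2 * (p / (p / (p - 1))))"]) auto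
  qed
qed

end
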